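(* Let $N\ge2$, let $k,\ell\ge1$ be integers and let $p\in[1,\infty)$. Let $$W^{k,\ell,p}(\mathbb R^N_+;\partial\mathbb R^N_+)=\left\{u\in W^{k,p}(\mathbb R^N_+)\,:\,u_{|\partial\mathbb R^N_+}\in W^{\ell,p}(\partial\mathbb R^N_+)\right\},$$ endowed with the norm of the pair $(u,u_{|\partial\mathbb R^N_+})$ in the product space $W^{k,p}(\mathbb R^N_+)\times W^{\ell,p}(\partial\mathbb R^N_+)$, where $u_{|\partial\mathbb R^N_+}$ denotes the trace of $u$ on $\partial\mathbb R^N_+$. Then $$\left\{u\big|_{\mathbb R^N_+}\,:\,u\in C^\infty(\mathbb R^N)\right\}\cap W^{k,\ell,p}(\mathbb R^N_+;\partial\mathbb R^N_+)$$ is dense in $W^{k,\ell,p}(\mathbb R^N_+;\partial\mathbb R^N_+)$.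
   Context: Points of $\mathbb R^N$ are written $x=(x',x_N)$ with $x'\in\mathbb R^{N-1}$, $x_N\in\mathbb R$; $\mathbb R^N_+=\{x\in\mathbb R^N: x_N>0\}$ and $\partial\mathbb R^N_+=\{(x',0):x'\in\mathbb R^{N-1}\}$. The space $W^{\ell,p}(\partial\mathbb R^N_+)$ is identified with $W^{\ell,p}(\mathbb R^{N-1})$ via $(x',0)\leftrightarrow x'$. The trace $u_{|\partial\mathbb R^N_+}$ is the usual trace operator on $W^{k,p}(\mathbb R^N_+)$, $k\ge1$; it is the ordinary restriction to $\partial\mathbb R^N_+$ when $u$ is continuous up to the boundary. *)

theory Defs
  imports "HOL-Analysis.Analysis" "HOL-Library.Multiset"
begin

section \<open>Smooth functions and test functions\<close>

primrec iter_partial :: "'a::euclidean_space list \<Rightarrow> ('a \<Rightarrow> real) \<Rightarrow> 'a \<Rightarrow> real" where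
  "iter_partial [] f = f"
| "iter_partial (b # bs) f = (\<lambda>x. frechet_derivative (iter_partial bs f) (at x) b)"

text \<open>
  \<open>f\<close> is infinitely differentiable on the whole space: every iterated partial derivative
  is differentiable at every point (hence also continuous).
\<close>

definition smooth :: "('a::euclidean_space \<Rightarrow> real) \<Rightarrow> bool" where
  "smooth f \<longleftrightarrow> (\<forall>bs. set bs \<subseteq> Basis \<longrightarrow> iter_partial bs f differentiable_on UNIV)"

definition test_functions :: "'a::euclidean_space set \<Rightarrow> ('a \<Rightarrow> real) set" where
  "test_functions \<Omega> =
     {\<phi>. smooth \<phi> \<and> compact (closure {x. \<phi> x \<noteq> 0}) \<and> closure {x. \<phi> x \<noteq> 0} \<subseteq> \<Omega>}"

section \<open>Lebesgue and Sobolev spaces\<close>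

text \<open>
  Elements of the function spaces on \<open>\<Omega>\<close> are represented by functions on the whole type, of which
  only the values on \<open>\<Omega>\<close>, up to Lebesgue null sets, are relevant. The norms below are meaningful
  on the corresponding spaces only: the Bochner integral of a non-integrable function is \<open>0\<close>.
\<close>

definition Lp :: "real \<Rightarrow> 'a::euclidean_space set \<Rightarrow> ('a \<Rightarrow> real) set" where
  "Lp p \<Omega> = {u. u \<in> borel_measurable (lebesgue_on \<Omega>) \<and>
                  integrable (lebesgue_on \<Omega>) (\<lambda>x. \<bar>u x\<bar> powr p)}"

definition Lp_norm :: "real \<Rightarrow> 'a::euclidean_space set \<Rightarrow> ('a \<Rightarrow> real) \<Rightarrow> real" where
  "Lp_norm p \<Omega> u = (LINT x|lebesgue_on \<Omega>. \<bar>u x\<bar> powr p) powr (1 / p)"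

definition locally_integrable :: "'a::euclidean_space set \<Rightarrow> ('a \<Rightarrow> real) \<Rightarrow> bool" where
  "locally_integrable \<Omega> u \<longleftrightarrow> (\<forall>K. compact K \<and> K \<subseteq> \<Omega> \<longrightarrow> integrable (lebesgue_on K) u)"

text \<open>
  A multi-index is a multiset of basis vectors: \<open>count \<alpha> b\<close> is the number of differentiations in
  direction \<open>b\<close>, and \<open>size \<alpha>\<close> is the order. The partial derivative of order \<open>\<alpha>\<close> of a smooth function
  is \<open>iter_partial bs\<close> for any enumeration \<open>bs\<close> of \<open>\<alpha>\<close>; all enumerations give the same function.
\<close>

definition multi_indices :: "nat \<Rightarrow> 'a::euclidean_space multiset set" where
  "multi_indices k = {\<alpha>. set_mset \<alpha> \<subseteq> Basis \<and> size \<alpha> \<le> k}"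

lemma finite_multi_indices: "finite (multi_indices k :: 'a::euclidean_space multiset set)"
proof (rule finite_subset)
  show "multi_indices k \<subseteq> mset ` {xs. set xs \<subseteq> (Basis :: 'a set) \<and> length xs \<le> k}"
  proof
    fix \<alpha> :: "'a multiset"
    assume "\<alpha> \<in> multi_indices k"
    moreover obtain xs where "mset xs = \<alpha>"
      using ex_mset by blast
    ultimately show "\<alpha> \<in> mset ` {xs. set xs \<subseteq> (Basis :: 'a set) \<and> length xs \<le> k}"
      unfolding multi_indices_def by force
  qed
  show "finite (mset ` {xs. set xs \<subseteq> (Basis :: 'a set) \<and> length xs \<le> k})"
    by (intro finite_imageI finite_lists_length_le finite_Basis)
qed

definition has_weak_deriv ::
  "'a::euclidean_space set \<Rightarrow> 'a multiset \<Rightarrow> ('a \<Rightarrow> real) \<Rightarrow> ('a \<Rightarrow> real) \<Rightarrow> bool" where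
  "has_weak_deriv \<Omega> \<alpha> u v \<longleftrightarrow>
     locally_integrable \<Omega> u \<and> locally_integrable \<Omega> v \<and>
     (\<forall>\<phi>\<in>test_functions \<Omega>. \<forall>bs. mset bs = \<alpha> \<longrightarrow>
        (LINT x|lebesgue_on \<Omega>. u x * iter_partial bs \<phi> x) =
        (-1) ^ size \<alpha> * (LINT x|lebesgue_on \<Omega>. v x * \<phi> x))"

text \<open>On an open set weak derivatives are unique up to null sets, so the choice is immaterial.\<close>

definition weak_deriv ::
  "'a::euclidean_space set \<Rightarrow> 'a multiset \<Rightarrow> ('a \<Rightarrow> real) \<Rightarrow> 'a \<Rightarrow> real" where
  "weak_deriv \<Omega> \<alpha> u = (SOME v. has_weak_deriv \<Omega> \<alpha> u v)"

definition Sobolev :: "nat \<Rightarrow> real \<Rightarrow> 'a::euclidean_space set \<Rightarrow> ('a \<Rightarrow> real) set" where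
  "Sobolev k p \<Omega> =
     {u \<in> Lp p \<Omega>. \<forall>\<alpha>\<in>multi_indices k. \<exists>v\<in>Lp p \<Omega>. has_weak_deriv \<Omega> \<alpha> u v}"

definition Sobolev_norm :: "nat \<Rightarrow> real \<Rightarrow> 'a::euclidean_space set \<Rightarrow> ('a \<Rightarrow> real) \<Rightarrow> real" where
  "Sobolev_norm k p \<Omega> u =
     (\<Sum>\<alpha>\<in>multi_indices k. Lp_norm p \<Omega> (weak_deriv \<Omega> \<alpha> u) powr p) powr (1 / p)"

section \<open>The half-space and traces\<close>

text \<open>
  The space of dimension \<open>N = CARD('n) + 1 \<ge> 2\<close> is \<open>(real^'n) \<times> real\<close>, with points \<open>(x', x\<^sub>N)\<close>;
  functions on the boundary of the half-space are functions of \<open>x'\<close>.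
\<close>

definition half_space :: "((real^'n) \<times> real) set" where
  "half_space = {x. snd x > 0}"

text \<open>
  The trace operator is the continuous extension to first-order Sobolev functions of the restriction
  map \<open>\<phi> \<mapsto> \<phi>(\<cdot>, 0)\<close>, defined on the (dense) restrictions to the half-space of smooth functions
  with compact support in the whole space.
\<close>

definition has_trace ::
  "real \<Rightarrow> ((real^'n) \<times> real \<Rightarrow> real) \<Rightarrow> (real^'n \<Rightarrow> real) \<Rightarrow> bool" where
  "has_trace p u g \<longleftrightarrow>
     u \<in> Sobolev 1 p half_space \<and> g \<in> Lp p UNIV \<and>
     (\<exists>\<phi>. (\<forall>n::nat. \<phi> n \<in> test_functions UNIV) \<and>
          (\<lambda>n. Sobolev_norm 1 p half_space (\<lambda>x. \<phi> n x - u x)) \<longlonglongrightarrow> 0 \<and>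
          (\<lambda>n. Lp_norm p UNIV (\<lambda>x'. \<phi> n (x', 0) - g x')) \<longlonglongrightarrow> 0)"

definition boundary_trace :: "real \<Rightarrow> ((real^'n) \<times> real \<Rightarrow> real) \<Rightarrow> real^'n \<Rightarrow> real" where
  "boundary_trace p u = (SOME g. has_trace p u g)"

definition Sobolev_trace ::
  "nat \<Rightarrow> nat \<Rightarrow> real \<Rightarrow> ((real^'n) \<times> real \<Rightarrow> real) set" where
  "Sobolev_trace k l p = {u \<in> Sobolev k p half_space. boundary_trace p u \<in> Sobolev l p UNIV}"

definition Sobolev_trace_norm ::
  "nat \<Rightarrow> nat \<Rightarrow> real \<Rightarrow> ((real^'n) \<times> real \<Rightarrow> real) \<Rightarrow> real" where
  "Sobolev_trace_norm k l p u =
     Sobolev_norm k p half_space u + Sobolev_norm l p UNIV (boundary_trace p u)"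

definition smooth_restrictions :: "((real^'n) \<times> real \<Rightarrow> real) set" where
  "smooth_restrictions = {u. \<exists>v. smooth v \<and> (\<forall>x\<in>half_space. u x = v x)}"

definition dense_wrt ::
  "(('a \<Rightarrow> real) \<Rightarrow> real) \<Rightarrow> ('a \<Rightarrow> real) set \<Rightarrow> ('a \<Rightarrow> real) set \<Rightarrow> bool" where
  "dense_wrt nrm D X \<longleftrightarrow> D \<subseteq> X \<and> (\<forall>u\<in>X. \<forall>e>0. \<exists>w\<in>D. nrm (\<lambda>x. u x - w x) < e)"

end

theory Submission
  imports Defs "HOL-Computational_Algebra.Polynomial"
begin

text \<open>
  Extend \<open>u\<close> by zero and average its translates, \<open>w(x) = \<integral> \<rho>(y') \<eta>(t) u(x' + y', x\<^sub>N + t) dy' dt\<close>, with \<open>\<eta>\<close>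
  supported in \<open>t > 0\<close>: the half-space is mapped into itself, so weak derivatives commute with the
  averaging, and \<open>w\<close> is smooth on the whole space. The trace of \<open>w\<close> is \<open>\<rho> * (g - h)\<close>, where \<open>g\<close> is the
  trace of \<open>u\<close> and \<open>h\<close>, the difference of \<open>g\<close> and the trace of the normal average of \<open>u\<close>, is small in
  \<open>L\<^sup>p\<close> by the trace inequality. Fix \<open>\<rho>\<close> so that \<open>\<rho> * g\<close> is close to \<open>g\<close> in \<open>W\<^sup>l\<^sup>,\<^sup>p\<close> and the tangential average of \<open>u\<close> is close
  to \<open>u\<close>; then shrink the support of \<open>\<eta>\<close>, so that \<open>h\<close> compensates the size of the derivatives of \<open>\<rho>\<close>.
  The trace itself is given by the explicit functional
  \<open>\<integral>\<^sub>0\<^sup>1 (u(x', t) - (1 - t) \<partial>\<^sub>N u(x', t)) dt\<close>.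
\<close>

section \<open>Calculus of smooth functions\<close>

text \<open>The obstacle is that \<open>k\<close> and \<open>l\<close> are unrelated: the trace may
  have many more derivatives than the interior slices of \<open>u\<close>. Moving inward replaces
  the trace by an average of slices whose distance to the trace is controlled in \<open>L^p\<close>
  only; in general nothing bounds the tangential derivatives of that distance. Convolution with a
  fixed smooth kernel turns the \<open>L^p\<close> bound into a \<open>W^{l,p}\<close> bound, at the
  price of the L^1 norms of the kernel derivatives. Extension by zero destroys weak
  differentiability across the boundary, but this is harmless: averages at points of the half-space
  read values in the half-space only. The trace is defined by an arbitrary choice among limits of
  test functions, so existence (density of test functions in \<open>W^{1,p}\<close>) and uniqueness
  both have to be proved. The explicit functional serves for both, being linear almost everywhere,
  bounded in \<open>L^p\<close> and compatible with tangential averages. Estimates are made for p-th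
  powers of norms by Jensen's inequality, which treats p = 1 and p > 1 alike.\<close>

definition pd :: "'a::euclidean_space \<Rightarrow> ('a \<Rightarrow> real) \<Rightarrow> 'a \<Rightarrow> real" where
  "pd b f = (\<lambda>x. frechet_derivative f (at x) b)"

lemma pd_eq: "(\<And>x. (f has_derivative D x) (at x)) \<Longrightarrow> pd b f = (\<lambda>x. D x b)"
  unfolding pd_def by (metis frechet_derivative_at)

lemma iter_partial_Cons: "iter_partial (b # bs) f = pd b (iter_partial bs f)"
  by (simp add: pd_def)

lemma iter_partial_append: "iter_partial (bs @ cs) f = iter_partial bs (iter_partial cs f)"
  by (induction bs) auto

lemma iter_partial_snoc: "iter_partial (bs @ [b]) f = iter_partial bs (pd b f)"
  by (simp add: iter_partial_append pd_def)

text \<open>Iterated partials never leave a family closed under differentiation, so smoothness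
  reduces to first-order facts about the family. Below, such families are formed by sums of
  products, by polynomials in \<open>1 / t\<close> times an exponential, and by convolutions with
  varying kernels.\<close>

lemma smooth_coinduct:
  assumes "f \<in> S"
    and "\<And>f x. f \<in> S \<Longrightarrow> f differentiable (at x)"
    and "\<And>f b. f \<in> S \<Longrightarrow> b \<in> Basis \<Longrightarrow> pd b f \<in> S"
  shows "smooth f"
proof -
  have "iter_partial bs f \<in> S" if "set bs \<subseteq> Basis" for bs
    using that by (induction bs) (auto simp: assms(1) iter_partial_Cons assms(3) simp del: iter_partial.simps(2))
  then show ?thesis
    unfolding smooth_def differentiable_on_def using assms(2) by (auto intro: differentiable_at_withinI)
qed

lemma smooth_iter_partial:
  assumes "smooth f" "set bs \<subseteq> Basis"
  shows "smooth (iter_partial bs f)"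
  unfolding smooth_def
proof (intro allI impI)
  fix cs :: "'a list" assume "set cs \<subseteq> Basis"
  then have "iter_partial (cs @ bs) f differentiable_on UNIV"
    using assms unfolding smooth_def by (metis set_append le_sup_iff)
  then show "iter_partial cs (iter_partial bs f) differentiable_on UNIV"
    by (simp add: iter_partial_append)
qed

lemma smooth_pd: "smooth f \<Longrightarrow> b \<in> Basis \<Longrightarrow> smooth (pd b f)"
  using smooth_iter_partial[of f "[b]"] by (simp add: pd_def)

lemma smooth_differentiable: "smooth f \<Longrightarrow> f differentiable (at x)"
  unfolding smooth_def differentiable_on_def
  by (metis UNIV_I empty_subsetI iter_partial.simps(1) set_empty)

lemma smooth_frechet: "smooth f \<Longrightarrow> (f has_derivative frechet_derivative f (at x)) (at x)"
  using smooth_differentiable frechet_derivative_works by blast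

lemma smooth_continuous: "smooth f \<Longrightarrow> continuous_on S f"
  by (meson smooth_differentiable continuous_at_imp_continuous_on differentiable_imp_continuous_within)

lemma smooth_has_derivative:
  assumes "smooth f"
  shows "(f has_derivative (\<lambda>h. \<Sum>b\<in>Basis. (h \<bullet> b) * pd b f x)) (at x)"
proof -
  let ?D = "frechet_derivative f (at x)"
  have D: "(f has_derivative ?D) (at x)"
    by (rule smooth_frechet[OF assms])
  then interpret linear ?D by (rule has_derivative_linear)
  have "?D = (\<lambda>h. \<Sum>b\<in>Basis. (h \<bullet> b) * pd b f x)"
  proof
    fix h
    have "?D h = ?D (\<Sum>b\<in>Basis. (h \<bullet> b) *\<^sub>R b)" by (simp add: euclidean_representation)
    also have "\<dots> = (\<Sum>b\<in>Basis. (h \<bullet> b) * pd b f x)" by (simp add: sum scale pd_def)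
    finally show "?D h = (\<Sum>b\<in>Basis. (h \<bullet> b) * pd b f x)" .
  qed
  with D show ?thesis by metis
qed

lemma pd_mult: "smooth f \<Longrightarrow> smooth g \<Longrightarrow> pd b (\<lambda>x. f x * g x) = (\<lambda>x. f x * pd b g x + pd b f x * g x)"
  by (subst pd_eq[OF has_derivative_mult[OF smooth_frechet smooth_frechet]]) (auto simp: pd_def)

text \<open>The product rule turns one product into a sum of two, so products alone are not closed
  under differentiation; their finite sums are.\<close>

inductive_set smooth_products :: "('a::euclidean_space \<Rightarrow> real) set" where
  prod: "smooth f \<Longrightarrow> smooth g \<Longrightarrow> (\<lambda>x. f x * g x) \<in> smooth_products"
| sum: "f \<in> smooth_products \<Longrightarrow> g \<in> smooth_products \<Longrightarrow> (\<lambda>x. f x + g x) \<in> smooth_products"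

lemma smooth_mult:
  fixes f g :: "'a::euclidean_space \<Rightarrow> real"
  assumes "smooth f" "smooth g" shows "smooth (\<lambda>x. f x * g x)"
proof (rule smooth_coinduct[where S = smooth_products])
  show "(\<lambda>x. f x * g x) \<in> smooth_products" using assms by (rule smooth_products.prod)
  show diff: "h differentiable (at x)" if "h \<in> smooth_products" for h :: "'a \<Rightarrow> real" and x
    using that by induction (auto intro: smooth_differentiable differentiable_mult differentiable_add)
  show "pd b h \<in> smooth_products" if "h \<in> smooth_products" "b \<in> Basis" for h and b :: 'a
    using that(1)
  proof induction
    case (prod f g)
    then show ?case
      by (subst pd_mult) (auto intro!: smooth_products.intros smooth_pd that(2))
  next
    case (sum f g)
    have "(k has_derivative frechet_derivative k (at x)) (at x)" if "k \<in> smooth_products" for k :: "'a \<Rightarrow> real" and x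
      using diff[OF that] frechet_derivative_works by blast
    then have "pd b (\<lambda>x. f x + g x) = (\<lambda>x. pd b f x + pd b g x)"
      using sum.hyps by (subst pd_eq[OF has_derivative_add]) (auto simp: pd_def)
    with sum.IH show ?case by (auto intro: smooth_products.sum)
  qed
qed

lemma smooth_const: "smooth (\<lambda>x. c)"
proof (rule smooth_coinduct[where S = "range (\<lambda>c x. c)"])
  show "pd b h \<in> range (\<lambda>c x. c)" if "h \<in> range (\<lambda>c x. c)" for h :: "'a \<Rightarrow> real" and b
    using that by (auto simp: pd_eq[OF has_derivative_const])
qed auto

lemma smooth_cmult: "smooth f \<Longrightarrow> smooth (\<lambda>x. c * f x)"
  by (rule smooth_mult[OF smooth_const])

lemma pd_const: "pd b (\<lambda>x. c) = (\<lambda>x. 0)"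
  by (subst pd_eq[OF has_derivative_const]) auto

lemma pd_cmult: "smooth f \<Longrightarrow> pd b (\<lambda>x. c * f x) = (\<lambda>x. c * pd b f x)"
  by (subst pd_mult[OF smooth_const]) (auto simp: pd_const)

lemma iter_partial_cmult:
  "smooth f \<Longrightarrow> set bs \<subseteq> Basis \<Longrightarrow> iter_partial bs (\<lambda>x. c * f x) = (\<lambda>x. c * iter_partial bs f x)"
  by (induction bs) (auto simp: iter_partial_Cons pd_cmult smooth_iter_partial simp del: iter_partial.simps(2))

lemma pd_affine:
  assumes "smooth f"
  shows "pd b (\<lambda>x. f (a + c *\<^sub>R x)) = (\<lambda>x. c * pd b f (a + c *\<^sub>R x))"
proof (subst pd_eq)
  fix x
  have "((\<lambda>x. f (a + c *\<^sub>R x)) has_derivative (\<lambda>h. frechet_derivative f (at (a + c *\<^sub>R x)) (0 + c *\<^sub>R h))) (at x)"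
    by (rule has_derivative_compose[where g = f])
       (rule derivative_intros smooth_frechet assms)+
  moreover have "linear (frechet_derivative f (at (a + c *\<^sub>R x)))"
    by (meson assms linear_frechet_derivative smooth_differentiable)
  ultimately show "((\<lambda>x. f (a + c *\<^sub>R x)) has_derivative (\<lambda>h. c * frechet_derivative f (at (a + c *\<^sub>R x)) h)) (at x)"
    by (simp add: linear_scale)
qed (simp add: pd_def)

text \<open>Each differentiation produces a factor \<open>c\<close>; the free scalar
  \<open>d\<close> in the invariant family absorbs these factors.\<close>

lemma smooth_affine:
  assumes "smooth f"
  shows "smooth (\<lambda>x. f (a + c *\<^sub>R x))"
proof (rule smooth_coinduct[where S = "{\<lambda>x. d * f (a + c *\<^sub>R x) | d f. smooth f}"])
  have "(\<lambda>x. f (a + c *\<^sub>R x)) = (\<lambda>x. 1 * f (a + c *\<^sub>R x))" by simp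
  then show "(\<lambda>x. f (a + c *\<^sub>R x)) \<in> {\<lambda>x. d * f (a + c *\<^sub>R x) | d f. smooth f}"
    using assms by blast
next
  fix h x assume "h \<in> {\<lambda>x. d * f (a + c *\<^sub>R x) | d f. smooth f}"
  then obtain d f where h: "h = (\<lambda>x. d * f (a + c *\<^sub>R x))" "smooth f" by blast
  have "f \<circ> (\<lambda>x. a + c *\<^sub>R x) differentiable (at x)"
    by (rule differentiable_chain_at) (auto intro!: smooth_differentiable h derivative_intros)
  then show "h differentiable (at x)" by (auto simp: h o_def)
next
  fix h and b :: 'a assume "h \<in> {\<lambda>x. d * f (a + c *\<^sub>R x) | d f. smooth f}" and b: "b \<in> Basis"
  then obtain d f where h: "h = (\<lambda>x. d * f (a + c *\<^sub>R x))" "smooth f" by blast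
  have "(\<lambda>x. f (a + c *\<^sub>R x)) differentiable (at x)" for x
    using differentiable_chain_at[of "\<lambda>x. a + c *\<^sub>R x" x f] smooth_differentiable[OF h(2)]
    by (auto simp: o_def intro!: derivative_intros)
  then have "pd b h = (\<lambda>x. d * pd b (\<lambda>x. f (a + c *\<^sub>R x)) x)"
    unfolding h by (subst pd_eq[where D = "\<lambda>x h. d * frechet_derivative (\<lambda>x. f (a + c *\<^sub>R x)) (at x) h"])
      (auto intro!: derivative_eq_intros simp: frechet_derivative_works[symmetric] pd_def)
  also have "\<dots> = (\<lambda>x. (d * c) * pd b f (a + c *\<^sub>R x))" by (simp add: pd_affine h mult.assoc)
  finally show "pd b h \<in> {\<lambda>x. d * f (a + c *\<^sub>R x) | d f. smooth f}"
    using smooth_pd[OF h(2) b] by blast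
qed

lemma smooth_shift: "smooth f \<Longrightarrow> smooth (\<lambda>x. f (x - a))"
  using smooth_affine[of f "-a" 1] by (simp add: add.commute)

lemma iter_partial_shift:
  assumes "smooth f" "set bs \<subseteq> Basis"
  shows "iter_partial bs (\<lambda>x. f (x - a)) = (\<lambda>x. iter_partial bs f (x - a))"
  using assms(2)
proof (induction bs)
  case (Cons b bs)
  then show ?case
    using pd_affine[of "iter_partial bs f" b "-a" 1] smooth_iter_partial[OF assms(1), of bs]
    by (auto simp: iter_partial_Cons add.commute simp del: iter_partial.simps(2))
qed auto

text \<open>Weak derivatives quantify over all orders of differentiation. For kernels of product form the
  order is evidently immaterial, so no theorem on mixed partial derivatives is needed.\<close>

lemma pd_coordinate_product:
  fixes D :: "'a::euclidean_space \<Rightarrow> nat \<Rightarrow> real \<Rightarrow> real"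
  assumes D: "\<And>b n t. b \<in> Basis \<Longrightarrow> (D b n has_real_derivative D b (Suc n) t) (at t)"
  shows "(\<lambda>x. \<Prod>b\<in>Basis. D b (m b) (x \<bullet> b)) differentiable (at x)"
    and "c \<in> Basis \<Longrightarrow> pd c (\<lambda>x. \<Prod>b\<in>Basis. D b (m b) (x \<bullet> b))
      = (\<lambda>x. \<Prod>b\<in>Basis. D b ((m(c := Suc (m c))) b) (x \<bullet> b))"
proof -
  let ?P = "\<lambda>x::'a. \<Prod>b\<in>Basis. D b (m b) (x \<bullet> b)"
  let ?P' = "\<lambda>x h::'a. \<Sum>b\<in>Basis. ((h \<bullet> b) * D b (Suc (m b)) (x \<bullet> b)) * (\<Prod>j\<in>Basis - {b}. D j (m j) (x \<bullet> j))"
  have 1: "(?P has_derivative ?P' x) (at x)" for x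
  proof (rule has_derivative_prod)
    fix b :: 'a assume "b \<in> Basis"
    have "((\<lambda>x. D b (m b) (x \<bullet> b)) has_derivative (\<lambda>h. D b (Suc (m b)) (x \<bullet> b) * (h \<bullet> b))) (at x)"
      by (rule has_derivative_compose[OF _ D[OF \<open>b \<in> Basis\<close>, unfolded has_field_derivative_def]])
         (auto intro!: derivative_eq_intros)
    then show "((\<lambda>x. D b (m b) (x \<bullet> b)) has_derivative (\<lambda>h. h \<bullet> b * D b (Suc (m b)) (x \<bullet> b))) (at x)"
      by (simp add: mult.commute)
  qed
  from 1 show "?P differentiable (at x)" unfolding differentiable_def by blast
  assume c: "c \<in> Basis"
  have "?P' x c = (\<Prod>b\<in>Basis. D b ((m(c := Suc (m c))) b) (x \<bullet> b))" for x
  proof -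
    \<comment> \<open>The basis is orthonormal, so the direction \<open>c\<close> leaves only the
      summand that differentiates factor \<open>c\<close>.\<close>
    have "?P' x c = (\<Sum>b\<in>Basis. if b = c then D c (Suc (m c)) (x \<bullet> c) * (\<Prod>j\<in>Basis - {c}. D j (m j) (x \<bullet> j)) else 0)"
      by (rule sum.cong) (auto simp: inner_Basis c)
    also have "\<dots> = D c (Suc (m c)) (x \<bullet> c) * (\<Prod>j\<in>Basis - {c}. D j (m j) (x \<bullet> j))"
      by (simp add: c)
    also have "(\<Prod>j\<in>Basis - {c}. D j (m j) (x \<bullet> j)) = (\<Prod>j\<in>Basis - {c}. D j ((m(c := Suc (m c))) j) (x \<bullet> j))"
      by (rule prod.cong) auto
    finally show ?thesis by (simp add: prod.remove[OF finite_Basis c])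
  qed
  then show "pd c ?P = (\<lambda>x. \<Prod>b\<in>Basis. D b ((m(c := Suc (m c))) b) (x \<bullet> b))"
    by (subst pd_eq[OF 1]) auto
qed

text \<open>A partial derivative only raises the order of one factor, so after all of
  \<open>bs\<close> the orders are the multiplicities in \<open>bs\<close>.\<close>

lemma smooth_coordinate_product:
  fixes D :: "'a::euclidean_space \<Rightarrow> nat \<Rightarrow> real \<Rightarrow> real"
  assumes D: "\<And>b n t. b \<in> Basis \<Longrightarrow> (D b n has_real_derivative D b (Suc n) t) (at t)"
  shows "smooth (\<lambda>x. \<Prod>b\<in>Basis. D b (m b) (x \<bullet> b))"
    and "set bs \<subseteq> Basis \<Longrightarrow> iter_partial bs (\<lambda>x. \<Prod>b\<in>Basis. D b 0 (x \<bullet> b))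
      = (\<lambda>x. \<Prod>b\<in>Basis. D b (count (mset bs) b) (x \<bullet> b))"
proof -
  show "smooth (\<lambda>x. \<Prod>b\<in>Basis. D b (m b) (x \<bullet> b))"
    by (rule smooth_coinduct[where S = "range (\<lambda>m x. \<Prod>b\<in>Basis. D b (m b) (x \<bullet> b))"])
       (auto simp: pd_coordinate_product[where D = D, OF D] simp del: fun_upd_apply)
  show "iter_partial bs (\<lambda>x. \<Prod>b\<in>Basis. D b 0 (x \<bullet> b))
      = (\<lambda>x. \<Prod>b\<in>Basis. D b (count (mset bs) b) (x \<bullet> b))" if "set bs \<subseteq> Basis"
    using that
  proof (induction bs)
    case (Cons c bs)
    have *: "(count (mset bs))(c := Suc (count (mset bs) c)) = count (mset (c # bs))" by auto
    show ?case using Cons pd_coordinate_product(2)[of D c "count (mset bs)", OF D] unfolding *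
      by (simp add: iter_partial_Cons del: iter_partial.simps(2) mset.simps)
  qed auto
qed

section \<open>A smooth bump function\<close>

text \<open>The classical function exp(-1/t), extended by zero to t <= 0. The polynomial factor in
  \<open>1 / t\<close> makes the family closed under differentiation.\<close>

definition flat :: "real poly \<Rightarrow> real \<Rightarrow> real" where
  "flat P t = (if t > 0 then poly P (1 / t) * exp (- (1 / t)) else 0)"

lemma power_le_fact_exp: "0 \<le> s \<Longrightarrow> s ^ n \<le> fact n * exp (s::real)"
proof -
  assume "0 \<le> s"
  have "summable (\<lambda>n. s ^ n /\<^sub>R fact n)" by (rule summable_exp_generic)
  then have "(\<Sum>i\<in>{n}. s ^ i /\<^sub>R fact i) \<le> (\<Sum>i. s ^ i /\<^sub>R fact i)"
    using \<open>0 \<le> s\<close> by (intro sum_le_suminf) (auto intro!: mult_nonneg_nonneg)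
  then have "s ^ n / fact n \<le> exp s" by (simp add: exp_def divide_inverse mult.commute)
  then show ?thesis by (simp add: field_simps)
qed

text \<open>With s = 1/t, the powers s^(i + 2) are dominated by (i + 2)! exp(s). Decay of order t^2
  is what the origin needs: the difference quotient there is bounded by a multiple of |t|.\<close>

lemma flat_bound: "\<exists>C. \<forall>t. \<bar>flat P t\<bar> \<le> C * t\<^sup>2"
proof (intro exI allI)
  fix t :: real
  let ?C = "\<Sum>i\<le>degree P. \<bar>coeff P i\<bar> * fact (i + 2)"
  have C: "0 \<le> ?C" by (auto intro!: sum_nonneg)
  show "\<bar>flat P t\<bar> \<le> ?C * t\<^sup>2"
  proof (cases "t > 0")
    case True
    define s where "s = 1 / t"
    have s: "s > 0" "t = 1 / s" using True by (auto simp: s_def)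
    have "\<bar>poly P s\<bar> * s\<^sup>2 \<le> (\<Sum>i\<le>degree P. \<bar>coeff P i\<bar> * s ^ i) * s\<^sup>2"
      using s by (intro mult_right_mono) (auto simp: poly_altdef abs_mult intro!: order_trans[OF sum_abs] sum_mono)
    also have "\<dots> = (\<Sum>i\<le>degree P. \<bar>coeff P i\<bar> * s ^ (i + 2))"
      unfolding sum_distrib_right by (intro sum.cong) (simp_all add: power2_eq_square mult_ac)
    also have "\<dots> \<le> (\<Sum>i\<le>degree P. \<bar>coeff P i\<bar> * (fact (i + 2) * exp s))"
      using s by (intro sum_mono mult_left_mono power_le_fact_exp) auto
    also have "\<dots> = ?C * exp s" by (simp add: sum_distrib_right mult.assoc)
    finally have "\<bar>poly P s\<bar> * exp (- s) \<le> ?C / s\<^sup>2"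
      using s by (simp add: exp_minus field_simps)
    then show ?thesis using True by (simp add: flat_def abs_mult s_def power_divide)
  qed (use C in \<open>simp add: flat_def\<close>)
qed

text \<open>For t > 0 the chain rule gives s^2 (P(s) - P'(s)) exp(-s) with s = 1/t, which is where
  \<open>[:0,0,1:]\<close> comes from. At the origin the quadratic bound makes the derivative
  vanish.\<close>

lemma flat_has_derivative: "(flat P has_real_derivative flat ([:0,0,1:] * (P - pderiv P)) t) (at t)"
proof -
  consider "t > 0" | "t < 0" | "t = 0" by linarith
  then show ?thesis
  proof cases
    case 1
    let ?f = "\<lambda>t. poly P (1 / t) * exp (- (1 / t))"
    have "(?f has_real_derivative flat ([:0,0,1:] * (P - pderiv P)) t) (at t)"
      using 1 by (auto intro!: derivative_eq_intros simp: flat_def field_simps power2_eq_square)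
    then show ?thesis
      by (rule has_field_derivative_transform_within_open[where S = "{0<..}"]) (use 1 in \<open>auto simp: flat_def\<close>)
  next
    case 2
    have "((\<lambda>t::real. 0) has_real_derivative flat ([:0,0,1:] * (P - pderiv P)) t) (at t)"
      using 2 by (auto simp: flat_def)
    then show ?thesis
      by (rule has_field_derivative_transform_within_open[where S = "{..<0}"]) (use 2 in \<open>auto simp: flat_def\<close>)
  next
    case 3
    obtain C where C: "\<And>t. \<bar>flat P t\<bar> \<le> C * t\<^sup>2" using flat_bound by metis
    have "((\<lambda>h. flat P h / h) \<longlongrightarrow> 0) (at 0)"
    proof (rule Lim_null_comparison)
      show "\<forall>\<^sub>F h in at 0. norm (flat P h / h) \<le> C * \<bar>h\<bar>"
        unfolding eventually_at_filter
      proof (rule always_eventually, intro allI impI)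
        fix h :: real assume "h \<noteq> 0"
        have "\<bar>flat P h\<bar> \<le> (C * \<bar>h\<bar>) * \<bar>h\<bar>" using C[of h] by (simp add: power2_eq_square)
        with \<open>h \<noteq> 0\<close> show "norm (flat P h / h) \<le> C * \<bar>h\<bar>" by (simp add: divide_le_eq)
      qed
      show "((\<lambda>h. C * \<bar>h\<bar>) \<longlongrightarrow> 0) (at 0)" by (auto intro!: tendsto_eq_intros)
    qed
    then show ?thesis using 3 by (simp add: DERIV_def flat_def)
  qed
qed

lemma smooth_flat: "smooth (flat P)"
proof (rule smooth_coinduct[where S = "range flat"])
  fix h assume "h \<in> range flat"
  then obtain P where h: "h = flat P" by auto
  show "h differentiable (at x)" for x
    unfolding h using flat_has_derivative has_field_derivative_imp_has_derivative differentiableI by blast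
  show "pd b h \<in> range flat" if "b \<in> Basis" for b
    using that pd_eq[of "flat P", OF flat_has_derivative[unfolded has_field_derivative_def], of b]
    by (auto simp: h)
qed auto

text \<open>The interval \<open>(0, e)\<close> lies on one side of the origin, so that averages
  built on it displace points in positive directions only.\<close>

definition bump :: "real \<Rightarrow> real \<Rightarrow> real" where
  "bump e t = flat 1 t * flat 1 (e - t)"

lemma smooth_bump: "smooth (bump e)"
  unfolding bump_def using smooth_mult[OF smooth_flat smooth_affine[OF smooth_flat, of "1" e "-1"], of 1] by simp

lemma bump_nonneg: "bump e t \<ge> 0"
  by (auto simp: bump_def flat_def)

lemma bump_pos_iff: "bump e t \<noteq> 0 \<longleftrightarrow> 0 < t \<and> t < e"
  by (auto simp: bump_def flat_def)

text \<open>A product over the coordinates rather than a radial bump, so that it factors into a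
  tangential and a normal part.\<close>

definition box_bump :: "'a::euclidean_space \<Rightarrow> 'a \<Rightarrow> real" where
  "box_bump e x = (\<Prod>b\<in>Basis. bump (e \<bullet> b) (x \<bullet> b))"

lemma box_bump_derivs:
  fixes e :: "'a::euclidean_space"
  shows "smooth (box_bump e)"
    and "\<lbrakk>set bs \<subseteq> Basis; mset bs = mset cs\<rbrakk> \<Longrightarrow> iter_partial bs (box_bump e) = iter_partial cs (box_bump e)"
proof -
  \<comment> \<open>\<open>1\<close> is the only basis vector of the reals, so \<open>D b n\<close>
    is the n-th derivative of the one-dimensional bump.\<close>
  define D where "D b n = iter_partial (replicate n (1::real)) (bump (e \<bullet> b))" for b n
  have D: "(D b n has_real_derivative D b (Suc n) t) (at t)" for b n t
  proof -
    have "smooth (D b n)" unfolding D_def by (intro smooth_iter_partial smooth_bump) auto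
    from smooth_has_derivative[OF this, of t] show ?thesis
      by (simp add: D_def has_field_derivative_def pd_def mult.commute[of _ "_::real"] mult_commute_abs)
  qed
  have eq: "box_bump e = (\<lambda>x. \<Prod>b\<in>Basis. D b 0 (x \<bullet> b))"
    by (simp add: box_bump_def D_def fun_eq_iff)
  show "smooth (box_bump e)"
    using smooth_coordinate_product(1)[where D = D, OF D, of "\<lambda>_. 0"] eq by simp
  show "iter_partial bs (box_bump e) = iter_partial cs (box_bump e)"
    if "set bs \<subseteq> Basis" "mset bs = mset cs"
  proof -
    have "set cs \<subseteq> Basis" using that mset_eq_setD by blast
    then show ?thesis
      unfolding eq using smooth_coordinate_product(2)[where D = D, OF D] that by metis
  qed
qed

lemma box_bump_nonneg: "box_bump e x \<ge> 0"
  by (auto simp: box_bump_def intro!: prod_nonneg bump_nonneg)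

lemma box_bump_pos_iff: "box_bump e x \<noteq> 0 \<longleftrightarrow> x \<in> box 0 e"
  by (auto simp: box_bump_def bump_pos_iff mem_box)

text \<open>The basis of a product space is the union of the two embedded bases. Read from right to
  left, the identity shows that a tangential times a normal bump is again a smooth box bump.\<close>

lemma box_bump_Pair: "box_bump (e, d) (x, t) = box_bump e x * box_bump d t"
proof -
  have "box_bump (e, d) (x, t) = (\<Prod>b\<in>(\<lambda>u. (u, 0)) ` Basis \<union> (\<lambda>u. (0, u)) ` Basis. bump ((e, d) \<bullet> b) ((x, t) \<bullet> b))"
    by (simp add: box_bump_def Basis_prod_def)
  also have "\<dots> = box_bump e x * box_bump d t"
    by (subst prod.union_disjoint) (auto simp: box_bump_def prod.reindex inj_on_def)
  finally show ?thesis .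
qed

section \<open>Averages and translations in \<open>L\<^sup>p\<close>\<close>

text \<open>The p-th power of the \<open>L^p\<close> norm, kept in \<open>ennreal\<close>: no
  integrability side conditions arise, Tonelli applies directly, and the value infinity marks
  measurable functions outside \<open>L^p\<close>. The triangle inequality is replaced by a cruder
  one with factor \<open>2 powr p\<close>.\<close>

definition Npow :: "real \<Rightarrow> ('a::euclidean_space \<Rightarrow> real) \<Rightarrow> ennreal" where
  "Npow p f = (\<integral>\<^sup>+x. ennreal (\<bar>f x\<bar> powr p) \<partial>lborel)"

text \<open>Convexity on the open half-line puts the graph of the power above its tangent at
  \<open>m\<close>. The point \<open>s = 0\<close> lies outside that domain; there the left side is
  (1 - p) m^p, which is at most 0.\<close>

lemma powr_tangent:
  fixes p m s :: real
  assumes "p \<ge> 1" "m > 0" "s \<ge> 0"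
  shows "m powr p + p * m powr (p - 1) * (s - m) \<le> s powr p"
proof (cases "s = 0")
  case True
  have "m powr (p - 1) * m = m powr p"
    using assms by (simp add: powr_diff)
  then show ?thesis using assms True by (simp add: algebra_simps mult_left_mono)
next
  case False
  have "s powr p - m powr p \<ge> (p * m powr (p - 1)) * (s - m)"
  proof (rule convex_on_imp_above_tangent[where A = "{0<..}" and f = "\<lambda>x. x powr p"])
    show "convex_on {0<..} (\<lambda>x. x powr p)" using assms by (simp add: powr_convex)
    show "((\<lambda>x. x powr p) has_real_derivative p * m powr (p - 1)) (at m within {0<..})"
      using assms by (auto intro!: derivative_eq_intros)
  qed (use assms False in \<open>auto simp: interior_open\<close>)
  then show ?thesis by linarith
qed

lemma abs_add_powr_le:
  fixes p a b :: real
  assumes "p \<ge> 1"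
  shows "\<bar>a + b\<bar> powr p \<le> 2 powr p * (\<bar>a\<bar> powr p + \<bar>b\<bar> powr p)"
proof -
  have "\<bar>a + b\<bar> powr p \<le> (2 * max \<bar>a\<bar> \<bar>b\<bar>) powr p"
    using assms by (intro powr_mono2) auto
  also have "\<dots> = 2 powr p * max \<bar>a\<bar> \<bar>b\<bar> powr p" by (simp add: powr_mult)
  also have "\<dots> \<le> 2 powr p * (\<bar>a\<bar> powr p + \<bar>b\<bar> powr p)"
    by (intro mult_left_mono) (auto simp: max_def)
  finally show ?thesis .
qed

lemma abs_le_1_plus_powr: "p \<ge> 1 \<Longrightarrow> \<bar>a::real\<bar> \<le> 1 + \<bar>a\<bar> powr p"
  using powr_mono[of 1 p "\<bar>a\<bar>"] by (cases "\<bar>a\<bar> \<le> 1") (auto simp: add_increasing2)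

lemma Npow_mono:
  assumes "\<And>x. \<bar>f x\<bar> \<le> \<bar>g x\<bar>" "p \<ge> 0"
  shows "Npow p f \<le> Npow p g"
  unfolding Npow_def using assms by (intro nn_integral_mono ennreal_leI powr_mono2) auto

lemma Npow_cong_AE: "AE x in lborel. f x = g x \<Longrightarrow> Npow p f = Npow p g"
  unfolding Npow_def by (rule nn_integral_cong_AE) auto

lemma Npow_minus: "Npow p (\<lambda>x. - f x) = Npow p f"
  by (simp add: Npow_def)

lemma Npow_diff_commute: "Npow p (\<lambda>x. f x - g x) = Npow p (\<lambda>x. g x - f x)"
  by (simp add: Npow_def abs_minus_commute)

lemma Npow_zero: "Npow p (\<lambda>x. 0) = 0"
  by (simp add: Npow_def)

lemma Npow_add:
  assumes [measurable]: "f \<in> borel_measurable borel" "g \<in> borel_measurable borel" and p: "p \<ge> 1"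
  shows "Npow p (\<lambda>x. f x + g x) \<le> ennreal (2 powr p) * (Npow p f + Npow p g)"
proof -
  have "Npow p (\<lambda>x. f x + g x) \<le> (\<integral>\<^sup>+x. ennreal (2 powr p * (\<bar>f x\<bar> powr p + \<bar>g x\<bar> powr p)) \<partial>lborel)"
    unfolding Npow_def by (intro nn_integral_mono ennreal_leI abs_add_powr_le p)
  also have "\<dots> = (\<integral>\<^sup>+x. ennreal (2 powr p) * (ennreal (\<bar>f x\<bar> powr p) + ennreal (\<bar>g x\<bar> powr p)) \<partial>lborel)"
    by (simp add: ennreal_mult' flip: ennreal_plus)
  also have "\<dots> = ennreal (2 powr p) * (Npow p f + Npow p g)"
    unfolding Npow_def by (subst nn_integral_cmult nn_integral_add; measurable)+
  finally show ?thesis .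
qed

lemma Npow_diff:
  assumes "f \<in> borel_measurable borel" "g \<in> borel_measurable borel" "p \<ge> 1"
  shows "Npow p (\<lambda>x. f x - g x) \<le> ennreal (2 powr p) * (Npow p f + Npow p g)"
  using Npow_add[of f "\<lambda>x. - g x" p] assms by (simp add: Npow_minus)

text \<open>The budget per summand is the one for which the factor in \<open>Npow_add\<close>
  returns exactly \<open>e\<close>.\<close>

lemma Npow_add_half:
  assumes "f \<in> borel_measurable borel" "g \<in> borel_measurable borel" "p \<ge> 1" "e > 0"
    and "Npow p f \<le> ennreal (e / (2 * 2 powr p))" "Npow p g \<le> ennreal (e / (2 * 2 powr p))"
  shows "Npow p (\<lambda>x. f x + g x) \<le> ennreal e"
proof -
  define a where "a = e / (2 * 2 powr p)"
  have a: "a > 0" "2 powr p * (a + a) = e" using assms(4) by (simp_all add: a_def)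
  have "Npow p (\<lambda>x. f x + g x) \<le> ennreal (2 powr p) * (Npow p f + Npow p g)" by (intro Npow_add assms)
  also have "\<dots> \<le> ennreal (2 powr p) * (ennreal a + ennreal a)"
    using assms(5,6) by (intro mult_left_mono add_mono) (auto simp: a_def)
  also have "\<dots> = ennreal e"
    unfolding a(2)[symmetric] using a(1) by (simp only: ennreal_mult ennreal_plus add_nonneg_nonneg less_imp_le powr_ge_zero)
  finally show ?thesis .
qed

lemma Npow_cmult:
  assumes [measurable]: "f \<in> borel_measurable borel"
  shows "Npow p (\<lambda>x. c * f x) = ennreal (\<bar>c\<bar> powr p) * Npow p f"
  unfolding Npow_def by (subst nn_integral_cmult[symmetric]) (auto simp: abs_mult powr_mult ennreal_mult)

section \<open>Translation invariance and kernel operators\<close>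

lemma nn_integral_lborel_shift:
  fixes a :: "'a::euclidean_space"
  assumes [measurable]: "f \<in> borel_measurable borel"
  shows "(\<integral>\<^sup>+x. f (x + a) \<partial>lborel) = (\<integral>\<^sup>+x. f x \<partial>lborel)"
proof -
  have "(\<integral>\<^sup>+x. f x \<partial>lborel) = (\<integral>\<^sup>+x. f x \<partial>distr lborel borel ((+) a))"
    by (simp add: lborel_distr_plus)
  also have "\<dots> = (\<integral>\<^sup>+x. f (x + a) \<partial>lborel)"
    by (subst nn_integral_distr) (auto simp: add.commute)
  finally show ?thesis by simp
qed

lemma integral_lborel_shift:
  fixes a :: "'a::euclidean_space" and f :: "'a \<Rightarrow> real"
  assumes [measurable]: "f \<in> borel_measurable borel"
  shows "(LINT x|lborel. f (x + a)) = (LINT x|lborel. f x)"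
proof -
  have "(LINT x|lborel. f x) = (LINT x|distr lborel borel ((+) a). f x)"
    by (simp add: lborel_distr_plus)
  also have "\<dots> = (LINT x|lborel. f (x + a))"
    by (subst integral_distr) (auto simp: add.commute)
  finally show ?thesis by simp
qed

lemma Npow_shift: "f \<in> borel_measurable borel \<Longrightarrow> Npow p (\<lambda>x. f (x + a)) = Npow p f"
  unfolding Npow_def by (rule nn_integral_lborel_shift) measurable

lemma Npow_eq_0_iff:
  assumes [measurable]: "f \<in> borel_measurable borel"
  shows "Npow p f = 0 \<longleftrightarrow> (AE x in lborel. f x = 0)"
  unfolding Npow_def by (subst nn_integral_0_iff_AE) auto

text \<open>On the bounded support of \<open>\<psi>\<close> the bound |f| <= 1 + |f|^p takes the
  place of Hoelder's inequality.\<close>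

lemma integrable_mult_bounded:
  fixes f \<psi> :: "'a::euclidean_space \<Rightarrow> real"
  assumes [measurable]: "f \<in> borel_measurable borel" "\<psi> \<in> borel_measurable borel"
    and f: "Npow p f < \<infinity>" and p: "p \<ge> 1"
    and \<psi>: "\<And>x. \<bar>\<psi> x\<bar> \<le> M" "bounded {x. \<psi> x \<noteq> 0}"
  shows "integrable lborel (\<lambda>x. \<psi> x * f x)"
proof -
  obtain B where B: "\<And>x. \<psi> x \<noteq> 0 \<Longrightarrow> norm x \<le> B" using \<psi>(2) unfolding bounded_iff by auto
  have M: "M \<ge> 0" using \<psi>(1)[of 0] by linarith
  have i1: "integrable lborel (\<lambda>x. \<bar>f x\<bar> powr p)"
    using f by (intro integrableI_bounded) (auto simp: Npow_def)
  have i2: "integrable lborel (indicat_real (cball 0 B :: 'a set))"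
    by (intro integrable_real_indicator) (use emeasure_bounded_finite[OF bounded_cball, of 0 B] in auto)
  have "integrable lborel (\<lambda>x. M * (indicat_real (cball 0 B) x + \<bar>f x\<bar> powr p))"
    using i1 i2 by auto
  then show ?thesis
  proof (rule Bochner_Integration.integrable_bound)
    show "AE x in lborel. norm (\<psi> x * f x) \<le> norm (M * (indicat_real (cball 0 B) x + \<bar>f x\<bar> powr p))"
    proof (intro always_eventually allI)
      fix x
      show "norm (\<psi> x * f x) \<le> norm (M * (indicat_real (cball 0 B) x + \<bar>f x\<bar> powr p))"
      proof (cases "\<psi> x = 0")
        case False
        with B[of x] have "\<bar>f x\<bar> \<le> indicat_real (cball 0 B) x + \<bar>f x\<bar> powr p"
          using abs_le_1_plus_powr[OF p, of "f x"] by simp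
        then have "\<bar>\<psi> x\<bar> * \<bar>f x\<bar> \<le> M * (indicat_real (cball 0 B) x + \<bar>f x\<bar> powr p)"
          using \<psi>(1)[of x] M by (intro mult_mono) auto
        then show ?thesis using M by (simp add: abs_mult)
      qed auto
    qed
  qed measurable
qed

lemma integrable_kernel:
  fixes \<kappa> :: "'a::euclidean_space \<Rightarrow> real"
  assumes [measurable]: "\<kappa> \<in> borel_measurable borel" and "\<And>x. \<bar>\<kappa> x\<bar> \<le> M" "bounded {x. \<kappa> x \<noteq> 0}"
  shows "integrable lborel \<kappa>"
proof -
  obtain B where B: "{x. \<kappa> x \<noteq> 0} \<subseteq> cball 0 B" using assms(3) unfolding bounded_iff by (auto simp: subset_iff)
  have "integrable lborel (\<lambda>x. M * indicat_real (cball 0 B :: 'a set) x)"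
    by (intro integrable_mult_right integrable_real_indicator) (use emeasure_bounded_finite[OF bounded_cball, of 0 B] in auto)
  then show ?thesis
  proof (rule Bochner_Integration.integrable_bound)
    have "\<bar>\<kappa> x\<bar> \<le> \<bar>M * indicat_real (cball 0 B) x\<bar>" for x
      using B order_trans[OF assms(2)[of x] abs_ge_self] by (cases "\<kappa> x = 0") auto
    then show "AE x in lborel. norm (\<kappa> x) \<le> norm (M * indicat_real (cball 0 B) x)"
      by (intro always_eventually) auto
  qed measurable
qed

text \<open>Jensen's inequality for the measure |\<kappa>| dz, whose total mass \<open>c\<close>
  need not be 1; normalising produces the factor c^(p - 1). The proof integrates the tangent
  inequality at the mean value of |G|.\<close>

lemma nn_jensen:
  fixes \<kappa> G :: "'a::euclidean_space \<Rightarrow> real"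
  assumes [measurable]: "G \<in> borel_measurable borel" and \<kappa>: "integrable lborel \<kappa>" and p: "p \<ge> 1"
    and c: "c = (LINT z|lborel. \<bar>\<kappa> z\<bar>)"
  shows "ennreal (\<bar>LINT z|lborel. \<kappa> z * G z\<bar> powr p)
    \<le> ennreal (c powr (p - 1)) * (\<integral>\<^sup>+z. ennreal \<bar>\<kappa> z\<bar> * ennreal (\<bar>G z\<bar> powr p) \<partial>lborel)" (is "?L \<le> ?C * ?R")
proof -
  have [measurable]: "\<kappa> \<in> borel_measurable borel" using borel_measurable_integrable[OF \<kappa>] by simp
  have c0: "c \<ge> 0" by (simp add: c)
  \<comment> \<open>A kernel of mass zero vanishes almost everywhere, and an infinite right side
    leaves nothing to prove; in the remaining case the mean value exists.\<close>
  consider "c = 0" | "c > 0" "?R = \<infinity>" | "c > 0" "?R < \<infinity>" using c0 by (fastforce simp: less_top)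
  then show ?thesis
  proof cases
    case 1
    then have "AE z in lborel. \<bar>\<kappa> z\<bar> = 0"
      using \<kappa> by (subst (asm) c, subst (asm) integral_nonneg_eq_0_iff_AE) auto
    then have "(LINT z|lborel. \<kappa> z * G z) = 0" by (intro integral_eq_zero_AE) auto
    then show ?thesis by simp
  next
    case 2
    then have "?C * ?R = \<infinity>" by (auto simp: ennreal_mult_top)
    then show ?thesis by simp
  next
    case 3
    let ?H = "\<lambda>z. \<bar>\<kappa> z\<bar> * \<bar>G z\<bar> powr p"
    have R: "?R = (\<integral>\<^sup>+z. ennreal (?H z) \<partial>lborel)" by (simp add: ennreal_mult)
    have H: "integrable lborel ?H"
      using 3 unfolding R by (intro integrableI_bounded) auto
    have KG: "integrable lborel (\<lambda>z. \<bar>\<kappa> z\<bar> * \<bar>G z\<bar>)"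
    proof (rule Bochner_Integration.integrable_bound)
      show "integrable lborel (\<lambda>z. \<bar>\<kappa> z\<bar> + ?H z)" using H \<kappa> by auto
      have "\<bar>\<kappa> z\<bar> * \<bar>G z\<bar> \<le> \<bar>\<kappa> z\<bar> + ?H z" for z
        using mult_left_mono[OF abs_le_1_plus_powr[OF p, of "G z"], of "\<bar>\<kappa> z\<bar>"] by (simp add: algebra_simps)
      then show "AE z in lborel. norm (\<bar>\<kappa> z\<bar> * \<bar>G z\<bar>) \<le> norm (\<bar>\<kappa> z\<bar> + ?H z)"
        by (intro always_eventually) auto
    qed measurable
    define I where "I = (LINT z|lborel. \<bar>\<kappa> z\<bar> * \<bar>G z\<bar>)"
    \<comment> \<open>The mean of |G| with respect to |\<kappa>| / c. The linear part of the tangent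
      at this point integrates to zero, leaving c m^p.\<close>
    define m where "m = I / c"
    have "I \<ge> 0" by (simp add: I_def)
    have IH: "c * m powr p \<le> integral\<^sup>L lborel ?H"
    proof (cases "I = 0")
      case True
      then show ?thesis by (simp add: m_def)
    next
      case False
      then have "m > 0" using \<open>I \<ge> 0\<close> 3 by (simp add: m_def)
      have "integral\<^sup>L lborel ?H \<ge> (LINT z|lborel. (m powr p - p * m powr (p - 1) * m) * \<bar>\<kappa> z\<bar> + (p * m powr (p - 1)) * (\<bar>\<kappa> z\<bar> * \<bar>G z\<bar>))"
      proof (rule integral_mono)
        fix z
        have "\<bar>\<kappa> z\<bar> * (m powr p + p * m powr (p - 1) * (\<bar>G z\<bar> - m)) \<le> ?H z"
          using powr_tangent[OF p \<open>m > 0\<close>, of "\<bar>G z\<bar>"] by (intro mult_left_mono) auto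
        then show "(m powr p - p * m powr (p - 1) * m) * \<bar>\<kappa> z\<bar> + (p * m powr (p - 1)) * (\<bar>\<kappa> z\<bar> * \<bar>G z\<bar>) \<le> ?H z"
          by (simp add: algebra_simps)
      qed (use H KG \<kappa> in auto)
      also have "(LINT z|lborel. (m powr p - p * m powr (p - 1) * m) * \<bar>\<kappa> z\<bar> + (p * m powr (p - 1)) * (\<bar>\<kappa> z\<bar> * \<bar>G z\<bar>))
          = (m powr p - p * m powr (p - 1) * m) * c + (p * m powr (p - 1)) * I"
        using KG \<kappa> by (simp add: c I_def)
      also have "\<dots> = c * m powr p" using 3 by (simp add: m_def field_simps)
      finally show ?thesis .
    qed
    have "\<bar>LINT z|lborel. \<kappa> z * G z\<bar> \<le> c * m"
      using integral_abs_bound[of lborel "\<lambda>z. \<kappa> z * G z"] 3 by (simp add: m_def I_def abs_mult)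
    then have "\<bar>LINT z|lborel. \<kappa> z * G z\<bar> powr p \<le> (c * m) powr p"
      using p by (intro powr_mono2) auto
    also have "\<dots> = c powr (p - 1) * (c * m powr p)"
      using 3 by (simp add: powr_mult powr_diff)
    also have "\<dots> \<le> c powr (p - 1) * integral\<^sup>L lborel ?H"
      using IH by (intro mult_left_mono) auto
    finally have "?L \<le> ennreal (c powr (p - 1) * integral\<^sup>L lborel ?H)" by (rule ennreal_leI)
    also have "\<dots> = ?C * ?R"
      unfolding R using H by (subst nn_integral_eq_integral) (auto simp: ennreal_mult)
    finally show ?thesis .
  qed
qed

text \<open>Jensen in \<open>z\<close> for each fixed \<open>x\<close>, followed by Tonelli: an
  integral inequality of Minkowski type for p-th powers.\<close>

lemma Npow_kernel:
  fixes F :: "'b::euclidean_space \<Rightarrow> 'a::euclidean_space \<Rightarrow> real"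
  assumes F[measurable]: "case_prod F \<in> borel_measurable (borel \<Otimes>\<^sub>M borel)" and \<kappa>: "integrable lborel \<kappa>" and p: "p \<ge> 1"
    and c: "c = (LINT z|lborel. \<bar>\<kappa> z\<bar>)"
  shows "Npow p (\<lambda>x. LINT z|lborel. \<kappa> z * F z x)
    \<le> ennreal (c powr (p - 1)) * (\<integral>\<^sup>+z. ennreal \<bar>\<kappa> z\<bar> * Npow p (F z) \<partial>lborel)"
proof -
  have [measurable]: "\<kappa> \<in> borel_measurable borel" using borel_measurable_integrable[OF \<kappa>] by simp
  have "Npow p (\<lambda>x. LINT z|lborel. \<kappa> z * F z x)
     \<le> (\<integral>\<^sup>+x. ennreal (c powr (p - 1)) * (\<integral>\<^sup>+z. ennreal \<bar>\<kappa> z\<bar> * ennreal (\<bar>F z x\<bar> powr p) \<partial>lborel) \<partial>lborel)"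
    unfolding Npow_def by (intro nn_integral_mono nn_jensen \<kappa> p c) measurable
  also have "\<dots> = ennreal (c powr (p - 1)) * (\<integral>\<^sup>+x. (\<integral>\<^sup>+z. ennreal \<bar>\<kappa> z\<bar> * ennreal (\<bar>F z x\<bar> powr p) \<partial>lborel) \<partial>lborel)"
    by (rule nn_integral_cmult) measurable
  also have "(\<integral>\<^sup>+x. (\<integral>\<^sup>+z. ennreal \<bar>\<kappa> z\<bar> * ennreal (\<bar>F z x\<bar> powr p) \<partial>lborel) \<partial>lborel)
      = (\<integral>\<^sup>+z. (\<integral>\<^sup>+x. ennreal \<bar>\<kappa> z\<bar> * ennreal (\<bar>F z x\<bar> powr p) \<partial>lborel) \<partial>lborel)"
    by (rule lborel_pair.Fubini') measurable
  also have "\<dots> = (\<integral>\<^sup>+z. ennreal \<bar>\<kappa> z\<bar> * Npow p (F z) \<partial>lborel)"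
    unfolding Npow_def by (intro nn_integral_cong nn_integral_cmult) measurable
  finally show ?thesis .
qed

text \<open>Translates enter as \<open>x + L z\<close>, so this is convolution with the reflected
  kernel. The map \<open>L\<close> lets one definition average over all directions, over the
  tangential ones, or over the normal one.\<close>

definition conv :: "('b::euclidean_space \<Rightarrow> 'a::euclidean_space) \<Rightarrow> ('b \<Rightarrow> real) \<Rightarrow> ('a \<Rightarrow> real) \<Rightarrow> 'a \<Rightarrow> real" where
  "conv L \<kappa> f x = (LINT z|lborel. \<kappa> z * f (x + L z))"

lemma shift_measurable:
  fixes L :: "'b::euclidean_space \<Rightarrow> 'a::euclidean_space"
  assumes "linear L" and [measurable]: "f \<in> borel_measurable borel"
  shows "(\<lambda>(z, x). f (x + L z)) \<in> borel_measurable (borel \<Otimes>\<^sub>M borel)"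
    "(\<lambda>(x, z). f (x + L z)) \<in> borel_measurable (borel \<Otimes>\<^sub>M borel)"
    "(\<lambda>z. f (x + L z)) \<in> borel_measurable borel"
proof -
  have [measurable]: "L \<in> borel_measurable borel"
    using assms(1) by (intro borel_measurable_continuous_onI linear_continuous_on linear_conv_bounded_linear[THEN iffD1])
  show "(\<lambda>(z, x). f (x + L z)) \<in> borel_measurable (borel \<Otimes>\<^sub>M borel)"
    "(\<lambda>(x, z). f (x + L z)) \<in> borel_measurable (borel \<Otimes>\<^sub>M borel)"
    "(\<lambda>z. f (x + L z)) \<in> borel_measurable borel" by measurable
qed

lemma conv_measurable:
  assumes L: "linear L" and f: "f \<in> borel_measurable borel" and [measurable]: "\<kappa> \<in> borel_measurable borel"
  shows "conv L \<kappa> f \<in> borel_measurable borel"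
proof -
  note [measurable] = shift_measurable(2)[OF L f]
  have "conv L \<kappa> f = (\<lambda>x. LINT z|lborel. \<kappa> z * case_prod (\<lambda>x z. f (x + L z)) (x, z))"
    by (simp add: conv_def fun_eq_iff)
  also have "\<dots> \<in> borel_measurable borel" by measurable
  finally show ?thesis .
qed

text \<open>Young's inequality in p-th powers: translations preserve \<open>Npow\<close>, so the
  kernel contributes only its L^1 norm, with exponent p - 1 from Jensen and once more as total
  mass.\<close>

lemma Npow_conv:
  assumes L: "linear L" and f: "f \<in> borel_measurable borel" and \<kappa>: "integrable lborel \<kappa>" and p: "p \<ge> 1"
  shows "Npow p (conv L \<kappa> f) \<le> ennreal ((LINT z|lborel. \<bar>\<kappa> z\<bar>) powr p) * Npow p f"
proof -
  let ?c = "LINT z|lborel. \<bar>\<kappa> z\<bar>"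
  have [measurable]: "\<kappa> \<in> borel_measurable borel" using borel_measurable_integrable[OF \<kappa>] by simp
  have "Npow p (conv L \<kappa> f) \<le> ennreal (?c powr (p - 1)) * (\<integral>\<^sup>+z. ennreal \<bar>\<kappa> z\<bar> * Npow p (\<lambda>x. f (x + L z)) \<partial>lborel)"
    unfolding conv_def[abs_def] using Npow_kernel[of "\<lambda>z x. f (x + L z)", OF shift_measurable(1)[OF L f] \<kappa> p refl] .
  also have "(\<integral>\<^sup>+z. ennreal \<bar>\<kappa> z\<bar> * Npow p (\<lambda>x. f (x + L z)) \<partial>lborel) = (\<integral>\<^sup>+z. ennreal \<bar>\<kappa> z\<bar> \<partial>lborel) * Npow p f"
    by (subst nn_integral_multc[symmetric]) (auto simp: Npow_shift f)
  also have "(\<integral>\<^sup>+z. ennreal \<bar>\<kappa> z\<bar> \<partial>lborel) = ennreal ?c"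
    using \<kappa> by (intro nn_integral_eq_integral) auto
  also have "ennreal (?c powr (p - 1)) * (ennreal ?c * Npow p f) = ennreal (?c powr p) * Npow p f"
    by (cases "?c = 0") (auto simp: powr_diff mult.assoc[symmetric] ennreal_mult[symmetric])
  finally show ?thesis .
qed

text \<open>The integral of a non-integrable function is 0 by convention, so \<open>conv\<close> can
  be treated as linear only where the integrand is integrable. Tonelli gives this almost everywhere,
  since |\<kappa>| |f|^p has a finite double integral and |f| <= 1 + |f|^p.\<close>

lemma AE_integrable_conv:
  assumes L: "linear L" and f: "f \<in> borel_measurable borel" and \<kappa>: "integrable lborel \<kappa>" and p: "p \<ge> 1"
    and fin: "Npow p f < \<infinity>"
  shows "AE x in lborel. integrable lborel (\<lambda>z. \<kappa> z * f (x + L z))"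
proof -
  note [measurable] = shift_measurable[OF L f]
  have [measurable]: "\<kappa> \<in> borel_measurable borel" using borel_measurable_integrable[OF \<kappa>] by simp
  let ?F = "\<lambda>x z. ennreal (\<bar>\<kappa> z\<bar> * \<bar>case_prod (\<lambda>x z. f (x + L z)) (x, z)\<bar> powr p)"
  have "(\<integral>\<^sup>+x. (\<integral>\<^sup>+z. ?F x z \<partial>lborel) \<partial>lborel) = (\<integral>\<^sup>+z. (\<integral>\<^sup>+x. ?F x z \<partial>lborel) \<partial>lborel)"
    by (rule lborel_pair.Fubini'[symmetric]) measurable
  also have "\<dots> = (\<integral>\<^sup>+z. ennreal \<bar>\<kappa> z\<bar> * Npow p (\<lambda>x. f (x + L z)) \<partial>lborel)"
    unfolding Npow_def
  proof (intro nn_integral_cong)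
    fix z
    have [measurable]: "(\<lambda>x. f (x + L z)) \<in> borel_measurable borel"
      using f by measurable
    show "(\<integral>\<^sup>+x. ?F x z \<partial>lborel) = ennreal \<bar>\<kappa> z\<bar> * (\<integral>\<^sup>+x. ennreal (\<bar>f (x + L z)\<bar> powr p) \<partial>lborel)"
      by (subst nn_integral_cmult[symmetric]) (auto simp: ennreal_mult)
  qed
  also have "\<dots> = (\<integral>\<^sup>+z. ennreal \<bar>\<kappa> z\<bar> \<partial>lborel) * Npow p f"
    by (subst nn_integral_multc[symmetric]) (auto simp: Npow_shift f)
  also have "\<dots> < \<infinity>"
    using \<kappa> fin by (auto simp: ennreal_mult_less_top integrable_iff_bounded)
  finally have "AE x in lborel. (\<integral>\<^sup>+z. ?F x z \<partial>lborel) \<noteq> \<infinity>"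
    by (intro nn_integral_noteq_infinite) auto
  then show ?thesis
  proof eventually_elim
    case (elim x)
    have i: "integrable lborel (\<lambda>z. \<bar>\<kappa> z\<bar> * \<bar>f (x + L z)\<bar> powr p)"
      using elim by (intro integrableI_bounded) (auto simp: less_top)
    show ?case
    proof (rule Bochner_Integration.integrable_bound)
      show "integrable lborel (\<lambda>z. \<bar>\<kappa> z\<bar> + \<bar>\<kappa> z\<bar> * \<bar>f (x + L z)\<bar> powr p)" using i \<kappa> by auto
      have "\<bar>\<kappa> z\<bar> * \<bar>f (x + L z)\<bar> \<le> \<bar>\<kappa> z\<bar> + \<bar>\<kappa> z\<bar> * \<bar>f (x + L z)\<bar> powr p" for z
        using mult_left_mono[OF abs_le_1_plus_powr[OF p, of "f (x + L z)"], of "\<bar>\<kappa> z\<bar>"] by (simp add: algebra_simps)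
      then show "AE z in lborel. norm (\<kappa> z * f (x + L z)) \<le> norm (\<bar>\<kappa> z\<bar> + \<bar>\<kappa> z\<bar> * \<bar>f (x + L z)\<bar> powr p)"
        by (intro always_eventually) (auto simp: abs_mult)
    qed measurable
  qed
qed

lemma AE_conv_diff:
  assumes "linear L" "f \<in> borel_measurable borel" "g \<in> borel_measurable borel" "integrable lborel \<kappa>" "p \<ge> 1"
    "Npow p f < \<infinity>" "Npow p g < \<infinity>"
  shows "AE x in lborel. conv L \<kappa> (\<lambda>x. f x - g x) x = conv L \<kappa> f x - conv L \<kappa> g x"
  using AE_integrable_conv[OF assms(1,2,4,5,6)] AE_integrable_conv[OF assms(1,3,4,5,7)]
  by eventually_elim (simp add: conv_def right_diff_distrib)

text \<open>A kernel of mass one lets \<open>f x\<close> be moved under the integral, so the error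
  is an average of the differences f(x + L z) - f(x).\<close>

lemma Npow_conv_diff:
  assumes L: "linear L" and f: "f \<in> borel_measurable borel" and \<kappa>: "integrable lborel \<kappa>" and p: "p \<ge> 1"
    and fin: "Npow p f < \<infinity>" and prob: "\<And>z. \<kappa> z \<ge> 0" "(LINT z|lborel. \<kappa> z) = 1"
    and close: "\<And>z. \<kappa> z \<noteq> 0 \<Longrightarrow> Npow p (\<lambda>x. f (x + L z) - f x) \<le> e"
  shows "Npow p (\<lambda>x. conv L \<kappa> f x - f x) \<le> e"
proof -
  note [measurable] = shift_measurable[OF L f] f
  have [measurable]: "\<kappa> \<in> borel_measurable borel" using borel_measurable_integrable[OF \<kappa>] by simp
  have m: "(\<lambda>(z, x). f (x + L z) - f x) \<in> borel_measurable (borel \<Otimes>\<^sub>M borel)"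
    unfolding split_beta using shift_measurable(1)[OF L f, unfolded split_beta] by measurable
  have "Npow p (\<lambda>x. conv L \<kappa> f x - f x) = Npow p (\<lambda>x. LINT z|lborel. \<kappa> z * (f (x + L z) - f x))"
  proof (rule Npow_cong_AE)
    show "AE x in lborel. conv L \<kappa> f x - f x = (LINT z|lborel. \<kappa> z * (f (x + L z) - f x))"
      using AE_integrable_conv[OF L f \<kappa> p fin]
      by eventually_elim (use \<kappa> prob in \<open>simp add: conv_def right_diff_distrib\<close>)
  qed
  also have "\<dots> \<le> ennreal ((LINT z|lborel. \<bar>\<kappa> z\<bar>) powr (p - 1)) * (\<integral>\<^sup>+z. ennreal \<bar>\<kappa> z\<bar> * Npow p (\<lambda>x. f (x + L z) - f x) \<partial>lborel)"
    by (rule Npow_kernel[of "\<lambda>z x. f (x + L z) - f x", OF m \<kappa> p refl])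
  also have "\<dots> = (\<integral>\<^sup>+z. ennreal (\<kappa> z) * Npow p (\<lambda>x. f (x + L z) - f x) \<partial>lborel)"
    using prob by simp
  also have "\<dots> \<le> (\<integral>\<^sup>+z. ennreal (\<kappa> z) * e \<partial>lborel)"
  proof (rule nn_integral_mono)
    fix z show "ennreal (\<kappa> z) * Npow p (\<lambda>x. f (x + L z) - f x) \<le> ennreal (\<kappa> z) * e"
      by (cases "\<kappa> z = 0") (auto intro!: mult_left_mono close)
  qed
  also have "\<dots> = (\<integral>\<^sup>+z. ennreal (\<kappa> z) \<partial>lborel) * e"
    by (rule nn_integral_multc) measurable
  also have "(\<integral>\<^sup>+z. ennreal (\<kappa> z) \<partial>lborel) = 1"
    using nn_integral_eq_integral[OF \<kappa>] prob by auto
  finally show ?thesis by simp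
qed

section \<open>Continuity of translations in L^p\<close>

definition shift_cont :: "real \<Rightarrow> ('a::euclidean_space \<Rightarrow> real) \<Rightarrow> bool" where
  "shift_cont p f \<longleftrightarrow> (\<forall>e>0. \<exists>d>0. \<forall>h. norm h < d \<longrightarrow> Npow p (\<lambda>x. f (x + h) - f x) \<le> ennreal e)"

text \<open>Translations are isometries, so replacing \<open>f\<close> by \<open>g\<close> costs the
  same before and after the shift; continuity therefore passes to L^p limits.\<close>

lemma shift_cont_approx:
  fixes f :: "'a::euclidean_space \<Rightarrow> real"
  assumes [measurable]: "f \<in> borel_measurable borel" and p: "p \<ge> 1"
    and approx: "\<And>e. e > 0 \<Longrightarrow> \<exists>g\<in>borel_measurable borel. shift_cont p g \<and> Npow p (\<lambda>x. f x - g x) \<le> ennreal e"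
  shows "shift_cont p f"
  unfolding shift_cont_def
proof (intro allI impI)
  fix e :: real assume "e > 0"
  define C :: real where "C = 2 powr p"
  have C: "C > 0" by (simp add: C_def)
  \<comment> \<open>Two applications of the sum estimate give C (C (e' + e') + e'), and this choice
    makes that equal to \<open>e\<close>.\<close>
  define e' where "e' = e / (C * (C * 2 + 1))"
  have e': "e' > 0" using \<open>e > 0\<close> C by (simp add: e'_def)
  obtain g where [measurable]: "g \<in> borel_measurable borel" and g: "shift_cont p g" "Npow p (\<lambda>x. f x - g x) \<le> ennreal e'"
    using approx[OF e'] by auto
  obtain d where d: "d > 0" "\<And>h. norm h < d \<Longrightarrow> Npow p (\<lambda>x. g (x + h) - g x) \<le> ennreal e'"
    using g(1) e' unfolding shift_cont_def by blast
  have "Npow p (\<lambda>x. f (x + h) - f x) \<le> ennreal e" if "norm h < d" for h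
  proof -
    have "Npow p (\<lambda>x. f (x + h) - f x) = Npow p (\<lambda>x. ((f (x + h) - g (x + h)) - (f x - g x)) + (g (x + h) - g x))"
      by (simp add: Npow_def)
    also have "\<dots> \<le> C * (Npow p (\<lambda>x. (f (x + h) - g (x + h)) - (f x - g x)) + Npow p (\<lambda>x. g (x + h) - g x))"
      unfolding C_def by (intro Npow_add p) measurable
    also have "\<dots> \<le> C * (C * (Npow p (\<lambda>x. f (x + h) - g (x + h)) + Npow p (\<lambda>x. f x - g x)) + e')"
      unfolding C_def by (intro mult_left_mono add_mono d(2) that Npow_diff p; (measurable | simp))
    also have "Npow p (\<lambda>x. f (x + h) - g (x + h)) = Npow p (\<lambda>x. f x - g x)"
      by (rule Npow_shift[of "\<lambda>x. f x - g x"]) measurable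
    also have "C * (C * (Npow p (\<lambda>x. f x - g x) + Npow p (\<lambda>x. f x - g x)) + e') \<le> ennreal C * (ennreal C * (ennreal e' + ennreal e') + e')"
      by (intro mult_left_mono add_mono g order_refl) auto
    also have "\<dots> = ennreal (C * (C * (e' + e') + e'))"
      using C e' by (simp only: ennreal_mult ennreal_plus add_nonneg_nonneg mult_nonneg_nonneg less_imp_le)
    also have "C * (C * (e' + e') + e') = e"
      using C by (simp add: e'_def divide_simps) (simp add: algebra_simps)
    finally show ?thesis .
  qed
  with d(1) show "\<exists>d>0. \<forall>h. norm h < d \<longrightarrow> Npow p (\<lambda>x. f (x + h) - f x) \<le> ennreal e" by blast
qed

text \<open>\<open>A\<close> is sandwiched between a compact \<open>K\<close> and an open
  \<open>U\<close>, and shifts are so short that they keep \<open>K\<close> inside \<open>U\<close>.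
  If \<open>x + h\<close> lies in \<open>A\<close> and \<open>x\<close> does not, then
  \<open>x + h\<close> is in \<open>A - K\<close> or \<open>x\<close> is in \<open>U - A\<close>;
  the opposite case is symmetric.\<close>

lemma shift_cont_indicator:
  fixes A :: "'a::euclidean_space set"
  assumes A: "A \<in> sets borel" and fin: "emeasure lborel A < \<infinity>"
  shows "shift_cont p (indicat_real A)"
  unfolding shift_cont_def
proof (intro allI impI)
  fix e :: real assume "e > 0"
  obtain U where U: "open U" "A \<subseteq> U" "emeasure lborel (U - A) < ennreal (e / 6)"
    using outer_regular_lborel[OF A, of "e / 6"] \<open>e > 0\<close> by auto
  obtain V where V: "open V" "- A \<subseteq> V" "emeasure lborel (V - - A) < ennreal (e / 6)"
    using outer_regular_lborel[of "- A" "e / 6"] \<open>e > 0\<close> A by auto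
  have VA: "V - - A = A - (- V)" by auto
  have Vc: "closed (- V)" "- V \<subseteq> A" using V by auto
  \<comment> \<open>inner regularity by compact sets: exhaust the closed set by balls\<close>
  have "(\<lambda>n. emeasure lborel (A - (- V \<inter> cball 0 (real n)))) \<longlonglongrightarrow> emeasure lborel (\<Inter>n. A - (- V \<inter> cball 0 (real n)))"
  proof (rule Lim_emeasure_decseq)
    show "range (\<lambda>n. A - (- V \<inter> cball 0 (real n))) \<subseteq> sets lborel" using A V(1) by auto
    show "decseq (\<lambda>n. A - (- V \<inter> cball 0 (real n)))" by (auto simp: decseq_def)
    show "emeasure lborel (A - (- V \<inter> cball 0 (real n))) \<noteq> \<infinity>" for n
      using fin emeasure_mono[of "A - (- V \<inter> cball 0 (real n))" A lborel] A by (auto simp: top_unique)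
  qed
  moreover have "(\<Inter>n. A - (- V \<inter> cball 0 (real n))) = A - (- V)"
    using real_arch_simple by (fastforce simp: dist_norm)
  ultimately have "\<forall>\<^sub>F n in sequentially. emeasure lborel (A - (- V \<inter> cball 0 (real n))) < ennreal (e / 6)"
    using V(3) VA by (intro order_tendstoD(2)) auto
  then obtain n where n: "emeasure lborel (A - (- V \<inter> cball 0 (real n))) < ennreal (e / 6)"
    by (auto simp: eventually_sequentially)
  define K where "K = - V \<inter> cball 0 (real n)"
  have K: "compact K" "K \<subseteq> A" "emeasure lborel (A - K) < ennreal (e / 6)"
    using Vc n by (auto simp: K_def intro: closed_Int_compact)
  obtain d where d: "d > 0" "(\<Union>x\<in>K. ball x d) \<subseteq> U"
    using compact_subset_open_imp_ball_epsilon_subset[OF K(1) U(1)] K U by blast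
  have [measurable]: "A \<in> sets borel" "K \<in> sets borel" "U \<in> sets borel" "A - K \<in> sets borel" "U - A \<in> sets borel"
    using A K U by (auto simp: compact_imp_closed)
  \<comment> \<open>Each of the two sets has measure at most e / 6, whatever the shift; the four
    error terms below form two such pairs.\<close>
  have one: "(\<integral>\<^sup>+x. indicator (A - K) (x + h) + indicator (U - A) x \<partial>lborel) \<le> ennreal (e / 3)" for h :: 'a
  proof -
    have "(\<integral>\<^sup>+x. indicator (A - K) (x + h) + indicator (U - A) x \<partial>lborel)
        = (\<integral>\<^sup>+x. indicator (A - K) (x + h) \<partial>lborel) + (\<integral>\<^sup>+x. indicator (U - A) x \<partial>lborel)"
      by (rule nn_integral_add) measurable
    also have "(\<integral>\<^sup>+x. indicator (A - K) (x + h) \<partial>lborel) = (\<integral>\<^sup>+x. indicator (A - K) x \<partial>lborel)"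
      by (rule nn_integral_lborel_shift) measurable
    also have "(\<integral>\<^sup>+x. indicator (A - K) x \<partial>lborel) + (\<integral>\<^sup>+x. indicator (U - A) x \<partial>lborel) \<le> ennreal (e / 6) + ennreal (e / 6)"
      using K U by (intro add_mono) (auto simp: less_imp_le)
    also have "\<dots> = ennreal (e / 3)" using \<open>e > 0\<close> by (simp flip: ennreal_plus)
    finally show ?thesis .
  qed
  have "Npow p (\<lambda>x. indicat_real A (x + h) - indicat_real A x) \<le> ennreal e" if "norm h < d" for h
  proof -
    have KU: "x + h \<in> U" "x - h \<in> U" if "x \<in> K" for x
    proof -
      have "x + h \<in> ball x d" "x - h \<in> ball x d" using \<open>norm h < d\<close> by (auto simp: dist_norm)
      with that d(2) show "x + h \<in> U" "x - h \<in> U" by blast+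
    qed
    have "Npow p (\<lambda>x. indicat_real A (x + h) - indicat_real A x)
        \<le> (\<integral>\<^sup>+x. (indicator (A - K) (x + h) + indicator (U - A) x) + (indicator (A - K) x + indicator (U - A) (x + h)) \<partial>lborel)"
      unfolding Npow_def
    proof (rule nn_integral_mono)
      fix x
      show "ennreal (\<bar>indicat_real A (x + h) - indicat_real A x\<bar> powr p)
         \<le> (indicator (A - K) (x + h) + indicator (U - A) x) + (indicator (A - K) x + indicator (U - A) (x + h))"
        using KU(2)[of "x + h"] KU(1)[of x] U(2) by (auto simp: indicator_def)
    qed
    also have "\<dots> = (\<integral>\<^sup>+x. indicator (A - K) (x + h) + indicator (U - A) x \<partial>lborel)
        + (\<integral>\<^sup>+x. indicator (A - K) x + indicator (U - A) (x + h) \<partial>lborel)"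
      by (rule nn_integral_add) measurable
    \<comment> \<open>Translating the variable by \<open>h\<close> turns the second pair into an
      instance of \<open>one\<close> for \<open>- h\<close>.\<close>
    also have "(\<integral>\<^sup>+x. indicator (A - K) x + indicator (U - A) (x + h) \<partial>lborel)
        = (\<integral>\<^sup>+x. indicator (A - K) (x + (- h)) + indicator (U - A) x \<partial>lborel)"
      by (subst nn_integral_lborel_shift[of _ h, symmetric]) (auto, measurable)
    also have "(\<integral>\<^sup>+x. indicator (A - K) (x + h) + indicator (U - A) x \<partial>lborel) + \<dots> \<le> ennreal (e / 3) + ennreal (e / 3)"
      by (intro add_mono one)
    also have "\<dots> \<le> ennreal e" using \<open>e > 0\<close> by (simp flip: ennreal_plus)
    finally show ?thesis .
  qed
  with d(1) show "\<exists>d>0. \<forall>h. norm h < d \<longrightarrow> Npow p (\<lambda>x. indicat_real A (x + h) - indicat_real A x) \<le> ennreal e" by blast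
qed

lemma shift_cont_cmult:
  assumes [measurable]: "f \<in> borel_measurable borel" and "shift_cont p f"
  shows "shift_cont p (\<lambda>x. c * f x)"
  unfolding shift_cont_def
proof (intro allI impI)
  fix e :: real assume "e > 0"
  define C where "C = \<bar>c\<bar> powr p + 1"
  have C: "C > 0" by (auto simp: C_def intro: add_nonneg_pos)
  with \<open>e > 0\<close> obtain d where d: "d > 0" "\<And>h. norm h < d \<Longrightarrow> Npow p (\<lambda>x. f (x + h) - f x) \<le> ennreal (e / C)"
    using assms(2) unfolding shift_cont_def by (meson divide_pos_pos)
  have "Npow p (\<lambda>x. c * f (x + h) - c * f x) \<le> ennreal e" if "norm h < d" for h
  proof -
    have "Npow p (\<lambda>x. c * f (x + h) - c * f x) = ennreal (\<bar>c\<bar> powr p) * Npow p (\<lambda>x. f (x + h) - f x)"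
      by (subst Npow_cmult[symmetric]) (auto simp: right_diff_distrib)
    also have "\<dots> \<le> ennreal C * ennreal (e / C)"
      by (intro mult_mono d(2) that ennreal_leI) (auto simp: C_def)
    also have "\<dots> = ennreal e" using C \<open>e > 0\<close> by (simp flip: ennreal_mult)
    finally show ?thesis .
  qed
  with d(1) show "\<exists>d>0. \<forall>h. norm h < d \<longrightarrow> Npow p (\<lambda>x. c * f (x + h) - c * f x) \<le> ennreal e" by blast
qed

lemma shift_cont_add:
  assumes [measurable]: "f \<in> borel_measurable borel" "g \<in> borel_measurable borel"
    and fg: "shift_cont p f" "shift_cont p g" and p: "p \<ge> 1"
  shows "shift_cont p (\<lambda>x. f x + g x)"
  unfolding shift_cont_def
proof (intro allI impI)
  fix e :: real assume "e > 0"
  then have e: "e / (2 * 2 powr p) > 0" by simp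
  obtain d1 where d1: "d1 > 0" "\<And>h. norm h < d1 \<Longrightarrow> Npow p (\<lambda>x. f (x + h) - f x) \<le> ennreal (e / (2 * 2 powr p))"
    using fg(1) e unfolding shift_cont_def by blast
  obtain d2 where d2: "d2 > 0" "\<And>h. norm h < d2 \<Longrightarrow> Npow p (\<lambda>x. g (x + h) - g x) \<le> ennreal (e / (2 * 2 powr p))"
    using fg(2) e unfolding shift_cont_def by blast
  have "Npow p (\<lambda>x. (f (x + h) + g (x + h)) - (f x + g x)) \<le> ennreal e" if "norm h < min d1 d2" for h
  proof -
    have "Npow p (\<lambda>x. (f (x + h) - f x) + (g (x + h) - g x)) \<le> ennreal e"
      by (rule Npow_add_half[OF _ _ p \<open>e > 0\<close> d1(2) d2(2)]) (measurable, use that in auto)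
    then show ?thesis by (simp add: Npow_def algebra_simps)
  qed
  with d1(1) d2(1) show "\<exists>d>0. \<forall>h. norm h < d \<longrightarrow> Npow p (\<lambda>x. (f (x + h) + g (x + h)) - (f x + g x)) \<le> ennreal e"
    by (intro exI[of _ "min d1 d2"]) auto
qed

text \<open>Induction over indicators, sums and monotone limits. Finiteness of \<open>Npow\<close>
  is carried inside the induction as a premise, since summands and approximants inherit it from the
  function they build up.\<close>

lemma shift_cont_nonneg:
  fixes f :: "'a::euclidean_space \<Rightarrow> real"
  assumes f: "f \<in> borel_measurable lborel" "\<And>x. 0 \<le> f x" and p: "p \<ge> 1"
  shows "Npow p f < \<infinity> \<longrightarrow> shift_cont p f"
  using f
proof (induction rule: borel_measurable_induct_real)
  case (set A)
  have "Npow p (indicat_real A) = (\<integral>\<^sup>+x. indicator A x \<partial>lborel)"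
    unfolding Npow_def by (intro nn_integral_cong) (auto simp: indicator_def)
  with set show ?case by (auto intro!: shift_cont_indicator)
next
  case (mult u c)
  show ?case
  proof (cases "c = 0")
    case True
    then show ?thesis by (auto simp: shift_cont_def Npow_zero)
  next
    case False
    have "Npow p (\<lambda>x. c * u x) = ennreal (\<bar>c\<bar> powr p) * Npow p u"
      using mult by (intro Npow_cmult) auto
    then show ?thesis
      using mult False by (auto simp: ennreal_mult_less_top intro!: shift_cont_cmult)
  qed
next
  case (add u v)
  have "Npow p u \<le> Npow p (\<lambda>x. v x + u x)" "Npow p v \<le> Npow p (\<lambda>x. v x + u x)"
    using add p by (auto intro!: Npow_mono)
  then show ?case
    using add p by (auto intro!: shift_cont_add)
next
  case (seq U)
  have U: "U i x \<le> f x" for i x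
    using seq incseq_le[of "\<lambda>i. U i x" "f x" i] by (auto simp: incseq_def le_fun_def)
  note [measurable] = seq.hyps(1)
  have [measurable]: "f \<in> borel_measurable borel" using f by simp
  show ?case
  proof (intro impI shift_cont_approx p)
    fix e :: real assume fin: "Npow p f < \<infinity>" and "e > 0"
    have Ui: "shift_cont p (U i)" for i
    proof -
      have "Npow p (U i) \<le> Npow p f"
        using U seq.hyps(2) p by (intro Npow_mono) (auto intro: order_trans[OF U abs_ge_self])
      with fin seq.IH[of i] show ?thesis using order.strict_trans1 by blast
    qed
    have "(\<lambda>i. Npow p (\<lambda>x. f x - U i x)) \<longlonglongrightarrow> (\<integral>\<^sup>+x. 0 \<partial>(lborel :: 'a measure))"
      unfolding Npow_def
    \<comment> \<open>Since 0 <= U i <= f, the errors are dominated by |f|^p.\<close>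
    proof (rule nn_integral_dominated_convergence[where w = "\<lambda>x. ennreal (\<bar>f x\<bar> powr p)"])
      show "AE x in lborel. ennreal (\<bar>f x - U j x\<bar> powr p) \<le> ennreal (\<bar>f x\<bar> powr p)" for j
      proof (intro always_eventually allI ennreal_leI powr_mono2)
        fix x show "\<bar>f x - U j x\<bar> \<le> \<bar>f x\<bar>"
          using U[of j x] seq.hyps(2)[of j x] by linarith
      qed (use p in auto)
      show "AE x in lborel. (\<lambda>i. ennreal (\<bar>f x - U i x\<bar> powr p)) \<longlonglongrightarrow> 0"
      proof (intro always_eventually allI)
        fix x
        have "(\<lambda>i. \<bar>f x - U i x\<bar> powr p) \<longlonglongrightarrow> \<bar>f x - f x\<bar> powr p"
          using seq.hyps(4)[of x] p by (intro tendsto_powr' tendsto_intros) auto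
        then show "(\<lambda>i. ennreal (\<bar>f x - U i x\<bar> powr p)) \<longlonglongrightarrow> 0"
          using tendsto_ennrealI by fastforce
      qed
    qed (use fin in \<open>auto simp: Npow_def\<close>)
    then have "\<forall>\<^sub>F i in sequentially. Npow p (\<lambda>x. f x - U i x) < ennreal e"
      using \<open>e > 0\<close> by (intro order_tendstoD(2)) auto
    then obtain i where "Npow p (\<lambda>x. f x - U i x) \<le> ennreal e"
      by (auto simp: eventually_sequentially intro: less_imp_le)
    with Ui show "\<exists>g\<in>borel_measurable borel. shift_cont p g \<and> Npow p (\<lambda>x. f x - g x) \<le> ennreal e"
      using seq.hyps(1) by (intro bexI[of _ "U i"]) auto
  qed measurable
qed

text \<open>Positive and negative part are both covered by \<open>max 0 (s * f x)\<close> with a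
  sign \<open>s\<close>, and their difference is \<open>f\<close>.\<close>

lemma shift_cont:
  fixes f :: "'a::euclidean_space \<Rightarrow> real"
  assumes [measurable]: "f \<in> borel_measurable borel" and p: "p \<ge> 1" and fin: "Npow p f < \<infinity>"
  shows "shift_cont p f"
proof -
  have "shift_cont p (\<lambda>x. max 0 (s * f x))" if "\<bar>s\<bar> = 1" for s
  proof -
    have "\<bar>max 0 (s * f x)\<bar> \<le> \<bar>f x\<bar>" for x using that abs_ge_self[of "s * f x"] by (auto simp: max_def abs_mult)
    then have "Npow p (\<lambda>x. max 0 (s * f x)) \<le> Npow p f"
      using p by (intro Npow_mono) auto
    with fin p shift_cont_nonneg[of "\<lambda>x. max 0 (s * f x)" p]
    show ?thesis using order.strict_trans1[of "Npow p (\<lambda>x. max 0 (s * f x))" "Npow p f"] by simp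
  qed
  from this[of 1] this[of "-1"]
  have "shift_cont p (\<lambda>x. max 0 (f x) + (-1) * max 0 (- f x))"
    by (intro shift_cont_add shift_cont_cmult p) auto
  moreover have "(\<lambda>x. max 0 (f x) + (-1) * max 0 (- f x)) = f" by (auto simp: max_def)
  ultimately show ?thesis by simp
qed

section \<open>Supports of derivatives and stability of test functions\<close>

lemma pd_support: "{x. pd b f x \<noteq> 0} \<subseteq> closure {x. f x \<noteq> 0}"
proof (rule subsetI, rule ccontr)
  fix x assume "x \<in> {x. pd b f x \<noteq> 0}" and x: "x \<notin> closure {x. f x \<noteq> 0}"
  have "(f has_derivative (\<lambda>h. 0)) (at x)"
  proof (rule has_derivative_transform_within_open[where s = "- closure {x. f x \<noteq> 0}" and f = "\<lambda>x. 0"])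
    show "y \<in> - closure {x. f x \<noteq> 0} \<Longrightarrow> 0 = f y" for y
      using closure_subset[of "{x. f x \<noteq> 0}"] by auto
  qed (use x in auto)
  then have "pd b f x = 0" unfolding pd_def using frechet_derivative_at[of f "\<lambda>h. 0" x] by metis
  with \<open>x \<in> _\<close> show False by simp
qed

lemma iter_partial_support: "{x. iter_partial bs f x \<noteq> 0} \<subseteq> closure {x. f x \<noteq> 0}"
proof (induction bs)
  case (Cons b bs)
  show ?case
    unfolding iter_partial_Cons using pd_support closure_minimal[OF Cons closed_closure] by blast
qed (auto simp: closure_subset)

lemma bounded_support_iter_partial: "bounded {x. f x \<noteq> 0} \<Longrightarrow> bounded {x. iter_partial bs f x \<noteq> 0}"
  by (rule bounded_subset[OF bounded_closure iter_partial_support])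

lemma bounded_support_pd: "bounded {x. f x \<noteq> 0} \<Longrightarrow> bounded {x. pd b f x \<noteq> 0}"
  by (rule bounded_subset[OF bounded_closure pd_support])

lemma test_functionsI:
  "smooth \<phi> \<Longrightarrow> bounded {x. \<phi> x \<noteq> 0} \<Longrightarrow> closure {x. \<phi> x \<noteq> 0} \<subseteq> \<Omega> \<Longrightarrow> \<phi> \<in> test_functions \<Omega>"
  by (simp add: test_functions_def)

lemma test_functionsD:
  assumes "\<phi> \<in> test_functions \<Omega>"
  shows "smooth \<phi>" "bounded {x. \<phi> x \<noteq> 0}" "closure {x. \<phi> x \<noteq> 0} \<subseteq> \<Omega>"
    and "x \<notin> \<Omega> \<Longrightarrow> iter_partial bs \<phi> x = 0" "x \<notin> \<Omega> \<Longrightarrow> \<phi> x = 0"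
  using assms iter_partial_support[of bs \<phi>] iter_partial_support[of "[]" \<phi>] by (auto simp: test_functions_def)

lemma test_functions_iter_partial:
  assumes "\<phi> \<in> test_functions \<Omega>" "set bs \<subseteq> Basis"
  shows "iter_partial bs \<phi> \<in> test_functions \<Omega>"
proof (rule test_functionsI)
  show "closure {x. iter_partial bs \<phi> x \<noteq> 0} \<subseteq> \<Omega>"
    using closure_minimal[OF iter_partial_support closed_closure, of bs \<phi>] test_functionsD(3)[OF assms(1)] by auto
qed (auto intro!: smooth_iter_partial bounded_support_iter_partial assms test_functionsD[OF assms(1)])

lemma support_shift: "{x. f (x - a) \<noteq> (0::real)} = (+) a ` {x. f x \<noteq> 0}" for a :: "'a::euclidean_space"
  by (auto simp: image_iff) (metis add.commute diff_add_cancel)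

lemma bounded_support_shift: "bounded {x. f x \<noteq> (0::real)} \<Longrightarrow> bounded {x. f (x - a) \<noteq> 0}" for a :: "'a::euclidean_space"
  unfolding support_shift by (rule bounded_translation)

lemma test_functions_shift:
  assumes \<phi>: "\<phi> \<in> test_functions \<Omega>" and a: "\<And>x. x \<in> \<Omega> \<Longrightarrow> x + a \<in> \<Omega>"
  shows "(\<lambda>x. \<phi> (x - a)) \<in> test_functions \<Omega>"
proof (rule test_functionsI)
  show "bounded {x. \<phi> (x - a) \<noteq> 0}"
    by (intro bounded_support_shift test_functionsD[OF \<phi>])
  show "closure {x. \<phi> (x - a) \<noteq> 0} \<subseteq> \<Omega>"
    unfolding support_shift closure_translation using test_functionsD(3)[OF \<phi>] a by (auto simp: add.commute)
qed (intro smooth_shift test_functionsD[OF \<phi>])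

lemma test_functions_mult:
  assumes \<phi>: "\<phi> \<in> test_functions \<Omega>" and \<psi>: "smooth \<psi>"
  shows "(\<lambda>x. \<psi> x * \<phi> x) \<in> test_functions \<Omega>"
proof (rule test_functionsI)
  have sub: "{x. \<psi> x * \<phi> x \<noteq> 0} \<subseteq> {x. \<phi> x \<noteq> 0}" by auto
  show "bounded {x. \<psi> x * \<phi> x \<noteq> 0}"
    by (rule bounded_subset[OF test_functionsD(2)[OF \<phi>] sub])
  show "closure {x. \<psi> x * \<phi> x \<noteq> 0} \<subseteq> \<Omega>"
    using closure_mono[OF sub] test_functionsD(3)[OF \<phi>] by auto
qed (intro smooth_mult \<psi> test_functionsD[OF \<phi>])

lemma smooth_bounded:
  fixes f :: "'a::euclidean_space \<Rightarrow> real"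
  assumes "smooth f" "bounded {x. f x \<noteq> 0}"
  obtains M where "\<And>x. \<bar>f x\<bar> \<le> M"
proof -
  have "compact (f ` closure {x. f x \<noteq> 0})"
    using assms by (intro compact_continuous_image smooth_continuous) auto
  then obtain M where M: "\<And>x. x \<in> closure {x. f x \<noteq> 0} \<Longrightarrow> \<bar>f x\<bar> \<le> M"
    unfolding bounded_iff[THEN iffD1, OF compact_imp_bounded] using compact_imp_bounded bounded_iff
    by (metis (no_types, lifting) imageI real_norm_def)
  have "\<bar>f x\<bar> \<le> max 0 M" for x
    using M[of x] closure_subset[of "{x. f x \<noteq> 0}"] by (cases "f x = 0") (auto simp: max_def)
  then show ?thesis using that by blast
qed

lemma smooth_measurable: "smooth f \<Longrightarrow> f \<in> borel_measurable borel"
  by (intro borel_measurable_continuous_onI smooth_continuous)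

lemma smooth_integrable:
  "smooth f \<Longrightarrow> bounded {x. f x \<noteq> 0} \<Longrightarrow> integrable lborel f"
  by (metis smooth_bounded integrable_kernel smooth_measurable)

section \<open>Smoothness of convolutions\<close>

text \<open>Local integrability of a Borel function on the whole space, tested on balls. In contrast
  to \<open>locally_integrable\<close>, which concerns Lebesgue measurable functions on a given set,
  it provides functions to which product measures apply.\<close>

definition loc_int :: "('a::euclidean_space \<Rightarrow> real) \<Rightarrow> bool" where
  "loc_int u \<longleftrightarrow> u \<in> borel_measurable borel \<and> (\<forall>R. integrable lborel (\<lambda>x. indicat_real (cball 0 R) x * u x))"

lemma loc_int_measurable: "loc_int u \<Longrightarrow> u \<in> borel_measurable borel"
  by (simp add: loc_int_def)

lemma loc_int_integrable:
  assumes u: "loc_int u" and [measurable]: "\<psi> \<in> borel_measurable borel"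
    and \<psi>: "\<And>x. \<bar>\<psi> x\<bar> \<le> M" "bounded {x. \<psi> x \<noteq> 0}"
  shows "integrable lborel (\<lambda>x. \<psi> x * u x)"
proof -
  have [measurable]: "u \<in> borel_measurable borel" using u by (rule loc_int_measurable)
  obtain B where B: "\<And>x. \<psi> x \<noteq> 0 \<Longrightarrow> x \<in> cball 0 B" using \<psi>(2) unfolding bounded_iff by auto
  have "integrable lborel (\<lambda>x. M * (indicat_real (cball 0 B) x * u x))"
    using u by (simp add: loc_int_def)
  then show ?thesis
  proof (rule Bochner_Integration.integrable_bound)
    have "\<bar>\<psi> x * u x\<bar> \<le> \<bar>M * (indicat_real (cball 0 B) x * u x)\<bar>" for x
      using B[of x] \<psi>(1)[of x] by (cases "\<psi> x = 0") (auto simp: abs_mult intro!: mult_right_mono)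
    then show "AE x in lborel. norm (\<psi> x * u x) \<le> norm (M * (indicat_real (cball 0 B) x * u x))"
      by (intro always_eventually) auto
  qed measurable
qed

lemma smooth_loc_int_integrable:
  assumes "loc_int u" "smooth \<psi>" "bounded {x. \<psi> x \<noteq> 0}"
  shows "integrable lborel (\<lambda>x. \<psi> x * u x)" "integrable lborel (\<lambda>x. u x * \<psi> x)"
  using loc_int_integrable[OF assms(1) smooth_measurable[OF assms(2)] _ assms(3)] smooth_bounded[OF assms(2,3)]
  by (metis, metis (no_types, lifting) mult.commute Bochner_Integration.integrable_cong)

lemma loc_int_Npow:
  assumes "f \<in> borel_measurable borel" "Npow p f < \<infinity>" "p \<ge> 1"
  shows "loc_int f"
  unfolding loc_int_def using assms
  by (auto intro!: integrable_mult_bounded[where M = 1 and p = p] bounded_subset[OF bounded_cball[of 0]] simp: indicator_def)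

lemma loc_int_continuous: "continuous_on UNIV f \<Longrightarrow> loc_int (f :: 'a::euclidean_space \<Rightarrow> real)"
  unfolding loc_int_def
  using borel_integrable_compact[OF compact_cball, of 0 _ f]
  by (auto intro: borel_measurable_continuous_onI continuous_on_subset)

lemma loc_int_smooth: "smooth f \<Longrightarrow> loc_int f"
  by (rule loc_int_continuous[OF smooth_continuous])

lemma loc_int_shift:
  assumes u: "loc_int u" shows "loc_int (\<lambda>x. u (x + a))"
proof -
  have [measurable]: "u \<in> borel_measurable borel" using u by (rule loc_int_measurable)
  have "integrable lborel (\<lambda>x. indicat_real (cball 0 R) x * u (x + a))" for R
  proof -
    have "integrable lborel (\<lambda>x. indicat_real (cball a R) x * u x)"
      by (rule loc_int_integrable[OF u, where M = 1])
         (auto simp: indicator_def intro: bounded_subset[OF bounded_cball[of a R]])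
    moreover have [measurable]: "cball a R \<in> sets borel" by auto
    ultimately have "integrable (distr lborel borel ((+) a)) (\<lambda>x. indicat_real (cball a R) x * u x)"
      by (simp add: lborel_distr_plus)
    then have "integrable lborel (\<lambda>x. indicat_real (cball a R) (a + x) * u (a + x))"
      by (subst (asm) integrable_distr_eq) measurable
    moreover have "indicat_real (cball a R) (a + x) = indicat_real (cball 0 R) x" for x
      by (simp add: indicator_def dist_norm)
    ultimately show ?thesis by (simp add: add.commute)
  qed
  then show ?thesis by (simp add: loc_int_def)
qed

lemma conv_id_integrable:
  assumes "loc_int u" "smooth K" "bounded {x. K x \<noteq> 0}"
  shows "integrable lborel (\<lambda>z. K z * u (x + z))"
  using smooth_loc_int_integrable(1)[OF loc_int_shift[OF assms(1)] assms(2,3), of x] by (simp add: add.commute)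

text \<open>A change of variables shifts the dependence on \<open>x\<close> from \<open>u\<close> to
  the kernel, where it can be differentiated.\<close>

lemma conv_id_eq:
  assumes "u \<in> borel_measurable borel" "K \<in> borel_measurable borel"
  shows "conv (\<lambda>z. z) K u x = (LINT y|lborel. K (y - x) * u y)"
proof -
  have "(LINT y|lborel. K (y - x) * u y) = (LINT z|lborel. K ((z + x) - x) * u (z + x))"
    by (rule integral_lborel_shift[symmetric]) (use assms in measurable)
  then show ?thesis by (simp add: conv_def add.commute)
qed

section \<open>Differentiation of convolutions\<close>

lemma uniform_continuity_bounded_support:
  fixes g :: "'a::euclidean_space \<Rightarrow> real"
  assumes g: "continuous_on UNIV g" and supp: "bounded {x. g x \<noteq> 0}" and "e > 0"
  obtains d where "d > 0" "\<And>x y. norm (x - y) < d \<Longrightarrow> \<bar>g x - g y\<bar> < e"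
proof -
  obtain B where B: "\<And>x. g x \<noteq> 0 \<Longrightarrow> norm x \<le> B" using supp unfolding bounded_iff by auto
  \<comment> \<open>The extra 1 leaves room for the second point: if one of two points at distance
    below 1 is in the support, both lie in the enlarged ball.\<close>
  have "uniformly_continuous_on (cball 0 (B + 1)) g"
    by (intro compact_uniformly_continuous continuous_on_subset[OF g]) auto
  then obtain d where d: "d > 0" "\<And>x y. x \<in> cball 0 (B + 1) \<Longrightarrow> y \<in> cball 0 (B + 1) \<Longrightarrow> dist x y < d \<Longrightarrow> dist (g x) (g y) < e"
    unfolding uniformly_continuous_on_def using \<open>e > 0\<close> by (metis dist_commute)
  have "\<bar>g x - g y\<bar> < e" if xy: "norm (x - y) < min d 1" for x y
  proof (cases "g x = 0 \<and> g y = 0")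
    case True
    then show ?thesis using \<open>e > 0\<close> by simp
  next
    case False
    then have "norm x \<le> B \<or> norm y \<le> B" using B by blast
    then have "norm x \<le> B + 1 \<and> norm y \<le> B + 1"
      using xy norm_triangle_ineq2[of x y] norm_triangle_ineq2[of y x] by (auto simp: norm_minus_commute)
    then show ?thesis using d(2)[of x y] xy by (simp add: dist_norm)
  qed
  then show ?thesis using that[of "min d 1"] d(1) by simp
qed

text \<open>The partials of \<open>K\<close> are uniformly continuous because their supports are
  bounded, so the mean value estimate holds with one \<open>d\<close> for all \<open>z\<close>. The
  increment is \<open>- h\<close>, hence the plus sign before the sum.\<close>

lemma smooth_uniform_linearization:
  fixes K :: "'a::euclidean_space \<Rightarrow> real"
  assumes K: "smooth K" "bounded {x. K x \<noteq> 0}" and "e > 0"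
  obtains d where "d > 0" "\<And>z h. norm h < d \<Longrightarrow> \<bar>K (z - h) - K z + (\<Sum>b\<in>Basis. (h \<bullet> b) * pd b K z)\<bar> \<le> e * norm h"
proof -
  define e' where "e' = e / DIM('a)"
  have e': "e' > 0" using \<open>e > 0\<close> by (simp add: e'_def)
  have "\<exists>d>0. \<forall>x y. norm (x - y) < d \<longrightarrow> \<bar>pd b K x - pd b K y\<bar> < e'" if "b \<in> Basis" for b
    using uniform_continuity_bounded_support[OF smooth_continuous[OF smooth_pd[OF K(1) that]] bounded_support_pd[OF K(2)] e']
    by metis
  then obtain d where d: "\<And>b. b \<in> Basis \<Longrightarrow> d b > 0"
    "\<And>b x y. b \<in> Basis \<Longrightarrow> norm (x - y) < d b \<Longrightarrow> \<bar>pd b K x - pd b K y\<bar> < e'"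
    by metis
  define D where "D = Min (d ` Basis)"
  have D: "D > 0" "\<And>b. b \<in> Basis \<Longrightarrow> D \<le> d b" using d(1) by (auto simp: D_def)
  show ?thesis
  proof (rule that[OF D(1)])
    fix z h :: 'a assume h: "norm h < D"
    let ?f = "\<lambda>x h. \<Sum>b\<in>Basis. (h \<bullet> b) * pd b K x"
    have "norm (K (z - h) - K z - ?f z ((z - h) - z)) \<le> norm ((z - h) - z) * e"
    proof (rule differentiable_bound_linearization[where S = "cball z (norm h)" and f' = ?f])
      show "z + t *\<^sub>R (z - h - z) \<in> cball z (norm h)" if "t \<in> {0..1}" for t
        using that by (simp add: dist_norm mult_left_le_one_le)
      show "(K has_derivative ?f x) (at x within cball z (norm h))" for x
        by (rule has_derivative_at_withinI[OF smooth_has_derivative[OF K(1)]])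
      show "onorm (?f x - ?f z) \<le> e" if "x \<in> cball z (norm h)" for x
      proof (rule onorm_le)
        fix v
        have "\<bar>\<Sum>b\<in>Basis. (v \<bullet> b) * (pd b K x - pd b K z)\<bar> \<le> (\<Sum>b\<in>(Basis::'a set). norm v * e')"
        proof (rule order_trans[OF sum_abs], rule sum_mono)
          fix b :: 'a assume b: "b \<in> Basis"
          have "norm (x - z) < d b"
            using that h D(2)[OF b] by (simp add: dist_norm norm_minus_commute)
          then show "\<bar>(v \<bullet> b) * (pd b K x - pd b K z)\<bar> \<le> norm v * e'"
            unfolding abs_mult using d(2)[OF b] Basis_le_norm[OF b]
            by (intro mult_mono) (auto simp: less_imp_le)
        qed
        also have "\<dots> = e * norm v" by (simp add: e'_def)
        finally show "norm ((?f x - ?f z) v) \<le> e * norm v"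
          by (simp add: right_diff_distrib sum_subtractf)
      qed
    qed simp
    then show "\<bar>K (z - h) - K z + ?f z h\<bar> \<le> e * norm h"
      by (simp add: sum_negf mult.commute)
  qed
qed

text \<open>The uniform linearization of the kernel can be integrated against |u| directly: for |h|
  < 1 the error lives in one fixed ball, on which \<open>u\<close> is integrable. The minus sign
  arises because the kernel is evaluated at \<open>y - x\<close>.\<close>

lemma conv_has_derivative:
  fixes K u :: "'a::euclidean_space \<Rightarrow> real"
  assumes K: "smooth K" "bounded {x. K x \<noteq> 0}" and u: "loc_int u"
  shows "(conv (\<lambda>z. z) K u has_derivative (\<lambda>h. \<Sum>b\<in>Basis. (h \<bullet> b) * - conv (\<lambda>z. z) (pd b K) u x)) (at x)"
  unfolding has_derivative_at_alt
proof (intro conjI allI impI)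
  show "bounded_linear (\<lambda>h. \<Sum>b\<in>Basis. (h \<bullet> b) * - conv (\<lambda>z. z) (pd b K) u x)"
    unfolding linear_conv_bounded_linear[symmetric]
    by (intro linearI) (auto simp: inner_add_left distrib_right sum.distrib sum_distrib_left mult.assoc sum_negf sum_subtractf)
next
  fix e :: real assume "e > 0"
  have um[measurable]: "u \<in> borel_measurable borel" using u by (rule loc_int_measurable)
  have Km[measurable]: "K \<in> borel_measurable borel" by (rule smooth_measurable[OF K(1)])
  have pm: "pd b K \<in> borel_measurable borel" if "b \<in> Basis" for b
    by (rule smooth_measurable[OF smooth_pd[OF K(1) that]])
  obtain B where B: "\<And>x. K x \<noteq> 0 \<Longrightarrow> norm x \<le> B" and Bp: "\<And>x b. pd b K x \<noteq> 0 \<Longrightarrow> norm x \<le> B"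
  proof -
    obtain B where "{x. K x \<noteq> 0} \<subseteq> cball 0 B" using K(2) unfolding bounded_iff by (auto simp: subset_iff)
    with closure_minimal[OF this] pd_support[of _ K] that[of B] show ?thesis by fastforce
  qed
  \<comment> \<open>A ball containing the supports, in \<open>y\<close>, of
    \<open>K (y - x)\<close>, of its partials, and of \<open>K (y - (x + h))\<close> whenever |h| <
    1.\<close>
  define A :: "'a set" where "A = cball 0 (B + 1 + norm x)"
  define I where "I = (LINT y|lborel. indicat_real A y * \<bar>u y\<bar>)"
  have iA: "integrable lborel (\<lambda>y. indicat_real A y * \<bar>u y\<bar>)"
  proof -
    have "integrable lborel (\<lambda>y. \<bar>indicat_real A y * u y\<bar>)"
      using u by (intro integrable_abs) (auto simp: loc_int_def A_def)
    then show ?thesis by (simp add: abs_mult)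
  qed
  have I: "I \<ge> 0" by (simp add: I_def)
  \<comment> \<open>The denominator \<open>I + 1\<close> stays positive even if \<open>u\<close>
    vanishes on \<open>A\<close>.\<close>
  define e' where "e' = e / (I + 1)"
  have e': "e' > 0" using \<open>e > 0\<close> I by (simp add: e'_def)
  obtain d where d: "d > 0" "\<And>z h. norm h < d \<Longrightarrow> \<bar>K (z - h) - K z + (\<Sum>b\<in>Basis. (h \<bullet> b) * pd b K z)\<bar> \<le> e' * norm h"
    using smooth_uniform_linearization[OF K e'] by metis
  have ik: "integrable lborel (\<lambda>y. K (y - a) * u y)" for a
    by (rule smooth_loc_int_integrable(1)[OF u smooth_shift[OF K(1)] bounded_support_shift[OF K(2)]])
  have ip: "integrable lborel (\<lambda>y. pd b K (y - a) * u y)" if "b \<in> Basis" for a b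
    by (rule smooth_loc_int_integrable(1)[OF u smooth_shift[OF smooth_pd[OF K(1) that]] bounded_support_shift[OF bounded_support_pd[OF K(2)]]])
  have main: "\<bar>conv (\<lambda>z. z) K u (x + h) - conv (\<lambda>z. z) K u x - (\<Sum>b\<in>Basis. (h \<bullet> b) * - conv (\<lambda>z. z) (pd b K) u x)\<bar> \<le> e * norm h"
    if h: "norm h < min d 1" for h
  proof -
    let ?Q = "\<lambda>y. (K (y - (x + h)) - K (y - x) + (\<Sum>b\<in>Basis. (h \<bullet> b) * pd b K (y - x))) * u y"
    have "conv (\<lambda>z. z) K u (x + h) - conv (\<lambda>z. z) K u x - (\<Sum>b\<in>Basis. (h \<bullet> b) * - conv (\<lambda>z. z) (pd b K) u x)
      = (LINT y|lborel. K (y - (x + h)) * u y) - (LINT y|lborel. K (y - x) * u y)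
        + (LINT y|lborel. (\<Sum>b\<in>Basis. (h \<bullet> b) * (pd b K (y - x) * u y)))"
      using ip by (simp add: conv_id_eq um Km pm sum_negf integral_sum del: add_diff_cancel_left')
    also have "\<dots> = (LINT y|lborel. K (y - (x + h)) * u y - K (y - x) * u y + (\<Sum>b\<in>Basis. (h \<bullet> b) * (pd b K (y - x) * u y)))"
      using ip by (subst Bochner_Integration.integral_add[OF Bochner_Integration.integrable_diff[OF ik ik]])
        (auto simp: Bochner_Integration.integral_diff[OF ik ik])
    also have "\<dots> = (LINT y|lborel. ?Q y)"
      by (simp add: algebra_simps sum_distrib_left)
    also have "\<bar>\<dots>\<bar> \<le> (LINT y|lborel. (e' * norm h) * (indicat_real A y * \<bar>u y\<bar>))"
    proof (rule integral_abs_bound_integral)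
      show "integrable lborel ?Q"
      proof -
        have "integrable lborel (\<lambda>y. K (y - (x + h)) * u y - K (y - x) * u y + (\<Sum>b\<in>Basis. (h \<bullet> b) * (pd b K (y - x) * u y)))"
          using ik ip by auto
        then show ?thesis by (simp add: algebra_simps sum_distrib_left)
      qed
      show "\<bar>?Q y\<bar> \<le> (e' * norm h) * (indicat_real A y * \<bar>u y\<bar>)" for y
      proof (cases "y \<in> A")
        case True
        have "\<bar>K (y - (x + h)) - K (y - x) + (\<Sum>b\<in>Basis. (h \<bullet> b) * pd b K (y - x))\<bar> \<le> e' * norm h"
          using d(2)[of h "y - x"] h by (simp add: algebra_simps)
        then show ?thesis using True by (simp add: abs_mult mult_right_mono)
      next
        case False
        then have "norm y > B + 1 + norm x" by (simp add: A_def)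
        then have "norm (y - x) > B" "norm (y - (x + h)) > B"
          using norm_triangle_ineq2[of y x] norm_triangle_ineq2[of y "x + h"] norm_triangle_ineq[of x h] h by auto
        then have "K (y - x) = 0" "K (y - (x + h)) = 0" "\<And>b. pd b K (y - x) = 0"
          using B Bp by (meson not_le)+
        then show ?thesis using e' by simp
      qed
    qed (use iA in auto)
    also have "\<dots> = e' * norm h * I" by (simp add: I_def)
    also have "\<dots> \<le> e * norm h"
    proof -
      have "e' * I \<le> e" using \<open>e > 0\<close> I by (simp add: e'_def field_simps)
      then show ?thesis using mult_right_mono[of "e' * I" e "norm h"] by (simp add: mult_ac)
    qed
    finally show ?thesis .
  qed
  show "\<exists>d>0. \<forall>y. norm (y - x) < d \<longrightarrow>
      norm (conv (\<lambda>z. z) K u y - conv (\<lambda>z. z) K u x - (\<Sum>b\<in>Basis. ((y - x) \<bullet> b) * - conv (\<lambda>z. z) (pd b K) u x)) \<le> e * norm (y - x)"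
    using main[of "y - x" for y] d(1) by (intro exI[of _ "min d 1"]) auto
qed

lemma pd_conv:
  assumes "smooth K" "bounded {x. K x \<noteq> 0}" "loc_int u" "b \<in> Basis"
  shows "pd b (conv (\<lambda>z. z) K u) = (\<lambda>x. - conv (\<lambda>z. z) (pd b K) u x)"
proof (subst pd_eq[OF conv_has_derivative[OF assms(1-3)]])
  have "(\<Sum>c\<in>Basis. (b \<bullet> c) * - conv (\<lambda>z. z) (pd c K) u x) = (\<Sum>c\<in>Basis. if c = b then - conv (\<lambda>z. z) (pd c K) u x else 0)" for x
    using assms(4) by (intro sum.cong) (auto simp: inner_Basis)
  then show "(\<lambda>x. \<Sum>c\<in>Basis. (b \<bullet> c) * - conv (\<lambda>z. z) (pd c K) u x) = (\<lambda>x. - conv (\<lambda>z. z) (pd b K) u x)"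
    using assms(4) by simp
qed

text \<open>Differentiation replaces the kernel by minus its partial, so the convolutions of the
  fixed \<open>u\<close> with all smooth kernels of bounded support form an invariant
  family.\<close>

lemma smooth_conv:
  fixes K u :: "'a::euclidean_space \<Rightarrow> real"
  assumes K: "smooth K" "bounded {x. K x \<noteq> 0}" and u: "loc_int u"
  shows "smooth (conv (\<lambda>z. z) K u)"
proof (rule smooth_coinduct[where S = "{conv (\<lambda>z. z) K u | K. smooth K \<and> bounded {x. K x \<noteq> 0}}"])
  show "f differentiable (at x)" if "f \<in> {conv (\<lambda>z. z) K u | K. smooth K \<and> bounded {x. K x \<noteq> 0}}" for f and x :: 'a
    using that conv_has_derivative[OF _ _ u] unfolding differentiable_def by blast
  show "pd b f \<in> {conv (\<lambda>z. z) K u | K. smooth K \<and> bounded {x. K x \<noteq> 0}}"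
    if "f \<in> {conv (\<lambda>z. z) K u | K. smooth K \<and> bounded {x. K x \<noteq> 0}}" "b \<in> Basis" for f and b :: 'a
  proof -
    from that obtain K where f: "f = conv (\<lambda>z. z) K u" and K: "smooth K" "bounded {x. K x \<noteq> 0}" by blast
    have "pd b f = conv (\<lambda>z. z) (\<lambda>x. (-1) * pd b K x) u"
      unfolding f pd_conv[OF K u that(2)] by (simp add: conv_def fun_eq_iff)
    moreover have "smooth (\<lambda>x. (-1) * pd b K x)" "bounded {x. (-1) * pd b K x \<noteq> 0}"
      using smooth_cmult[OF smooth_pd[OF K(1) that(2)], of "-1"] bounded_support_pd[OF K(2), of b] by auto
    ultimately show ?thesis by blast
  qed
qed (use K in blast)

lemma iter_partial_conv:
  assumes K: "smooth K" "bounded {x. K x \<noteq> 0}" and u: "loc_int u" and bs: "set bs \<subseteq> Basis"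
  shows "iter_partial bs (conv (\<lambda>z. z) K u) = (\<lambda>x. (-1) ^ length bs * conv (\<lambda>z. z) (iter_partial bs K) u x)"
  using bs
proof (induction bs)
  case (Cons b bs)
  have K': "smooth (iter_partial bs K)" "bounded {x. iter_partial bs K x \<noteq> 0}"
    using Cons by (auto intro: smooth_iter_partial K bounded_support_iter_partial)
  show ?case
    using Cons by (simp add: iter_partial_Cons pd_cmult smooth_conv K' u pd_conv del: iter_partial.simps(2))
qed simp

section \<open>Weak derivatives\<close>

text \<open>Convolving \<open>F\<close> with the constant 1 gives a constant function, whose
  derivative is 0; by \<open>pd_conv\<close> this derivative is also minus the integral of the
  partial of \<open>F\<close>.\<close>

lemma integral_pd_zero:
  assumes F: "smooth F" "bounded {x. F x \<noteq> 0}" and b: "b \<in> Basis"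
  shows "(LINT x|lborel. pd b F x) = 0"
proof -
  have "pd b (conv (\<lambda>z. z) F (\<lambda>x. 1)) = (\<lambda>x. - conv (\<lambda>z. z) (pd b F) (\<lambda>x. 1) x)"
    by (intro pd_conv F b loc_int_continuous) auto
  moreover have "conv (\<lambda>z. z) F (\<lambda>x. 1) = (\<lambda>x. LINT z|lborel. F z)" by (simp add: conv_def fun_eq_iff)
  ultimately show ?thesis by (simp add: pd_const conv_def fun_eq_iff)
qed

lemma integral_by_parts:
  assumes f: "smooth f" and \<phi>: "smooth \<phi>" "bounded {x. \<phi> x \<noteq> 0}" and b: "b \<in> Basis"
  shows "(LINT x|lborel. f x * pd b \<phi> x) = - (LINT x|lborel. pd b f x * \<phi> x)"
proof -
  have "(LINT x|lborel. pd b (\<lambda>x. f x * \<phi> x) x) = 0"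
    by (intro integral_pd_zero smooth_mult f \<phi> b bounded_subset[OF \<phi>(2)]) auto
  moreover have "integrable lborel (\<lambda>x. f x * pd b \<phi> x)" "integrable lborel (\<lambda>x. pd b f x * \<phi> x)"
    by (intro smooth_loc_int_integrable loc_int_smooth smooth_pd f \<phi> b bounded_support_pd)+
  ultimately show ?thesis by (simp add: pd_mult f \<phi>)
qed

text \<open>Each step takes the outermost partial off \<open>\<phi>\<close> and makes it the
  innermost one on \<open>f\<close>, which reverses the order.\<close>

lemma integral_by_parts_iter:
  assumes "smooth f" and \<phi>: "smooth \<phi>" "bounded {x. \<phi> x \<noteq> 0}" and "set bs \<subseteq> Basis"
  shows "(LINT x|lborel. f x * iter_partial bs \<phi> x) = (-1) ^ length bs * (LINT x|lborel. iter_partial (rev bs) f x * \<phi> x)"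
  using assms(1,4)
proof (induction bs arbitrary: f)
  case (Cons b bs)
  have "(LINT x|lborel. f x * iter_partial (b # bs) \<phi> x) = - (LINT x|lborel. pd b f x * iter_partial bs \<phi> x)"
    using Cons.prems unfolding iter_partial_Cons
    by (intro integral_by_parts smooth_iter_partial \<phi> bounded_support_iter_partial) auto
  with Cons.IH[of "pd b f"] Cons.prems show ?case
    by (simp add: smooth_pd iter_partial_snoc del: iter_partial.simps(2))
qed simp

text \<open>The integral identity of \<open>has_weak_deriv\<close>, separated from local
  integrability and with integrals over the whole space: test functions vanish off
  \<open>\<Omega>\<close>, so only values on \<open>\<Omega>\<close> enter.\<close>

definition wd :: "'a::euclidean_space set \<Rightarrow> 'a multiset \<Rightarrow> ('a \<Rightarrow> real) \<Rightarrow> ('a \<Rightarrow> real) \<Rightarrow> bool" where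
  "wd \<Omega> \<alpha> u v \<longleftrightarrow> (\<forall>\<phi>\<in>test_functions \<Omega>. \<forall>bs. mset bs = \<alpha> \<longrightarrow>
      (LINT x|lborel. u x * iter_partial bs \<phi> x) = (-1) ^ size \<alpha> * (LINT x|lborel. v x * \<phi> x))"

lemma wd_empty: "wd \<Omega> {#} u u"
  by (simp add: wd_def)

lemma wd_smooth:
  assumes "smooth f" "b \<in> Basis"
  shows "wd \<Omega> {#b#} f (pd b f)"
  unfolding wd_def
proof (intro ballI allI impI)
  fix \<phi> bs assume \<phi>: "\<phi> \<in> test_functions \<Omega>" and "mset bs = {#b#}"
  then have "bs = [b]" by (simp add: mset_single_iff_right)
  with integral_by_parts[OF assms(1) test_functionsD(1,2)[OF \<phi>] assms(2)]
  show "(LINT x|lborel. f x * iter_partial bs \<phi> x) = (-1) ^ size {#b#} * (LINT x|lborel. pd b f x * \<phi> x)"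
    by (simp add: iter_partial_Cons del: iter_partial.simps(2))
qed

lemma wd_diff:
  assumes "wd \<Omega> \<alpha> u v" "wd \<Omega> \<alpha> u' v'" "loc_int u" "loc_int u'" "loc_int v" "loc_int v'" "set_mset \<alpha> \<subseteq> Basis"
  shows "wd \<Omega> \<alpha> (\<lambda>x. u x - u' x) (\<lambda>x. v x - v' x)"
  unfolding wd_def
proof (intro ballI allI impI)
  fix \<phi> bs assume \<phi>: "\<phi> \<in> test_functions \<Omega>" and bs: "mset bs = \<alpha>"
  then have "set bs \<subseteq> Basis" using assms(7) by (metis set_mset_mset)
  then have \<psi>: "iter_partial bs \<phi> \<in> test_functions \<Omega>" using \<phi> by (rule test_functions_iter_partial[rotated])
  have "integrable lborel (\<lambda>x. u x * iter_partial bs \<phi> x)" "integrable lborel (\<lambda>x. u' x * iter_partial bs \<phi> x)"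
    "integrable lborel (\<lambda>x. v x * \<phi> x)" "integrable lborel (\<lambda>x. v' x * \<phi> x)"
    using smooth_loc_int_integrable(2) test_functionsD[OF \<phi>] test_functionsD[OF \<psi>] assms by auto
  with assms(1,2) \<phi> bs
  show "(LINT x|lborel. (u x - u' x) * iter_partial bs \<phi> x) = (-1) ^ size \<alpha> * (LINT x|lborel. (v x - v' x) * \<phi> x)"
    by (auto simp: wd_def left_diff_distrib algebra_simps)
qed

section \<open>Averages and weak derivatives\<close>

lemma integral_conv_mult:
  fixes \<kappa> :: "'b::euclidean_space \<Rightarrow> real" and u \<psi> :: "'a::euclidean_space \<Rightarrow> real"
  assumes L: "linear L" and u: "u \<in> borel_measurable borel" "Npow p u < \<infinity>" and p: "p \<ge> 1"
    and \<kappa>: "integrable lborel \<kappa>"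
    and \<psi>: "\<psi> \<in> borel_measurable borel" "\<And>x. \<bar>\<psi> x\<bar> \<le> M" "bounded {x. \<psi> x \<noteq> 0}"
  shows "(LINT x|lborel. conv L \<kappa> u x * \<psi> x) = (LINT z|lborel. \<kappa> z * (LINT y|lborel. u y * \<psi> (y - L z)))"
proof -
  note [measurable] = u(1) \<psi>(1)
  have [measurable]: "\<kappa> \<in> borel_measurable borel" using borel_measurable_integrable[OF \<kappa>] by simp
  have m1: "(\<lambda>(z, x). u (x + L z)) \<in> borel_measurable (borel \<Otimes>\<^sub>M borel)"
    by (rule shift_measurable[OF L u(1)])
  let ?F = "\<lambda>z x. \<kappa> z * u (x + L z) * \<psi> x"
  have m2[measurable]: "case_prod ?F \<in> borel_measurable (lborel \<Otimes>\<^sub>M lborel)"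
    using m1 unfolding split_beta by measurable
  obtain B where B: "\<And>x. \<psi> x \<noteq> 0 \<Longrightarrow> norm x \<le> B" using \<psi>(3) unfolding bounded_iff by auto
  have M: "M \<ge> 0" using \<psi>(2)[of 0] by linarith
  define V where "V = emeasure lborel (cball 0 B :: 'a set)"
  have V: "V < \<infinity>" unfolding V_def using emeasure_bounded_finite[OF bounded_cball] by auto
  have "integrable (lborel \<Otimes>\<^sub>M lborel) (case_prod ?F)"
  proof (rule integrableI_bounded[OF m2])
    \<comment> \<open>On the support of \<open>\<psi>\<close>, |u| <= 1 + |u|^p. The resulting bound
      depends on \<open>z\<close> through |\<kappa> z| only, so the double integral is finite and
      Fubini applies.\<close>
    have bound: "(\<integral>\<^sup>+x. ennreal (norm (?F z x)) \<partial>lborel) \<le> ennreal \<bar>\<kappa> z\<bar> * (ennreal M * (V + Npow p u))" for z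
    proof -
      have "(\<integral>\<^sup>+x. ennreal (norm (?F z x)) \<partial>lborel)
          \<le> (\<integral>\<^sup>+x. ennreal (\<bar>\<kappa> z\<bar> * M) * (indicator (cball 0 B) x + ennreal (\<bar>u (x + L z)\<bar> powr p)) \<partial>lborel)"
      proof (rule nn_integral_mono)
        fix x
        show "ennreal (norm (?F z x)) \<le> ennreal (\<bar>\<kappa> z\<bar> * M) * (indicator (cball 0 B) x + ennreal (\<bar>u (x + L z)\<bar> powr p))"
        proof (cases "\<psi> x = 0")
          case False
          have "norm (?F z x) \<le> (\<bar>\<kappa> z\<bar> * M) * (1 + \<bar>u (x + L z)\<bar> powr p)"
            using mult_mono[OF mult_left_mono[OF \<psi>(2)[of x]] abs_le_1_plus_powr[OF p, of "u (x + L z)"], of "\<bar>\<kappa> z\<bar>"] M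
            by (simp add: abs_mult mult_ac)
          then have "ennreal (norm (?F z x)) \<le> ennreal ((\<bar>\<kappa> z\<bar> * M) * (1 + \<bar>u (x + L z)\<bar> powr p))"
            by (rule ennreal_leI)
          also have "\<dots> = ennreal (\<bar>\<kappa> z\<bar> * M) * (indicator (cball 0 B) x + ennreal (\<bar>u (x + L z)\<bar> powr p))"
            using B[OF False] M by (simp add: ennreal_mult)
          finally show ?thesis .
        qed simp
      qed
      also have "\<dots> = ennreal (\<bar>\<kappa> z\<bar> * M) * (V + Npow p (\<lambda>x. u (x + L z)))"
      proof -
        have "(\<integral>\<^sup>+x. indicator (cball 0 B) x + ennreal (\<bar>u (x + L z)\<bar> powr p) \<partial>lborel) = V + Npow p (\<lambda>x. u (x + L z))"
          unfolding V_def Npow_def by (subst nn_integral_add) (auto intro!: borel_measurable_indicator)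
        moreover have [measurable]: "cball (0::'a) B \<in> sets borel" by simp
        have "(\<lambda>x. indicator (cball 0 B) x + ennreal (\<bar>u (x + L z)\<bar> powr p)) \<in> borel_measurable borel"
          by measurable
        ultimately show ?thesis by (subst nn_integral_cmult) auto
      qed
      also have "\<dots> = ennreal \<bar>\<kappa> z\<bar> * (ennreal M * (V + Npow p u))"
        using M by (simp add: Npow_shift ennreal_mult mult.assoc)
      finally show ?thesis .
    qed
    have "(\<integral>\<^sup>+w. ennreal (norm (case_prod ?F w)) \<partial>(lborel \<Otimes>\<^sub>M lborel))
        = (\<integral>\<^sup>+z. (\<integral>\<^sup>+x. ennreal (norm (case_prod ?F (z, x))) \<partial>lborel) \<partial>lborel)"
      by (rule lborel.nn_integral_fst[symmetric]) measurable
    also have "\<dots> \<le> (\<integral>\<^sup>+z. ennreal \<bar>\<kappa> z\<bar> * (ennreal M * (V + Npow p u)) \<partial>lborel)"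
      using bound by (intro nn_integral_mono) simp
    also have "\<dots> = (\<integral>\<^sup>+z. ennreal \<bar>\<kappa> z\<bar> \<partial>lborel) * (ennreal M * (V + Npow p u))"
      by (rule nn_integral_multc) measurable
    also have "\<dots> < \<infinity>"
      using \<kappa> u(2) V by (auto simp: ennreal_mult_less_top integrable_iff_bounded)
    finally show "(\<integral>\<^sup>+w. ennreal (norm (case_prod ?F w)) \<partial>(lborel \<Otimes>\<^sub>M lborel)) < \<infinity>" .
  qed
  then have "(LINT x|lborel. LINT z|lborel. ?F z x) = (LINT z|lborel. LINT x|lborel. ?F z x)"
    by (rule lborel_pair.Fubini_integral)
  moreover have "(LINT x|lborel. LINT z|lborel. ?F z x) = (LINT x|lborel. conv L \<kappa> u x * \<psi> x)"
    unfolding conv_def by simp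
  moreover have "(LINT x|lborel. ?F z x) = \<kappa> z * (LINT y|lborel. u y * \<psi> (y - L z))" for z
    using integral_lborel_shift[of "\<lambda>y. u y * \<psi> (y - L z)" "L z"] by (simp add: mult.assoc)
  ultimately show ?thesis by simp
qed

text \<open>Fubini moves each translation from \<open>u\<close> to the test function. By
  \<open>inv\<close> the translate \<open>\<phi> (y - L z)\<close> is again a test function on
  \<open>\<Omega>\<close>, so the identity between \<open>u\<close> and \<open>v\<close> applies for
  each \<open>z\<close> of nonzero weight.\<close>

lemma wd_conv:
  fixes \<kappa> :: "'b::euclidean_space \<Rightarrow> real" and u v :: "'a::euclidean_space \<Rightarrow> real"
  assumes L: "linear L" and u: "u \<in> borel_measurable borel" "Npow p u < \<infinity>"
    and v: "v \<in> borel_measurable borel" "Npow p v < \<infinity>" and p: "p \<ge> 1"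
    and \<kappa>: "integrable lborel \<kappa>" and inv: "\<And>z x. \<kappa> z \<noteq> 0 \<Longrightarrow> x \<in> \<Omega> \<Longrightarrow> x + L z \<in> \<Omega>"
    and \<alpha>: "set_mset \<alpha> \<subseteq> Basis" and wd: "wd \<Omega> \<alpha> u v"
  shows "wd \<Omega> \<alpha> (conv L \<kappa> u) (conv L \<kappa> v)"
  unfolding wd_def
proof (intro ballI allI impI)
  fix \<phi> bs assume \<phi>: "\<phi> \<in> test_functions \<Omega>" and bs: "mset bs = \<alpha>"
  then have bs': "set bs \<subseteq> Basis" using \<alpha> by (metis set_mset_mset)
  then have \<psi>: "iter_partial bs \<phi> \<in> test_functions \<Omega>" using \<phi> by (rule test_functions_iter_partial[rotated])
  obtain M where M: "\<And>x. \<bar>\<phi> x\<bar> \<le> M" using smooth_bounded test_functionsD[OF \<phi>] by metis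
  obtain M' where M': "\<And>x. \<bar>iter_partial bs \<phi> x\<bar> \<le> M'" using smooth_bounded test_functionsD[OF \<psi>] by metis
  have "(LINT x|lborel. conv L \<kappa> u x * iter_partial bs \<phi> x)
      = (LINT z|lborel. \<kappa> z * (LINT y|lborel. u y * iter_partial bs \<phi> (y - L z)))"
    by (rule integral_conv_mult[OF L u p \<kappa> _ M']) (auto intro: smooth_measurable test_functionsD[OF \<psi>])
  also have "\<dots> = (LINT z|lborel. (-1) ^ size \<alpha> * (\<kappa> z * (LINT y|lborel. v y * \<phi> (y - L z))))"
  proof (intro Bochner_Integration.integral_cong refl)
    fix z
    show "\<kappa> z * (LINT y|lborel. u y * iter_partial bs \<phi> (y - L z)) = (-1) ^ size \<alpha> * (\<kappa> z * (LINT y|lborel. v y * \<phi> (y - L z)))"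
    proof (cases "\<kappa> z = 0")
      case False
      have "(\<lambda>y. \<phi> (y - L z)) \<in> test_functions \<Omega>"
        by (rule test_functions_shift[OF \<phi> inv[OF False]])
      then have "(LINT y|lborel. u y * iter_partial bs (\<lambda>y. \<phi> (y - L z)) y) = (-1) ^ size \<alpha> * (LINT y|lborel. v y * \<phi> (y - L z))"
        using wd bs unfolding wd_def by blast
      then show ?thesis
        by (simp add: iter_partial_shift[OF test_functionsD(1)[OF \<phi>] bs'])
    qed simp
  qed
  also have "\<dots> = (-1) ^ size \<alpha> * (LINT z|lborel. \<kappa> z * (LINT y|lborel. v y * \<phi> (y - L z)))" by simp
  also have "(LINT z|lborel. \<kappa> z * (LINT y|lborel. v y * \<phi> (y - L z))) = (LINT x|lborel. conv L \<kappa> v x * \<phi> x)"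
    by (rule integral_conv_mult[OF L v p \<kappa> _ M, symmetric]) (auto intro: smooth_measurable test_functionsD[OF \<phi>])
  finally show "(LINT x|lborel. conv L \<kappa> u x * iter_partial bs \<phi> x) = (-1) ^ size \<alpha> * (LINT x|lborel. conv L \<kappa> v x * \<phi> x)" .
qed

text \<open>Fubini for a product kernel: the two partial averages commute, and together they form
  one full convolution. Commutation is what the trace functional needs; the single convolution
  yields smoothness in all variables at once.\<close>

lemma conv_conv_product:
  fixes \<rho> :: "'a::euclidean_space \<Rightarrow> real" and \<eta> :: "'b::euclidean_space \<Rightarrow> real"
  assumes f: "loc_int f"
    and \<rho>: "\<rho> \<in> borel_measurable borel" "\<And>x. \<bar>\<rho> x\<bar> \<le> M" "bounded {x. \<rho> x \<noteq> 0}"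
    and \<eta>: "\<eta> \<in> borel_measurable borel" "\<And>x. \<bar>\<eta> x\<bar> \<le> M'" "bounded {x. \<eta> x \<noteq> 0}"
  shows "conv (\<lambda>y. (y, 0)) \<rho> (conv (\<lambda>t. (0, t)) \<eta> f) = conv (\<lambda>z. z) (\<lambda>z. \<rho> (fst z) * \<eta> (snd z)) f" (is ?A)
    and "conv (\<lambda>t. (0, t)) \<eta> (conv (\<lambda>y. (y, 0)) \<rho> f) = conv (\<lambda>z. z) (\<lambda>z. \<rho> (fst z) * \<eta> (snd z)) f" (is ?B)
proof -
  note [measurable] = \<rho>(1) \<eta>(1) loc_int_measurable[OF f]
  let ?K = "\<lambda>z. \<rho> (fst z) * \<eta> (snd z)"
  have "integrable lborel (\<lambda>z. ?K z * f (z + x))" for x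
  proof (rule loc_int_integrable[OF loc_int_shift[OF f]])
    have fst[measurable]: "(fst :: 'a \<times> 'b \<Rightarrow> 'a) \<in> borel_measurable borel" "(snd :: 'a \<times> 'b \<Rightarrow> 'b) \<in> borel_measurable borel"
      by (auto intro!: borel_measurable_continuous_onI continuous_intros)
    show "?K \<in> borel_measurable borel" by measurable
    have M: "0 \<le> M" using \<rho>(2)[of 0] by linarith
    show "\<bar>?K z\<bar> \<le> M * M'" for z unfolding abs_mult by (intro mult_mono \<rho> \<eta> M) auto
    show "bounded {z. ?K z \<noteq> 0}"
      by (rule bounded_subset[OF bounded_Times[OF \<rho>(3) \<eta>(3)]]) auto
  qed
  note int0 = this
  have int: "integrable (lborel \<Otimes>\<^sub>M lborel) (\<lambda>(y, t). (\<rho> y * \<eta> t) * f (x + (y, t)))" for x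
    using int0[of x] by (simp add: lborel_prod case_prod_beta' add.commute)
  show ?A
  proof
    fix x
    have "conv (\<lambda>y. (y, 0)) \<rho> (conv (\<lambda>t. (0, t)) \<eta> f) x = (LINT y|lborel. LINT t|lborel. (\<rho> y * \<eta> t) * f (x + (y, t)))"
      by (simp add: conv_def mult.assoc add.assoc)
    also have "\<dots> = conv (\<lambda>z. z) ?K f x"
      by (subst lborel_pair.integral_fst[OF int]) (simp add: lborel_prod conv_def case_prod_beta')
    finally show "conv (\<lambda>y. (y, 0)) \<rho> (conv (\<lambda>t. (0, t)) \<eta> f) x = conv (\<lambda>z. z) ?K f x" .
  qed
  show ?B
  proof
    fix x
    have "conv (\<lambda>t. (0, t)) \<eta> (conv (\<lambda>y. (y, 0)) \<rho> f) x = (LINT t|lborel. LINT y|lborel. (\<rho> y * \<eta> t) * f (x + (y, t)))"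
      by (simp add: conv_def mult.assoc add.assoc mult.left_commute)
    also have "\<dots> = conv (\<lambda>z. z) ?K f x"
      by (subst lborel_pair.integral_snd[OF int]) (simp add: lborel_prod conv_def case_prod_beta')
    finally show "conv (\<lambda>t. (0, t)) \<eta> (conv (\<lambda>y. (y, 0)) \<rho> f) x = conv (\<lambda>z. z) ?K f x" .
  qed
qed

section \<open>Mollifiers\<close>

text \<open>Positive coordinates make each displacement map the half-space into itself, while the
  norm bound keeps it small.\<close>

definition pos_ball :: "real \<Rightarrow> 'a::euclidean_space set" where
  "pos_ball d = {z. norm z < d \<and> (\<forall>b\<in>Basis. 0 < z \<bullet> b)}"

text \<open>The explicit shape \<open>c * box_bump e\<close> is recorded because smoothness,
  symmetry of mixed partials and the behaviour under products are all read off from it.\<close>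

definition mollifier :: "real \<Rightarrow> ('a::euclidean_space \<Rightarrow> real) \<Rightarrow> bool" where
  "mollifier d \<kappa> \<longleftrightarrow> (\<exists>c e. \<kappa> = (\<lambda>x. c * box_bump e x)) \<and> (\<forall>x. \<kappa> x \<ge> 0) \<and> (LINT x|lborel. \<kappa> x) = 1
     \<and> {x. \<kappa> x \<noteq> 0} \<subseteq> pos_ball d"

lemma mollifier_exists:
  assumes "d > 0" obtains \<kappa> :: "'a::euclidean_space \<Rightarrow> real" where "mollifier d \<kappa>"
proof -
  \<comment> \<open>The norm is bounded by the sum of the absolute coordinates, so a box with sides
    shorter than \<open>d / DIM('a)\<close> fits into the ball of radius \<open>d\<close>.\<close>
  define \<epsilon> where "\<epsilon> = d / (2 * DIM('a))"
  have \<epsilon>: "\<epsilon> > 0" "\<epsilon> * DIM('a) < d" using assms by (auto simp: \<epsilon>_def)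
  define e :: 'a where "e = \<epsilon> *\<^sub>R One"
  have eb: "e \<bullet> b = \<epsilon>" if "b \<in> Basis" for b using that by (simp add: e_def)
  have supp: "box 0 e \<subseteq> pos_ball d"
  proof
    fix x assume x: "x \<in> box 0 e"
    then have b: "0 < x \<bullet> b \<and> x \<bullet> b < \<epsilon>" if "b \<in> Basis" for b
      using that eb by (auto simp: mem_box)
    have "norm x \<le> (\<Sum>b\<in>Basis. \<bar>x \<bullet> b\<bar>)" by (rule norm_le_l1)
    also have "\<dots> \<le> (\<Sum>b\<in>(Basis::'a set). \<epsilon>)" using b by (intro sum_mono) fastforce
    also have "\<dots> < d" using \<epsilon> by (simp add: mult.commute)
    finally show "x \<in> pos_ball d" using b by (simp add: pos_ball_def)
  qed
  define I where "I = (LINT x|lborel. box_bump e x)"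
  have bd: "bounded {x. box_bump e x \<noteq> 0}" by (simp add: box_bump_pos_iff)
  have int: "integrable lborel (box_bump e)"
    by (rule smooth_integrable[OF box_bump_derivs(1) bd])
  \<comment> \<open>A vanishing integral would make the box, where the bump is positive, a null
    set.\<close>
  have "I \<noteq> 0"
  proof
    assume "I = 0"
    then have "AE x in lborel. box_bump e x = 0"
      using integral_nonneg_eq_0_iff_AE[OF int] box_bump_nonneg by (auto simp: I_def)
    then have "AE x in lborel. x \<notin> box 0 e" by (simp add: box_bump_pos_iff[symmetric])
    then have "emeasure lborel (box 0 e) = 0"
      by (subst (asm) AE_iff_measurable[OF _ refl]) auto
    then show False using eb \<epsilon>(1) by (auto simp: emeasure_lborel_box_eq prod_pos)
  qed
  moreover have "I \<ge> 0" by (simp add: I_def box_bump_nonneg)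
  ultimately have I: "I > 0" by simp
  show ?thesis
  proof (rule that)
    show "mollifier d (\<lambda>x. (1 / I) * box_bump e x)"
      unfolding mollifier_def
    proof (intro conjI exI[of _ "1 / I"] exI[of _ e])
      show "(LINT x|lborel. 1 / I * box_bump e x) = 1" using I by (simp add: I_def)
    qed (use I supp in \<open>auto simp: box_bump_nonneg box_bump_pos_iff\<close>)
  qed
qed

lemma pos_ball_bounded: "bounded (pos_ball d)"
  by (rule bounded_subset[OF bounded_ball[of 0 d]]) (auto simp: pos_ball_def)

lemma mollifierD:
  assumes "mollifier d \<kappa>"
  shows "smooth \<kappa>" "\<kappa> x \<ge> 0" "(LINT x|lborel. \<kappa> x) = 1" "\<kappa> x \<noteq> 0 \<Longrightarrow> x \<in> pos_ball d"
    "bounded {x. \<kappa> x \<noteq> 0}" "integrable lborel \<kappa>" "\<kappa> \<in> borel_measurable borel"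
proof -
  show s: "smooth \<kappa>" using assms unfolding mollifier_def by (auto intro: smooth_cmult box_bump_derivs)
  show b: "bounded {x. \<kappa> x \<noteq> 0}" using assms unfolding mollifier_def by (auto intro: bounded_subset[OF pos_ball_bounded])
  show "integrable lborel \<kappa>" by (rule smooth_integrable[OF s b])
  show "\<kappa> \<in> borel_measurable borel" by (rule smooth_measurable[OF s])
qed (use assms in \<open>auto simp: mollifier_def\<close>)

lemma mollifier_abs_integral: "mollifier d \<kappa> \<Longrightarrow> (LINT x|lborel. \<bar>\<kappa> x\<bar>) = 1"
  by (simp add: mollifierD)

lemma mollifier_symmetric:
  assumes "mollifier d \<kappa>" "set bs \<subseteq> Basis" "mset bs = mset cs"
  shows "iter_partial bs \<kappa> = iter_partial cs \<kappa>"
proof -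
  have "set cs \<subseteq> Basis" using assms mset_eq_setD by blast
  moreover obtain c e where "\<kappa> = (\<lambda>x. c * box_bump e x)" using assms(1) by (auto simp: mollifier_def)
  ultimately show ?thesis
    using assms(2) box_bump_derivs(2)[OF assms(2,3), of e] by (simp add: iter_partial_cmult box_bump_derivs(1))
qed

lemma mollifier_product_smooth:
  fixes \<rho> :: "'a::euclidean_space \<Rightarrow> real" and \<eta> :: "real \<Rightarrow> real"
  assumes "mollifier d \<rho>" "mollifier d' \<eta>"
  shows "smooth (\<lambda>z. \<rho> (fst z) * \<eta> (snd z))" "bounded {z. \<rho> (fst z) * \<eta> (snd z) \<noteq> 0}"
proof -
  obtain c e c' e' where "\<rho> = (\<lambda>x. c * box_bump e x)" "\<eta> = (\<lambda>x. c' * box_bump e' x)"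
    using assms unfolding mollifier_def by auto
  then have "(\<lambda>z. \<rho> (fst z) * \<eta> (snd z)) = (\<lambda>z. (c * c') * box_bump (e, e') z)"
    by (auto simp: fun_eq_iff box_bump_Pair)
  then show "smooth (\<lambda>z. \<rho> (fst z) * \<eta> (snd z))" by (simp add: smooth_cmult box_bump_derivs)
  show "bounded {z. \<rho> (fst z) * \<eta> (snd z) \<noteq> 0}"
    by (rule bounded_subset[OF bounded_Times[OF mollifierD(5)[OF assms(1)] mollifierD(5)[OF assms(2)]]]) auto
qed

lemma mollifier_Npow: "mollifier d \<kappa> \<Longrightarrow> linear L \<Longrightarrow> f \<in> borel_measurable borel \<Longrightarrow> p \<ge> 1 \<Longrightarrow> Npow p (conv L \<kappa> f) \<le> Npow p f"
  using Npow_conv[of L f \<kappa> p] by (simp add: mollifierD(6) mollifier_abs_integral)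

text \<open>The estimate is uniform in the kernel: any mollifier of radius at most \<open>d\<close>
  will do, so that a single kernel can serve several functions.\<close>

lemma mollifier_approx:
  fixes L :: "'b::euclidean_space \<Rightarrow> 'a::euclidean_space"
  assumes L: "linear L" "\<And>z. norm (L z) \<le> norm z" and f: "f \<in> borel_measurable borel" "Npow p f < \<infinity>"
    and p: "p \<ge> 1" and "e > 0"
  obtains d where "d > 0" "\<And>d' \<kappa>. d' \<le> d \<Longrightarrow> mollifier d' \<kappa> \<Longrightarrow> Npow p (\<lambda>x. conv L \<kappa> f x - f x) \<le> ennreal e"
proof -
  obtain d where d: "d > 0" "\<And>h. norm h < d \<Longrightarrow> Npow p (\<lambda>x. f (x + h) - f x) \<le> ennreal e"
    using shift_cont[OF f(1) p f(2)] \<open>e > 0\<close> unfolding shift_cont_def by blast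
  show ?thesis
  proof (rule that[OF d(1)])
    fix d' and \<kappa> :: "'b \<Rightarrow> real" assume "d' \<le> d" and \<kappa>: "mollifier d' \<kappa>"
    show "Npow p (\<lambda>x. conv L \<kappa> f x - f x) \<le> ennreal e"
    proof (rule Npow_conv_diff[OF L(1) f(1) mollifierD(6)[OF \<kappa>] p f(2)])
      fix z assume "\<kappa> z \<noteq> 0"
      then have "norm z < d'" using mollifierD(4)[OF \<kappa>] by (auto simp: pos_ball_def)
      then have "norm (L z) < d" using L(2)[of z] \<open>d' \<le> d\<close> by linarith
      then show "Npow p (\<lambda>x. f (x + L z) - f x) \<le> ennreal e" by (rule d(2))
    qed (auto simp: mollifierD[OF \<kappa>])
  qed
qed

lemma mollifier_approx_finite:
  fixes L :: "'b::euclidean_space \<Rightarrow> 'a::euclidean_space"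
  assumes "finite A" and L: "linear L" "\<And>z. norm (L z) \<le> norm z"
    and f: "\<And>a. a \<in> A \<Longrightarrow> f a \<in> borel_measurable borel" "\<And>a. a \<in> A \<Longrightarrow> Npow p (f a) < \<infinity>"
    and p: "p \<ge> 1" and "e > 0"
  shows "\<exists>d>0. \<forall>a\<in>A. \<forall>d' \<kappa>. d' \<le> d \<longrightarrow> mollifier d' \<kappa> \<longrightarrow> Npow p (\<lambda>x. conv L \<kappa> (f a) x - f a x) \<le> ennreal e"
proof -
  have "\<exists>d>0. \<forall>d' \<kappa>. d' \<le> d \<longrightarrow> mollifier d' \<kappa> \<longrightarrow> Npow p (\<lambda>x. conv L \<kappa> (f a) x - f a x) \<le> ennreal e" if "a \<in> A" for a
    using mollifier_approx[OF L f(1)[OF that] f(2)[OF that] p \<open>e > 0\<close>] by metis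
  then obtain d where d: "\<And>a. a \<in> A \<Longrightarrow> d a > 0"
    "\<And>a d' \<kappa>. a \<in> A \<Longrightarrow> d' \<le> d a \<Longrightarrow> mollifier d' \<kappa> \<Longrightarrow> Npow p (\<lambda>x. conv L \<kappa> (f a) x - f a x) \<le> ennreal e"
    by metis
  define D where "D = Min (insert 1 (d ` A))"
  have "D > 0" "\<And>a. a \<in> A \<Longrightarrow> D \<le> d a" using d(1) \<open>finite A\<close> by (auto simp: D_def)
  then show ?thesis using d(2) by (meson order_trans)
qed

section \<open>Uniqueness of weak derivatives\<close>

text \<open>Translated mollifiers are admissible as \<open>\<phi>\<close>, so the mollification of
  \<open>f\<close> vanishes on \<open>C\<close>; it also converges to \<open>f\<close> in L^1.
  Restricting to functions supported near points of \<open>C\<close> is what makes the result usable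
  inside an open set.\<close>

lemma AE_zero_local:
  fixes f :: "'a::euclidean_space \<Rightarrow> real"
  assumes f: "integrable lborel f" and \<epsilon>: "\<epsilon> > 0" and C: "C \<in> sets borel"
    and zero: "\<And>\<phi> x. x \<in> C \<Longrightarrow> smooth \<phi> \<Longrightarrow> {y. \<phi> y \<noteq> 0} \<subseteq> cball x \<epsilon> \<Longrightarrow> (LINT y|lborel. f y * \<phi> y) = 0"
  shows "AE x in lborel. x \<in> C \<longrightarrow> f x = 0"
proof -
  have m[measurable]: "f \<in> borel_measurable borel" using borel_measurable_integrable[OF f] by simp
  have N: "Npow 1 f < \<infinity>" using f by (simp add: Npow_def integrable_iff_bounded)
  have le: "Npow 1 (\<lambda>x. indicat_real C x * f x) \<le> ennreal e" if e: "e > 0" for e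
  proof -
    obtain d where d: "d > 0" "\<And>d' \<kappa>. d' \<le> d \<Longrightarrow> mollifier d' \<kappa> \<Longrightarrow> Npow 1 (\<lambda>x. conv (\<lambda>z. z) \<kappa> f x - f x) \<le> ennreal e"
      using mollifier_approx[OF linear_ident order_refl m N order_refl e] by metis
    obtain \<kappa> where \<kappa>: "mollifier (min d \<epsilon>) (\<kappa> :: 'a \<Rightarrow> real)" using mollifier_exists[of "min d \<epsilon>"] d(1) \<epsilon> by auto
    have "conv (\<lambda>z. z) \<kappa> f x = 0" if "x \<in> C" for x
    proof -
      have "(LINT y|lborel. f y * \<kappa> (y - x)) = 0"
      proof (rule zero[OF that smooth_shift[OF mollifierD(1)[OF \<kappa>]]])
        show "{y. \<kappa> (y - x) \<noteq> 0} \<subseteq> cball x \<epsilon>"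
          using mollifierD(4)[OF \<kappa>] by (force simp: pos_ball_def dist_norm norm_minus_commute)
      qed
      then show ?thesis by (simp add: conv_id_eq m mollifierD(7)[OF \<kappa>] mult.commute)
    qed
    then have "Npow 1 (\<lambda>x. indicat_real C x * f x) \<le> Npow 1 (\<lambda>x. conv (\<lambda>z. z) \<kappa> f x - f x)"
      by (intro Npow_mono) (auto simp: indicator_def)
    also have "\<dots> \<le> ennreal e" by (rule d(2)[OF _ \<kappa>]) simp
    finally show ?thesis .
  qed
  have "Npow 1 (\<lambda>x. indicat_real C x * f x) = 0"
  proof (rule ccontr)
    assume "Npow 1 (\<lambda>x. indicat_real C x * f x) \<noteq> 0"
    moreover have "Npow 1 (\<lambda>x. indicat_real C x * f x) < \<infinity>" using le[of 1] by (auto simp: top_unique less_top[symmetric])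
    ultimately obtain r where r: "r > 0" "Npow 1 (\<lambda>x. indicat_real C x * f x) = ennreal r"
      by (cases "Npow 1 (\<lambda>x. indicat_real C x * f x)") (auto simp: less_le)
    then show False using le[of "r / 2"] by (simp add: ennreal_le_iff)
  qed
  moreover have [measurable]: "C \<in> sets borel" by (rule C)
  have "(\<lambda>x. indicat_real C x * f x) \<in> borel_measurable borel" by measurable
  ultimately show ?thesis by (simp add: Npow_eq_0_iff indicator_def)
qed

section \<open>Borel representatives of functions on a set\<close>

lemma lebesgue_on_transfer:
  fixes f g :: "'a::euclidean_space \<Rightarrow> real"
  assumes ae: "AE x in lborel. x \<in> \<Omega> \<longrightarrow> f x = g x" and [measurable]: "g \<in> borel_measurable borel" "\<Omega> \<in> sets borel"
  shows "f \<in> borel_measurable (lebesgue_on \<Omega>)"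
    and "integrable (lebesgue_on \<Omega>) f \<longleftrightarrow> integrable lborel (\<lambda>x. indicat_real \<Omega> x * g x)"
    and "(LINT x|lebesgue_on \<Omega>. f x) = (LINT x|lborel. indicat_real \<Omega> x * g x)"
proof -
  have \<Omega>: "\<Omega> \<inter> space lebesgue \<in> sets lebesgue" by auto
  have gm: "(\<lambda>x. indicat_real \<Omega> x * g x) \<in> borel_measurable lborel" by measurable
  then have gm': "(\<lambda>x. indicat_real \<Omega> x * g x) \<in> borel_measurable lebesgue" by (rule measurable_completion)
  have eq: "AE x in lebesgue. indicat_real \<Omega> x * f x = indicat_real \<Omega> x * g x"
    using ae by (auto simp: AE_completion_iff elim: eventually_mono)
  \<comment> \<open>Completeness of Lebesgue measure makes a function measurable once it agrees
    almost everywhere with a measurable one.\<close>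
  have fm: "(\<lambda>x. indicat_real \<Omega> x * f x) \<in> borel_measurable lebesgue"
  proof (rule measurableI)
    fix A :: "real set" assume A: "A \<in> sets borel"
    show "(\<lambda>x. indicat_real \<Omega> x * f x) -` A \<inter> space lebesgue \<in> sets lebesgue"
    proof (rule completion.in_sets_AE[where M = lborel and A = "(\<lambda>x. indicat_real \<Omega> x * g x) -` A \<inter> space lebesgue"])
      show "AE x in lebesgue. (x \<in> (\<lambda>x. indicat_real \<Omega> x * g x) -` A \<inter> space lebesgue) = (x \<in> (\<lambda>x. indicat_real \<Omega> x * f x) -` A \<inter> space lebesgue)"
        using eq by eventually_elim auto
    qed (use measurable_sets[OF gm' A] in auto)
  qed auto
  show "f \<in> borel_measurable (lebesgue_on \<Omega>)"
    using fm by (subst borel_measurable_restrict_space_iff[OF \<Omega>]) simp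
  show "integrable (lebesgue_on \<Omega>) f \<longleftrightarrow> integrable lborel (\<lambda>x. indicat_real \<Omega> x * g x)"
    using integrable_cong_AE[OF fm gm' eq] integrable_completion[OF gm]
    by (simp add: integrable_restrict_space[OF \<Omega>])
  show "(LINT x|lebesgue_on \<Omega>. f x) = (LINT x|lborel. indicat_real \<Omega> x * g x)"
    using integral_cong_AE[OF fm gm' eq] integral_completion[OF gm]
    by (simp add: integral_restrict_space[OF \<Omega>])
qed

lemma lebesgue_on_borel_rep:
  fixes f :: "'a::euclidean_space \<Rightarrow> real"
  assumes "f \<in> borel_measurable (lebesgue_on \<Omega>)" "\<Omega> \<in> sets borel"
  obtains g where "g \<in> borel_measurable borel" "\<And>x. x \<notin> \<Omega> \<Longrightarrow> g x = 0" "AE x in lborel. x \<in> \<Omega> \<longrightarrow> f x = g x"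
proof -
  have \<Omega>: "\<Omega> \<inter> space lebesgue \<in> sets lebesgue" using assms by auto
  have "(\<lambda>x. indicat_real \<Omega> x * f x) \<in> borel_measurable lebesgue"
    using assms borel_measurable_restrict_space_iff[OF \<Omega>, of f] by simp
  then obtain g where g: "g \<in> borel_measurable lborel" "AE x in lborel. indicat_real \<Omega> x * f x = g x"
    using completion_ex_borel_measurable_real by blast
  show ?thesis
  proof (rule that[of "\<lambda>x. indicat_real \<Omega> x * g x"])
    show "(\<lambda>x. indicat_real \<Omega> x * g x) \<in> borel_measurable borel" using g assms by auto
    show "AE x in lborel. x \<in> \<Omega> \<longrightarrow> f x = indicat_real \<Omega> x * g x" using g(2) by eventually_elim auto
  qed auto
qed

text \<open>The link between a function given on \<open>\<Omega>\<close> up to null sets and a Borel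
  function on the whole space; the latter can be translated, integrated over products and
  convolved.\<close>

definition rep :: "'a::euclidean_space set \<Rightarrow> ('a \<Rightarrow> real) \<Rightarrow> ('a \<Rightarrow> real) \<Rightarrow> bool" where
  "rep \<Omega> f g \<longleftrightarrow> g \<in> borel_measurable borel \<and> (AE x in lborel. x \<in> \<Omega> \<longrightarrow> f x = g x)"

lemma repD: "rep \<Omega> f g \<Longrightarrow> g \<in> borel_measurable borel" "rep \<Omega> f g \<Longrightarrow> AE x in lborel. x \<in> \<Omega> \<longrightarrow> f x = g x"
  by (auto simp: rep_def)

lemma rep_refl: "f \<in> borel_measurable borel \<Longrightarrow> rep \<Omega> f f"
  by (simp add: rep_def)

lemma rep_diff: "rep \<Omega> f g \<Longrightarrow> rep \<Omega> f' g' \<Longrightarrow> rep \<Omega> (\<lambda>x. f x - f' x) (\<lambda>x. g x - g' x)"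
  unfolding rep_def by (auto elim: eventually_elim2)

lemma rep_AE_trans: "AE x in lborel. x \<in> \<Omega> \<longrightarrow> f' x = f x \<Longrightarrow> rep \<Omega> f g \<Longrightarrow> rep \<Omega> f' g"
  unfolding rep_def by (auto elim: eventually_elim2)

lemma Npow_restrict_finite_iff:
  fixes g :: "'a::euclidean_space \<Rightarrow> real"
  assumes [measurable]: "g \<in> borel_measurable borel" "\<Omega> \<in> sets borel"
  shows "integrable lborel (\<lambda>x. indicat_real \<Omega> x * \<bar>g x\<bar> powr p) \<longleftrightarrow> Npow p (\<lambda>x. indicat_real \<Omega> x * g x) < \<infinity>"
    and "(LINT x|lborel. indicat_real \<Omega> x * \<bar>g x\<bar> powr p) = enn2real (Npow p (\<lambda>x. indicat_real \<Omega> x * g x))"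
proof -
  have eq: "Npow p (\<lambda>x. indicat_real \<Omega> x * g x) = (\<integral>\<^sup>+x. ennreal (indicat_real \<Omega> x * \<bar>g x\<bar> powr p) \<partial>lborel)"
    unfolding Npow_def by (intro nn_integral_cong) (auto simp: indicator_def)
  show "integrable lborel (\<lambda>x. indicat_real \<Omega> x * \<bar>g x\<bar> powr p) \<longleftrightarrow> Npow p (\<lambda>x. indicat_real \<Omega> x * g x) < \<infinity>"
    unfolding eq by (subst integrable_iff_bounded) (auto simp: abs_mult)
  show "(LINT x|lborel. indicat_real \<Omega> x * \<bar>g x\<bar> powr p) = enn2real (Npow p (\<lambda>x. indicat_real \<Omega> x * g x))"
    unfolding eq by (intro integral_eq_nn_integral) auto
qed

text \<open>\<open>enn2real\<close> sends infinity to 0 and thereby reproduces the convention that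
  the integral of a non-integrable function is 0, so the norm formula holds in all cases.\<close>

lemma Lp_rep:
  assumes f: "rep \<Omega> f g" and [measurable]: "\<Omega> \<in> sets borel"
  shows "f \<in> Lp p \<Omega> \<longleftrightarrow> Npow p (\<lambda>x. indicat_real \<Omega> x * g x) < \<infinity>"
    and "Lp_norm p \<Omega> f = enn2real (Npow p (\<lambda>x. indicat_real \<Omega> x * g x)) powr (1 / p)"
proof -
  have [measurable]: "g \<in> borel_measurable borel" using f by (rule repD)
  have ae: "AE x in lborel. x \<in> \<Omega> \<longrightarrow> \<bar>f x\<bar> powr p = \<bar>g x\<bar> powr p" using repD(2)[OF f] by eventually_elim auto
  have m: "(\<lambda>x. \<bar>g x\<bar> powr p) \<in> borel_measurable borel" by measurable
  show "f \<in> Lp p \<Omega> \<longleftrightarrow> Npow p (\<lambda>x. indicat_real \<Omega> x * g x) < \<infinity>"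
    unfolding Lp_def using lebesgue_on_transfer(1)[OF repD(2)[OF f]] lebesgue_on_transfer(2)[OF ae m]
    by (simp add: Npow_restrict_finite_iff)
  show "Lp_norm p \<Omega> f = enn2real (Npow p (\<lambda>x. indicat_real \<Omega> x * g x)) powr (1 / p)"
    unfolding Lp_norm_def lebesgue_on_transfer(3)[OF ae m assms(2)] by (simp add: Npow_restrict_finite_iff)
qed

lemma integral_test_rep:
  assumes f: "rep \<Omega> f g" and "\<Omega> \<in> sets borel" and \<psi>: "smooth \<psi>" "\<And>x. x \<notin> \<Omega> \<Longrightarrow> \<psi> x = 0"
  shows "(LINT x|lebesgue_on \<Omega>. f x * \<psi> x) = (LINT x|lborel. g x * \<psi> x)"
proof -
  have [measurable]: "g \<in> borel_measurable borel" using f by (rule repD)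
  have [measurable]: "\<psi> \<in> borel_measurable borel" by (rule smooth_measurable[OF \<psi>(1)])
  have ae: "AE x in lborel. x \<in> \<Omega> \<longrightarrow> f x * \<psi> x = g x * \<psi> x" using repD(2)[OF f] by eventually_elim auto
  have "(LINT x|lebesgue_on \<Omega>. f x * \<psi> x) = (LINT x|lborel. indicat_real \<Omega> x * (g x * \<psi> x))"
    by (rule lebesgue_on_transfer(3)[OF ae _ assms(2)]) measurable
  also have "\<dots> = (LINT x|lborel. g x * \<psi> x)"
    by (intro Bochner_Integration.integral_cong refl) (auto simp: indicator_def \<psi>)
  finally show ?thesis .
qed

lemma locally_integrable_rep:
  assumes f: "rep \<Omega> f g" and g: "loc_int g"
  shows "locally_integrable \<Omega> f"
  unfolding locally_integrable_def
proof (intro allI impI)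
  fix K assume K: "compact K \<and> K \<subseteq> \<Omega>"
  then have Kb: "K \<in> sets borel" by (auto simp: compact_imp_closed)
  have "integrable lborel (\<lambda>x. indicat_real K x * g x)"
    using K by (intro loc_int_integrable[OF g, where M = 1] borel_measurable_indicator Kb)
      (auto simp: indicator_def intro: bounded_subset[OF compact_imp_bounded])
  moreover have "AE x in lborel. x \<in> K \<longrightarrow> f x = g x" using repD(2)[OF f] K by (auto elim: eventually_mono)
  ultimately show "integrable (lebesgue_on K) f"
    using lebesgue_on_transfer(2)[OF _ repD(1)[OF f] Kb] by blast
qed

lemma has_weak_derivI:
  assumes "rep \<Omega> u u'" "rep \<Omega> v v'" "loc_int u'" "loc_int v'" "wd \<Omega> \<alpha> u' v'" "set_mset \<alpha> \<subseteq> Basis" "open \<Omega>"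
  shows "has_weak_deriv \<Omega> \<alpha> u v"
  unfolding has_weak_deriv_def
proof (intro conjI ballI allI impI)
  show "locally_integrable \<Omega> u" "locally_integrable \<Omega> v" using assms locally_integrable_rep by auto
  fix \<phi> bs assume \<phi>: "\<phi> \<in> test_functions \<Omega>" and bs: "mset bs = \<alpha>"
  then have "set bs \<subseteq> Basis" using assms(6) by (metis set_mset_mset)
  then have \<psi>: "iter_partial bs \<phi> \<in> test_functions \<Omega>" using \<phi> by (rule test_functions_iter_partial[rotated])
  have \<Omega>: "\<Omega> \<in> sets borel" using assms(7) by auto
  show "(LINT x|lebesgue_on \<Omega>. u x * iter_partial bs \<phi> x) = (-1) ^ size \<alpha> * (LINT x|lebesgue_on \<Omega>. v x * \<phi> x)"
    using integral_test_rep[OF assms(1) \<Omega> test_functionsD(1)[OF \<psi>] test_functionsD(5)[OF \<psi>]]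
      integral_test_rep[OF assms(2) \<Omega> test_functionsD(1)[OF \<phi>] test_functionsD(5)[OF \<phi>]]
      assms(5) \<phi> bs unfolding wd_def by auto
qed

lemma has_weak_derivD:
  assumes "has_weak_deriv \<Omega> \<alpha> u v" "rep \<Omega> u u'" "rep \<Omega> v v'" "set_mset \<alpha> \<subseteq> Basis" "open \<Omega>"
  shows "wd \<Omega> \<alpha> u' v'"
  unfolding wd_def
proof (intro conjI ballI allI impI)
  fix \<phi> bs assume \<phi>: "\<phi> \<in> test_functions \<Omega>" and bs: "mset bs = \<alpha>"
  then have "set bs \<subseteq> Basis" using assms(4) by (metis set_mset_mset)
  then have \<psi>: "iter_partial bs \<phi> \<in> test_functions \<Omega>" using \<phi> by (rule test_functions_iter_partial[rotated])
  have \<Omega>: "\<Omega> \<in> sets borel" using assms(5) by auto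
  show "(LINT x|lborel. u' x * iter_partial bs \<phi> x) = (-1) ^ size \<alpha> * (LINT x|lborel. v' x * \<phi> x)"
    using integral_test_rep[OF assms(2) \<Omega> test_functionsD(1)[OF \<psi>] test_functionsD(5)[OF \<psi>]]
      integral_test_rep[OF assms(3) \<Omega> test_functionsD(1)[OF \<phi>] test_functionsD(5)[OF \<phi>]]
      assms(1) \<phi> bs unfolding has_weak_deriv_def by metis
qed

section \<open>The fundamental lemma of the calculus of variations\<close>

lemma locally_integrable_compact_rep:
  fixes v :: "'a::euclidean_space \<Rightarrow> real"
  assumes "locally_integrable \<Omega> v" "compact K" "K \<subseteq> \<Omega>"
  obtains g where "integrable lborel g" "g \<in> borel_measurable borel"
    "\<And>\<phi>. \<lbrakk>open \<Omega>; smooth \<phi>; \<And>y. y \<notin> K \<Longrightarrow> \<phi> y = 0\<rbrakk> \<Longrightarrow> AE y in lborel. y \<in> \<Omega> \<longrightarrow> v y * \<phi> y = g y * \<phi> y"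
    "AE x in lborel. x \<in> K \<longrightarrow> v x = g x"
proof -
  have Kb: "K \<in> sets borel" using assms by (auto simp: compact_imp_closed)
  have iv: "integrable (lebesgue_on K) v" using assms by (auto simp: locally_integrable_def)
  then have "v \<in> borel_measurable (lebesgue_on K)" by (rule borel_measurable_integrable)
  then obtain g where g: "g \<in> borel_measurable borel" "\<And>x. x \<notin> K \<Longrightarrow> g x = 0" "AE x in lborel. x \<in> K \<longrightarrow> v x = g x"
    using lebesgue_on_borel_rep[OF _ Kb] by metis
  have "(\<lambda>x. indicat_real K x * g x) = g" using g(2) by (auto simp: indicator_def fun_eq_iff)
  with iv have "integrable lborel g" using lebesgue_on_transfer(2)[OF g(3) g(1) Kb] by simp
  moreover have "AE y in lborel. y \<in> \<Omega> \<longrightarrow> v y * \<phi> y = g y * \<phi> y" if "\<And>y. y \<notin> K \<Longrightarrow> \<phi> y = 0" for \<phi>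
    using g(3) by eventually_elim (use that in auto)
  ultimately show ?thesis using that g by blast
qed

text \<open>Countably many compact boxes cover \<open>\<Omega>\<close>. Around each, a compact
  neighbourhood still inside \<open>\<Omega>\<close> carries an integrable version of
  \<open>v\<close>, to which \<open>AE_zero_local\<close> applies.\<close>

lemma locally_integrable_zero:
  fixes v :: "'a::euclidean_space \<Rightarrow> real"
  assumes "open \<Omega>" and li: "locally_integrable \<Omega> v"
    and zero: "\<And>\<phi>. \<phi> \<in> test_functions \<Omega> \<Longrightarrow> (LINT x|lebesgue_on \<Omega>. v x * \<phi> x) = 0"
  shows "AE x in lborel. x \<in> \<Omega> \<longrightarrow> v x = 0"
proof -
  obtain \<D> where \<D>: "countable \<D>" "\<D> \<subseteq> Pow \<Omega>" "\<And>X. X \<in> \<D> \<Longrightarrow> \<exists>a b. X = cbox a b" "\<Union>\<D> = \<Omega>"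
    using open_countable_Union_open_cbox[OF \<open>open \<Omega>\<close>] by metis
  have "AE x in lborel. x \<in> C \<longrightarrow> v x = 0" if "C \<in> \<D>" for C
  proof -
    have C: "compact C" "C \<subseteq> \<Omega>" using \<D>(2) \<D>(3)[OF that] that by auto
    then obtain \<epsilon> where \<epsilon>: "\<epsilon> > 0" "(\<Union>x\<in>C. cball x \<epsilon>) \<subseteq> \<Omega>"
      using compact_subset_open_imp_cball_epsilon_subset[OF C(1) \<open>open \<Omega>\<close> C(2)] by metis
    define K where "K = (\<Union>x\<in>C. cball x \<epsilon>)"
    have K: "compact K" "K \<subseteq> \<Omega>" "C \<subseteq> K"
    proof -
      show "K \<subseteq> \<Omega>" "C \<subseteq> K" using \<epsilon> by (auto simp: K_def)
      \<comment> \<open>As the sum of the compact set \<open>C\<close> and a closed ball, the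
        neighbourhood is compact.\<close>
      have "K = {x + y |x y. x \<in> C \<and> y \<in> cball 0 \<epsilon>}"
      proof (intro set_eqI iffI)
        fix z assume "z \<in> K"
        then obtain x where "x \<in> C" "z \<in> cball x \<epsilon>" by (auto simp: K_def)
        then have "z = x + (z - x)" "z - x \<in> cball 0 \<epsilon>" by (auto simp: dist_norm norm_minus_commute)
        with \<open>x \<in> C\<close> show "z \<in> {x + y |x y. x \<in> C \<and> y \<in> cball 0 \<epsilon>}" by blast
      next
        fix z assume "z \<in> {x + y |x y. x \<in> C \<and> y \<in> cball 0 \<epsilon>}"
        then obtain x y where "x \<in> C" "norm y \<le> \<epsilon>" "z = x + y" by auto
        moreover from this have "z \<in> cball x \<epsilon>" by (simp add: dist_norm)
        ultimately show "z \<in> K" unfolding K_def by blast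
      qed
      then show "compact K" using compact_sums[OF C(1) compact_cball[of 0 \<epsilon>]] by (simp only:)
    qed
    obtain g where gi: "integrable lborel g" and g: "g \<in> borel_measurable borel"
      "\<And>\<phi>. \<lbrakk>open \<Omega>; smooth \<phi>; \<And>y. y \<notin> K \<Longrightarrow> \<phi> y = 0\<rbrakk> \<Longrightarrow> AE y in lborel. y \<in> \<Omega> \<longrightarrow> v y * \<phi> y = g y * \<phi> y"
      "AE x in lborel. x \<in> K \<longrightarrow> v x = g x"
      using locally_integrable_compact_rep[OF li K(1,2)] by blast
    have "AE x in lborel. x \<in> C \<longrightarrow> g x = 0"
    proof (rule AE_zero_local[OF gi \<epsilon>(1)])
      show "C \<in> sets borel" using C by (auto simp: compact_imp_closed)
      fix \<phi> x assume "x \<in> C" and \<phi>: "smooth \<phi>" "{y. \<phi> y \<noteq> 0} \<subseteq> cball x \<epsilon>"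
      have sub: "closure {y. \<phi> y \<noteq> 0} \<subseteq> K"
        using closure_minimal[OF \<phi>(2) closed_cball] \<open>x \<in> C\<close> by (auto simp: K_def)
      have "\<phi> \<in> test_functions \<Omega>"
        using sub K(2) by (intro test_functionsI \<phi> bounded_subset[OF bounded_cball \<phi>(2)]) auto
      then have z: "(LINT x|lebesgue_on \<Omega>. v x * \<phi> x) = 0" by (rule zero)
      have zK: "y \<notin> K \<Longrightarrow> \<phi> y = 0" for y using sub closure_subset[of "{y. \<phi> y \<noteq> 0}"] by auto
      note meq = g(2)[OF \<open>open \<Omega>\<close> \<phi>(1) zK]
      have [measurable]: "g \<in> borel_measurable borel" "\<phi> \<in> borel_measurable borel"
        using g smooth_measurable[OF \<phi>(1)] by auto
      have "(LINT x|lebesgue_on \<Omega>. v x * \<phi> x) = (LINT y|lborel. indicat_real \<Omega> y * (g y * \<phi> y))"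
        by (rule lebesgue_on_transfer(3)[OF meq]) (use \<open>open \<Omega>\<close> in auto)
      also have "\<dots> = (LINT y|lborel. g y * \<phi> y)"
        using zK K(2) by (intro Bochner_Integration.integral_cong refl) (auto simp: indicator_def)
      finally show "(LINT y|lborel. g y * \<phi> y) = 0" using z by simp
    qed
    with g(3) show ?thesis by eventually_elim (use K(3) in auto)
  qed
  then have "AE x in lborel. \<forall>C\<in>\<D>. x \<in> C \<longrightarrow> v x = 0"
    unfolding AE_ball_countable[OF \<D>(1)] by blast
  then show ?thesis by eventually_elim (use \<D>(4) in auto)
qed

lemma integrable_test:
  fixes v :: "'a::euclidean_space \<Rightarrow> real"
  assumes "open \<Omega>" "locally_integrable \<Omega> v" and \<phi>: "\<phi> \<in> test_functions \<Omega>"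
  shows "integrable (lebesgue_on \<Omega>) (\<lambda>x. v x * \<phi> x)"
proof -
  define K where "K = closure {x. \<phi> x \<noteq> 0}"
  have K: "compact K" "K \<subseteq> \<Omega>" using \<phi> by (auto simp: K_def test_functions_def)
  obtain g where gi: "integrable lborel g" and g: "g \<in> borel_measurable borel"
      "\<And>\<phi>. \<lbrakk>open \<Omega>; smooth \<phi>; \<And>y. y \<notin> K \<Longrightarrow> \<phi> y = 0\<rbrakk> \<Longrightarrow> AE y in lborel. y \<in> \<Omega> \<longrightarrow> v y * \<phi> y = g y * \<phi> y"
    using locally_integrable_compact_rep[OF assms(2) K] by blast
  have zK: "y \<notin> K \<Longrightarrow> \<phi> y = 0" for y using closure_subset[of "{y. \<phi> y \<noteq> 0}"] by (auto simp: K_def)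
  note meq = g(2)[OF assms(1) test_functionsD(1)[OF \<phi>] zK]
  have [measurable]: "g \<in> borel_measurable borel" "\<phi> \<in> borel_measurable borel"
    using g smooth_measurable[OF test_functionsD(1)[OF \<phi>]] by auto
  obtain M where M: "\<And>x. \<bar>\<phi> x\<bar> \<le> M" using smooth_bounded test_functionsD[OF \<phi>] by metis
  have "integrable lborel (\<lambda>x. M * g x)" using gi by simp
  then have "integrable lborel (\<lambda>x. indicat_real \<Omega> x * (g x * \<phi> x))"
  proof (rule Bochner_Integration.integrable_bound)
    have [measurable]: "\<Omega> \<in> sets borel" using assms(1) by auto
    show "(\<lambda>x. indicat_real \<Omega> x * (g x * \<phi> x)) \<in> borel_measurable lborel" by measurable
    have "\<bar>indicat_real \<Omega> x * (g x * \<phi> x)\<bar> \<le> \<bar>M * g x\<bar>" for x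
    proof -
      have "\<bar>g x\<bar> * \<bar>\<phi> x\<bar> \<le> \<bar>g x\<bar> * \<bar>M\<bar>" using M[of x] by (intro mult_left_mono) auto
      then show ?thesis by (auto simp: indicator_def abs_mult mult.commute)
    qed
    then show "AE x in lborel. norm (indicat_real \<Omega> x * (g x * \<phi> x)) \<le> norm (M * g x)" by (intro always_eventually) auto
  qed
  then show ?thesis
    using lebesgue_on_transfer(2)[OF meq] assms(1) by auto
qed

lemma has_weak_deriv_unique:
  fixes u :: "'a::euclidean_space \<Rightarrow> real"
  assumes "open \<Omega>" "has_weak_deriv \<Omega> \<alpha> u v" "has_weak_deriv \<Omega> \<alpha> u w"
  shows "AE x in lborel. x \<in> \<Omega> \<longrightarrow> v x = w x"
proof -
  have li: "locally_integrable \<Omega> v" "locally_integrable \<Omega> w" using assms by (auto simp: has_weak_deriv_def)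
  have "AE x in lborel. x \<in> \<Omega> \<longrightarrow> v x - w x = 0"
  proof (rule locally_integrable_zero[OF assms(1)])
    show "locally_integrable \<Omega> (\<lambda>x. v x - w x)" using li by (auto simp: locally_integrable_def)
    fix \<phi> assume \<phi>: "\<phi> \<in> test_functions \<Omega>"
    obtain bs where bs: "mset bs = \<alpha>" using ex_mset by blast
    have "(LINT x|lebesgue_on \<Omega>. u x * iter_partial bs \<phi> x) = (-1) ^ size \<alpha> * (LINT x|lebesgue_on \<Omega>. f x * \<phi> x)"
      if "has_weak_deriv \<Omega> \<alpha> u f" for f
      using that \<phi> bs unfolding has_weak_deriv_def by blast
    from this[OF assms(2)] this[OF assms(3)]
    have "(-1) ^ size \<alpha> * (LINT x|lebesgue_on \<Omega>. v x * \<phi> x) = (-1) ^ size \<alpha> * (LINT x|lebesgue_on \<Omega>. w x * \<phi> x)"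
      by simp
    then show "(LINT x|lebesgue_on \<Omega>. (v x - w x) * \<phi> x) = 0"
      using integrable_test[OF assms(1) li(1) \<phi>] integrable_test[OF assms(1) li(2) \<phi>] by (simp add: left_diff_distrib)
  qed
  then show ?thesis by simp
qed

text \<open>Uniqueness makes the choice in \<open>weak_deriv\<close> harmless: a representative of
  any weak derivative also represents the chosen one.\<close>

lemma weak_deriv_rep:
  assumes "open \<Omega>" "has_weak_deriv \<Omega> \<alpha> u v" "rep \<Omega> v v'"
  shows "rep \<Omega> (weak_deriv \<Omega> \<alpha> u) v'"
proof -
  have "has_weak_deriv \<Omega> \<alpha> u (weak_deriv \<Omega> \<alpha> u)"
    unfolding weak_deriv_def by (rule someI[of "has_weak_deriv \<Omega> \<alpha> u", OF assms(2)])
  from has_weak_deriv_unique[OF assms(1) this assms(2)] assms(3) show ?thesis by (rule rep_AE_trans)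
qed

text \<open>The representatives \<open>V \<alpha>\<close> are \<open>p\<close>-integrable on the whole space, so that they can be convolved;
  off \<open>\<Omega>\<close> their values are arbitrary.\<close>

definition wderivs :: "nat \<Rightarrow> real \<Rightarrow> 'a::euclidean_space set \<Rightarrow> ('a \<Rightarrow> real) \<Rightarrow> ('a multiset \<Rightarrow> 'a \<Rightarrow> real) \<Rightarrow> bool" where
  "wderivs k p \<Omega> u V \<longleftrightarrow> rep \<Omega> u (V {#}) \<and>
     (\<forall>\<alpha>\<in>multi_indices k. V \<alpha> \<in> borel_measurable borel \<and> Npow p (V \<alpha>) < \<infinity> \<and> wd \<Omega> \<alpha> (V {#}) (V \<alpha>))"

section \<open>Sobolev functions described by representatives\<close>

lemma empty_in_multi_indices: "{#} \<in> multi_indices k"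
  by (simp add: multi_indices_def)

lemma wderivsD:
  assumes "wderivs k p \<Omega> u V" "\<alpha> \<in> multi_indices k" "p \<ge> 1" "open \<Omega>"
  shows "V \<alpha> \<in> borel_measurable borel" "Npow p (V \<alpha>) < \<infinity>" "wd \<Omega> \<alpha> (V {#}) (V \<alpha>)" "loc_int (V \<alpha>)"
    "has_weak_deriv \<Omega> \<alpha> u (V \<alpha>)" "rep \<Omega> (weak_deriv \<Omega> \<alpha> u) (V \<alpha>)" "rep \<Omega> u (V {#})"
proof -
  show V: "V \<alpha> \<in> borel_measurable borel" "Npow p (V \<alpha>) < \<infinity>" "wd \<Omega> \<alpha> (V {#}) (V \<alpha>)" "rep \<Omega> u (V {#})"
    using assms by (auto simp: wderivs_def)
  show l: "loc_int (V \<alpha>)" using V assms by (auto intro: loc_int_Npow)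
  have l0: "loc_int (V {#})" using assms empty_in_multi_indices by (auto intro!: loc_int_Npow simp: wderivs_def)
  show h: "has_weak_deriv \<Omega> \<alpha> u (V \<alpha>)"
    using assms(2) by (intro has_weak_derivI[OF V(4) rep_refl[OF V(1)] l0 l V(3) _ assms(4)]) (auto simp: multi_indices_def)
  show "rep \<Omega> (weak_deriv \<Omega> \<alpha> u) (V \<alpha>)"
    by (rule weak_deriv_rep[OF assms(4) h rep_refl[OF V(1)]])
qed

lemma Npow_indicator_le: "p \<ge> 1 \<Longrightarrow> Npow p (\<lambda>x. indicat_real \<Omega> x * g x) \<le> Npow p g"
  by (intro Npow_mono) (auto simp: indicator_def)

lemma wderivs_Sobolev:
  assumes "wderivs k p \<Omega> u V" "p \<ge> 1" "open \<Omega>"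
  shows "u \<in> Sobolev k p \<Omega>"
proof -
  have fin: "Npow p (\<lambda>x. indicat_real \<Omega> x * V \<alpha> x) < \<infinity>" if "\<alpha> \<in> multi_indices k" for \<alpha>
    using wderivsD(2)[OF assms(1) that assms(2,3)] Npow_indicator_le[OF assms(2), of \<Omega> "V \<alpha>"] by (rule order.strict_trans1[rotated])
  have \<Omega>: "\<Omega> \<in> sets borel" using assms(3) by auto
  have "u \<in> Lp p \<Omega>"
    using Lp_rep(1)[OF wderivsD(7)[OF assms(1) empty_in_multi_indices assms(2,3)] \<Omega>] fin empty_in_multi_indices by blast
  moreover have "V \<alpha> \<in> Lp p \<Omega>" if "\<alpha> \<in> multi_indices k" for \<alpha>
    using Lp_rep(1)[OF rep_refl[OF wderivsD(1)[OF assms(1) that assms(2,3)]] \<Omega>] fin that by blast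
  ultimately show ?thesis
    unfolding Sobolev_def using wderivsD(5)[OF assms(1) _ assms(2,3)] by blast
qed

text \<open>Each representative is set to 0 off \<open>\<Omega>\<close>, so that its p-integrability
  over \<open>\<Omega>\<close> becomes p-integrability over the whole space.\<close>

lemma Sobolev_wderivs:
  fixes u :: "'a::euclidean_space \<Rightarrow> real"
  assumes u: "u \<in> Sobolev k p \<Omega>" and \<Omega>: "open \<Omega>" and p: "p \<ge> 1"
  obtains V where "wderivs k p \<Omega> u V" "\<And>\<alpha> x. \<alpha> \<in> multi_indices k \<Longrightarrow> x \<notin> \<Omega> \<Longrightarrow> V \<alpha> x = 0"
proof -
  have \<Omega>b: "\<Omega> \<in> sets borel" using \<Omega> by auto
  have ex: "\<exists>g. g \<in> borel_measurable borel \<and> (\<forall>x. x \<notin> \<Omega> \<longrightarrow> g x = 0) \<and> rep \<Omega> f g \<and> Npow p g < \<infinity>"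
    if "f \<in> Lp p \<Omega>" for f :: "'a \<Rightarrow> real"
  proof -
    have "f \<in> borel_measurable (lebesgue_on \<Omega>)" using that by (simp add: Lp_def)
    from lebesgue_on_borel_rep[OF this \<Omega>b] obtain g where
      g: "g \<in> borel_measurable borel" "\<And>x. x \<notin> \<Omega> \<Longrightarrow> g x = 0" "AE x in lborel. x \<in> \<Omega> \<longrightarrow> f x = g x" by metis
    have r: "rep \<Omega> f g" using g by (simp add: rep_def)
    moreover have "(\<lambda>x. indicat_real \<Omega> x * g x) = g" using g(2) by (auto simp: indicator_def fun_eq_iff)
    ultimately have "Npow p g < \<infinity>" using Lp_rep(1)[OF r \<Omega>b] that by simp
    with r g show ?thesis by blast
  qed
  have uL: "u \<in> Lp p \<Omega>" using u by (simp add: Sobolev_def)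
  have "\<exists>g. g \<in> borel_measurable borel \<and> (\<forall>x. x \<notin> \<Omega> \<longrightarrow> g x = 0) \<and> Npow p g < \<infinity> \<and> (\<exists>v. has_weak_deriv \<Omega> \<alpha> u v \<and> rep \<Omega> v g) \<and> (\<alpha> = {#} \<longrightarrow> rep \<Omega> u g)"
    if \<alpha>: "\<alpha> \<in> multi_indices k" for \<alpha>
  \<comment> \<open>For the empty multi-index the representative has to be one of \<open>u\<close>
    itself, because \<open>V {#}\<close> serves both as representative of \<open>u\<close> and as
    its derivative of order zero.\<close>
  proof (cases "\<alpha> = {#}")
    case True
    obtain g where g: "g \<in> borel_measurable borel" "\<forall>x. x \<notin> \<Omega> \<longrightarrow> g x = 0" "rep \<Omega> u g" "Npow p g < \<infinity>" using ex[OF uL] by blast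
    have "loc_int g" using g p by (auto intro: loc_int_Npow)
    then have "has_weak_deriv \<Omega> {#} u u"
      using g by (intro has_weak_derivI[OF g(3) g(3) _ _ wd_empty _ \<Omega>]) auto
    with g True show ?thesis by blast
  next
    case False
    obtain v where v: "v \<in> Lp p \<Omega>" "has_weak_deriv \<Omega> \<alpha> u v" using u \<alpha> unfolding Sobolev_def by blast
    with ex[OF v(1)] False show ?thesis by blast
  qed
  then obtain V where V: "\<And>\<alpha>. \<alpha> \<in> multi_indices k \<Longrightarrow> V \<alpha> \<in> borel_measurable borel \<and> (\<forall>x. x \<notin> \<Omega> \<longrightarrow> V \<alpha> x = 0) \<and> Npow p (V \<alpha>) < \<infinity> \<and> (\<exists>v. has_weak_deriv \<Omega> \<alpha> u v \<and> rep \<Omega> v (V \<alpha>)) \<and> (\<alpha> = {#} \<longrightarrow> rep \<Omega> u (V \<alpha>))"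
    by metis
  have r: "rep \<Omega> u (V {#})" using V[OF empty_in_multi_indices] by simp
  have "wd \<Omega> \<alpha> (V {#}) (V \<alpha>)" if "\<alpha> \<in> multi_indices k" for \<alpha>
    using V[OF that] has_weak_derivD[OF _ r _ _ \<Omega>] that by (auto simp: multi_indices_def)
  with r V have "wderivs k p \<Omega> u V" by (auto simp: wderivs_def)
  with V show ?thesis using that by blast
qed

lemma wderivs_diff:
  assumes "wderivs k p \<Omega> u V" "wderivs k p \<Omega> w W" "p \<ge> 1" "open \<Omega>"
  shows "wderivs k p \<Omega> (\<lambda>x. u x - w x) (\<lambda>\<alpha> x. V \<alpha> x - W \<alpha> x)"
  unfolding wderivs_def
proof (intro conjI ballI)
  note V = wderivsD[OF assms(1) _ assms(3,4)] and W = wderivsD[OF assms(2) _ assms(3,4)]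
  show "rep \<Omega> (\<lambda>x. u x - w x) (\<lambda>x. V {#} x - W {#} x)"
    by (intro rep_diff V(7)[OF empty_in_multi_indices] W(7)[OF empty_in_multi_indices])
  fix \<alpha> :: "'a multiset" assume \<alpha>: "\<alpha> \<in> multi_indices k"
  show "(\<lambda>x. V \<alpha> x - W \<alpha> x) \<in> borel_measurable borel" using V(1)[OF \<alpha>] W(1)[OF \<alpha>] by measurable
  have "Npow p (\<lambda>x. V \<alpha> x - W \<alpha> x) \<le> ennreal (2 powr p) * (Npow p (V \<alpha>) + Npow p (W \<alpha>))"
    by (intro Npow_diff V W \<alpha> assms)
  also have "\<dots> < \<infinity>" using V(2)[OF \<alpha>] W(2)[OF \<alpha>] by (auto simp: ennreal_mult_less_top)
  finally show "Npow p (\<lambda>x. V \<alpha> x - W \<alpha> x) < \<infinity>" .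
  show "wd \<Omega> \<alpha> (\<lambda>x. V {#} x - W {#} x) (\<lambda>x. V \<alpha> x - W \<alpha> x)"
    using \<alpha> by (intro wd_diff V W empty_in_multi_indices) (auto simp: multi_indices_def)
qed

lemma Sobolev_norm_wderivs:
  assumes "wderivs k p \<Omega> u V" "p \<ge> 1" "open \<Omega>"
  shows "Sobolev_norm k p \<Omega> u = (\<Sum>\<alpha>\<in>multi_indices k. enn2real (Npow p (\<lambda>x. indicat_real \<Omega> x * V \<alpha> x))) powr (1 / p)"
proof -
  have "Lp_norm p \<Omega> (weak_deriv \<Omega> \<alpha> u) powr p = enn2real (Npow p (\<lambda>x. indicat_real \<Omega> x * V \<alpha> x))"
    if "\<alpha> \<in> multi_indices k" for \<alpha>
    using Lp_rep(2)[OF wderivsD(6)[OF assms(1) that assms(2,3)], of p] assms by (auto simp: powr_powr)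
  then show ?thesis unfolding Sobolev_norm_def by simp
qed

lemma Sobolev_norm_small:
  assumes "e > 0" "p \<ge> 1"
  obtains \<delta> where "\<delta> > 0"
    "\<And>(u :: 'a::euclidean_space \<Rightarrow> real) V \<Omega>. wderivs k p \<Omega> u V \<Longrightarrow> open \<Omega> \<Longrightarrow> (\<And>\<alpha>. \<alpha> \<in> multi_indices k \<Longrightarrow> Npow p (V \<alpha>) \<le> ennreal \<delta>)
      \<Longrightarrow> Sobolev_norm k p \<Omega> u < e"
proof -
  let ?c = "real (card (multi_indices k :: 'a multiset set)) + 1"
  \<comment> \<open>At most \<open>?c\<close> terms of size \<open>\<delta>\<close> add up to at
    most (e / 2)^p. Halving \<open>e\<close> yields the strict inequality, and the 1 in
    \<open>?c\<close> makes it visibly positive.\<close>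
  define \<delta> where "\<delta> = (e / 2) powr p / ?c"
  have \<delta>: "\<delta> > 0" using assms by (simp add: \<delta>_def add_nonneg_pos)
  show ?thesis
  proof (rule that[OF \<delta>])
    fix u :: "'a \<Rightarrow> real" and V \<Omega>
    assume V: "wderivs k p \<Omega> u V" "open \<Omega>" and small: "\<And>\<alpha>. \<alpha> \<in> multi_indices k \<Longrightarrow> Npow p (V \<alpha>) \<le> ennreal \<delta>"
    have "enn2real (Npow p (\<lambda>x. indicat_real \<Omega> x * V \<alpha> x)) \<le> \<delta>" if "\<alpha> \<in> multi_indices k" for \<alpha>
      using order_trans[OF Npow_indicator_le[OF assms(2)] small[OF that]] \<delta> by (intro enn2real_leI) auto
    then have "(\<Sum>\<alpha>\<in>multi_indices k. enn2real (Npow p (\<lambda>x. indicat_real \<Omega> x * V \<alpha> x))) \<le> real (card (multi_indices k :: 'a multiset set)) * \<delta>"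
      using sum_bounded_above[of "multi_indices k :: 'a multiset set" "\<lambda>\<alpha>. enn2real (Npow p (\<lambda>x. indicat_real \<Omega> x * V \<alpha> x))" \<delta>] by simp
    also have "\<dots> \<le> ?c * \<delta>" using \<delta> by (simp add: algebra_simps)
    also have "\<dots> = (e / 2) powr p" by (simp add: \<delta>_def add_nonneg_pos less_imp_neq[symmetric] add_nonneg_eq_0_iff)
    finally have "Sobolev_norm k p \<Omega> u \<le> ((e / 2) powr p) powr (1 / p)"
      unfolding Sobolev_norm_wderivs[OF V(1) assms(2) V(2)] using assms by (intro powr_mono2 sum_nonneg) auto
    also have "\<dots> < e" using assms by (simp add: powr_powr)
    finally show "Sobolev_norm k p \<Omega> u < e" .
  qed
qed

lemma Npow_le_Sobolev_norm:
  assumes "wderivs k p \<Omega> u V" "p \<ge> 1" "open \<Omega>" "\<alpha> \<in> multi_indices k"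
  shows "Npow p (\<lambda>x. indicat_real \<Omega> x * V \<alpha> x) \<le> ennreal (Sobolev_norm k p \<Omega> u powr p)"
proof -
  let ?N = "\<lambda>\<alpha>. Npow p (\<lambda>x. indicat_real \<Omega> x * V \<alpha> x)"
  have fin: "?N \<alpha> < \<infinity>"
    using order.strict_trans1[OF Npow_indicator_le[OF assms(2)] wderivsD(2)[OF assms(1,4,2,3)]] .
  have "Sobolev_norm k p \<Omega> u powr p = (\<Sum>\<alpha>\<in>multi_indices k. enn2real (?N \<alpha>))"
    unfolding Sobolev_norm_wderivs[OF assms(1-3)] using assms(2) by (simp add: powr_powr sum_nonneg)
  moreover have "enn2real (?N \<alpha>) \<le> (\<Sum>\<alpha>\<in>multi_indices k. enn2real (?N \<alpha>))"
    by (rule member_le_sum[OF assms(4)]) (auto intro: finite_multi_indices)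
  ultimately have "ennreal (enn2real (?N \<alpha>)) \<le> ennreal (Sobolev_norm k p \<Omega> u powr p)" by (simp add: ennreal_leI)
  then show ?thesis using ennreal_enn2real[of "?N \<alpha>"] fin by (metis infinity_ennreal_def)
qed

section \<open>Cutoff functions\<close>

lemma Npow_bounded_support:
  fixes f :: "'a::euclidean_space \<Rightarrow> real"
  assumes "\<And>x. \<bar>f x\<bar> \<le> M" "bounded {x. f x \<noteq> 0}" "p \<ge> 1"
  shows "Npow p f < \<infinity>"
proof -
  obtain B where B: "\<And>x. f x \<noteq> 0 \<Longrightarrow> norm x \<le> B" using assms(2) unfolding bounded_iff by auto
  have "Npow p f \<le> (\<integral>\<^sup>+x. ennreal (M powr p) * indicator (cball (0::'a) B) x \<partial>lborel)"
    unfolding Npow_def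
  proof (rule nn_integral_mono)
    fix x show "ennreal (\<bar>f x\<bar> powr p) \<le> ennreal (M powr p) * indicator (cball 0 B) x"
      using B[of x] assms(1)[of x] assms(3) by (cases "f x = 0") (auto intro!: ennreal_leI powr_mono2)
  qed
  also have "\<dots> < \<infinity>"
    using emeasure_bounded_finite[OF bounded_cball, of "0::'a" B]
    by (subst nn_integral_cmult_indicator) (auto simp: ennreal_mult_less_top)
  finally show ?thesis .
qed

text \<open>The indicator of a ball of radius \<open>R + 1\<close> is mollified at the fixed scale
  1. Partials fall on the kernel, so their bound \<open>C\<close> is a sum of L^1 norms of kernel
  partials and does not depend on \<open>R\<close>.\<close>

lemma cutoff_exists:
  "\<exists>C\<ge>0::real. \<forall>R. \<exists>\<xi> :: 'a::euclidean_space \<Rightarrow> real. smooth \<xi> \<and> bounded {x. \<xi> x \<noteq> 0} \<and>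
    (\<forall>x. \<bar>\<xi> x\<bar> \<le> 1) \<and> (\<forall>x\<in>cball 0 R. \<xi> x = 1) \<and>
    (\<forall>b\<in>Basis. (\<forall>x. \<bar>pd b \<xi> x\<bar> \<le> C) \<and> (\<forall>x\<in>cball 0 R. pd b \<xi> x = 0))"
proof -
  obtain \<kappa> :: "'a \<Rightarrow> real" where \<kappa>: "mollifier 1 \<kappa>" using mollifier_exists[of 1] by auto
  note k = mollifierD[OF \<kappa>]
  define C where "C = (\<Sum>b\<in>Basis. LINT z|lborel. \<bar>pd b \<kappa> z\<bar>)"
  have C: "C \<ge> 0" "\<And>b. b \<in> Basis \<Longrightarrow> (LINT z|lborel. \<bar>pd b \<kappa> z\<bar>) \<le> C"
    by (auto simp: C_def intro!: sum_nonneg member_le_sum)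
  have supp: "norm z \<le> 1" if "\<kappa> z \<noteq> 0" for z using k(4)[OF that] by (simp add: pos_ball_def)
  have psupp: "norm z \<le> 1" if "pd b \<kappa> z \<noteq> 0" for z b
  proof -
    have "{z. \<kappa> z \<noteq> 0} \<subseteq> cball 0 1" using supp by auto
    from closure_minimal[OF this] pd_support[of b \<kappa>] that show ?thesis by fastforce
  qed
  show ?thesis
  proof (rule exI[of _ C], rule conjI[OF C(1)], intro exI conjI ballI allI)
    fix R :: real
    let ?I = "indicat_real (cball 0 (R + 1) :: 'a set)"
    let ?\<xi> = "conv (\<lambda>z. z) \<kappa> ?I"
    have cb[measurable]: "cball (0::'a) (R + 1) \<in> sets borel" by simp
    have Im: "?I \<in> borel_measurable borel" by measurable
    have "Npow 1 ?I < \<infinity>"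
      by (rule Npow_bounded_support[where M = 1]) (auto simp: indicator_def bounded_iff)
    then have li: "loc_int ?I" by (rule loc_int_Npow[OF Im]) simp
    have eq1: "?I (x + z) = 1" if "x \<in> cball 0 R" "norm z \<le> 1" for x z
      using that norm_triangle_ineq[of x z] by (simp add: indicator_def)
    show "smooth ?\<xi>" by (rule smooth_conv[OF k(1,5) li])
    show "bounded {x. ?\<xi> x \<noteq> 0}"
    proof (rule bounded_subset[OF bounded_cball])
      show "{x. ?\<xi> x \<noteq> 0} \<subseteq> cball 0 (R + 2)"
      proof (clarify, rule ccontr)
        fix x assume "?\<xi> x \<noteq> 0" "x \<notin> cball 0 (R + 2)"
        then have "\<kappa> z * ?I (x + z) = 0" for z
          using supp[of z] norm_triangle_ineq2[of x "- z"] by (auto simp: indicator_def)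
        with \<open>?\<xi> x \<noteq> 0\<close> show False by (simp add: conv_def)
      qed
    qed
    show "\<bar>?\<xi> x\<bar> \<le> 1" for x
    proof -
      have "\<bar>?\<xi> x\<bar> \<le> (LINT z|lborel. \<kappa> z)"
        unfolding conv_def
        by (rule integral_abs_bound_integral[OF conv_id_integrable[OF li k(1,5)] k(6)])
           (auto simp: indicator_def k(2))
      then show ?thesis by (simp add: k(3))
    qed
    show "?\<xi> x = 1" if "x \<in> cball 0 R" for x
    proof -
      have "\<kappa> z * ?I (x + z) = \<kappa> z" for z using eq1[OF that] supp by (cases "\<kappa> z = 0") auto
      then show ?thesis by (simp only: conv_def k(3))
    qed
    fix b :: 'a assume b: "b \<in> Basis"
    have ib: "integrable lborel (pd b \<kappa>)"
      by (rule smooth_integrable[OF smooth_pd[OF k(1) b] bounded_support_pd[OF k(5)]])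
    show "\<bar>pd b ?\<xi> x\<bar> \<le> C" for x
    proof -
      have "\<bar>conv (\<lambda>z. z) (pd b \<kappa>) ?I x\<bar> \<le> (LINT z|lborel. \<bar>pd b \<kappa> z\<bar>)"
        unfolding conv_def
        by (rule integral_abs_bound_integral[OF conv_id_integrable[OF li smooth_pd[OF k(1) b] bounded_support_pd[OF k(5)]]])
           (use ib in \<open>auto simp: indicator_def\<close>)
      then show ?thesis using C(2)[OF b] by (simp add: pd_conv[OF k(1,5) li b])
    qed
    show "pd b ?\<xi> x = 0" if "x \<in> cball 0 R" for x
    proof -
      \<comment> \<open>Over the support of the kernel the indicator equals 1, and the integral of a
        partial of a compactly supported smooth function is 0.\<close>
      have "pd b \<kappa> z * ?I (x + z) = pd b \<kappa> z" for z using eq1[OF that] psupp by (cases "pd b \<kappa> z = 0") auto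
      then show ?thesis by (simp only: pd_conv[OF k(1,5) li b] conv_def integral_pd_zero[OF k(1,5) b] minus_zero)
    qed
  qed
qed

lemma Npow_tail:
  fixes f :: "'a::euclidean_space \<Rightarrow> real"
  assumes [measurable]: "f \<in> borel_measurable borel" and fin: "Npow p f < \<infinity>" and p: "p \<ge> 1"
  shows "(\<lambda>n. Npow p (\<lambda>x. indicat_real (- cball 0 (real n)) x * f x)) \<longlonglongrightarrow> 0"
proof -
  have [measurable]: "- cball (0::'a) (real n) \<in> sets borel" for n by simp
  have "(\<lambda>n. Npow p (\<lambda>x. indicat_real (- cball 0 (real n)) x * f x)) \<longlonglongrightarrow> (\<integral>\<^sup>+x. 0 \<partial>(lborel :: 'a measure))"
    unfolding Npow_def
  proof (rule nn_integral_dominated_convergence[where w = "\<lambda>x. ennreal (\<bar>f x\<bar> powr p)"])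
    show "AE x in lborel. ennreal (\<bar>indicat_real (- cball 0 (real j)) x * f x\<bar> powr p) \<le> ennreal (\<bar>f x\<bar> powr p)" for j
      by (auto intro!: always_eventually simp: indicator_def)
    show "AE x in lborel. (\<lambda>n. ennreal (\<bar>indicat_real (- cball 0 (real n)) x * f x\<bar> powr p)) \<longlonglongrightarrow> 0"
    proof (intro always_eventually allI)
      fix x :: 'a
      obtain N where N: "norm x \<le> real N" using real_arch_simple by blast
      have "\<forall>\<^sub>F n in sequentially. ennreal (\<bar>indicat_real (- cball 0 (real n)) x * f x\<bar> powr p) = 0"
        using eventually_ge_at_top[of N] by eventually_elim (use N in \<open>auto simp: indicator_def\<close>)
      then show "(\<lambda>n. ennreal (\<bar>indicat_real (- cball 0 (real n)) x * f x\<bar> powr p)) \<longlonglongrightarrow> 0"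
        by (rule tendsto_eventually)
    qed
  qed (use fin in \<open>auto simp: Npow_def\<close>)
  then show ?thesis by simp
qed

text \<open>Testing the identity for \<open>u\<close> against \<open>\<xi> x * \<phi> x\<close> and
  expanding the partial of this product gives the Leibniz rule.\<close>

lemma wd_mult:
  assumes \<xi>: "smooth \<xi>" and wd: "wd \<Omega> {#b#} u v" and li: "loc_int u" "loc_int v" and b: "b \<in> Basis"
  shows "wd \<Omega> {#b#} (\<lambda>x. \<xi> x * u x) (\<lambda>x. \<xi> x * v x + pd b \<xi> x * u x)"
  unfolding wd_def
proof (intro ballI allI impI)
  fix \<phi> bs assume \<phi>: "\<phi> \<in> test_functions \<Omega>" and "mset bs = {#b#}"
  then have bs: "bs = [b]" by (simp add: mset_single_iff_right)
  note s = test_functionsD(1,2)[OF \<phi>]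
  have "(LINT x|lborel. u x * iter_partial [b] (\<lambda>x. \<xi> x * \<phi> x) x) = (-1) ^ size {#b#} * (LINT x|lborel. v x * (\<xi> x * \<phi> x))"
    using wd test_functions_mult[OF \<phi> \<xi>] unfolding wd_def by (metis mset_single_iff)
  then have 1: "(LINT x|lborel. u x * (\<xi> x * pd b \<phi> x + pd b \<xi> x * \<phi> x)) = - (LINT x|lborel. v x * (\<xi> x * \<phi> x))"
    by (simp add: iter_partial_Cons pd_mult \<xi> s del: iter_partial.simps(2))
  have "bounded {x. \<xi> x * pd b \<phi> x \<noteq> 0}" "bounded {x. pd b \<xi> x * \<phi> x \<noteq> 0}" "bounded {x. \<xi> x * \<phi> x \<noteq> 0}"
    by (auto intro: bounded_subset[OF bounded_support_pd[OF s(2)]] bounded_subset[OF s(2)])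
  then have i: "integrable lborel (\<lambda>x. u x * (\<xi> x * pd b \<phi> x))" "integrable lborel (\<lambda>x. u x * (pd b \<xi> x * \<phi> x))"
    "integrable lborel (\<lambda>x. v x * (\<xi> x * \<phi> x))"
    using li by (auto intro!: smooth_loc_int_integrable(2) smooth_mult smooth_pd \<xi> s b)
  have "(LINT x|lborel. \<xi> x * u x * pd b \<phi> x) = (LINT x|lborel. u x * (\<xi> x * pd b \<phi> x))"
    by (simp add: mult_ac)
  also have "\<dots> = - (LINT x|lborel. v x * (\<xi> x * \<phi> x)) - (LINT x|lborel. u x * (pd b \<xi> x * \<phi> x))"
    using 1 i by (simp add: distrib_left)
  also have "\<dots> = - (LINT x|lborel. v x * (\<xi> x * \<phi> x) + u x * (pd b \<xi> x * \<phi> x))"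
    using i by simp
  also have "(LINT x|lborel. v x * (\<xi> x * \<phi> x) + u x * (pd b \<xi> x * \<phi> x)) = (LINT x|lborel. (\<xi> x * v x + pd b \<xi> x * u x) * \<phi> x)"
    by (simp add: algebra_simps)
  finally show "(LINT x|lborel. \<xi> x * u x * iter_partial bs \<phi> x) = (-1) ^ size {#b#} * (LINT x|lborel. (\<xi> x * v x + pd b \<xi> x * u x) * \<phi> x)"
    by (simp add: bs iter_partial_Cons del: iter_partial.simps(2))
qed

lemma multi_indices_1: "multi_indices (Suc 0) = insert {#} ((\<lambda>b. {#b#}) ` Basis)"
proof (intro set_eqI iffI)
  fix \<alpha> :: "'a multiset" assume "\<alpha> \<in> multi_indices (Suc 0)"
  then have \<alpha>: "set_mset \<alpha> \<subseteq> Basis" "size \<alpha> \<le> 1" by (auto simp: multi_indices_def)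
  show "\<alpha> \<in> insert {#} ((\<lambda>b. {#b#}) ` Basis)"
  proof (cases "\<alpha> = {#}")
    case False
    then have "size \<alpha> = 1" using \<alpha>(2) by (simp add: nonempty_has_size)
    then obtain b where "\<alpha> = {#b#}" using size_1_singleton_mset by blast
    with \<alpha>(1) show ?thesis by auto
  qed simp
qed (auto simp: multi_indices_def)

section \<open>The trace\<close>

lemma half_space_open: "open half_space"
  unfolding half_space_def by (intro open_Collect_less continuous_intros)

lemma half_space_shift:
  "z \<in> pos_ball d \<Longrightarrow> x \<in> half_space \<Longrightarrow> x + z \<in> half_space"
  "x \<in> half_space \<Longrightarrow> x + (y, 0) \<in> half_space"
  "t \<in> pos_ball d \<Longrightarrow> x \<in> half_space \<Longrightarrow> x + (0, t) \<in> half_space"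
proof -
  show "x \<in> half_space \<Longrightarrow> x + (y, 0) \<in> half_space" by (simp add: half_space_def)
  show "t \<in> pos_ball d \<Longrightarrow> x \<in> half_space \<Longrightarrow> x + (0, t) \<in> half_space" by (auto simp: half_space_def pos_ball_def)
  assume z: "z \<in> pos_ball d" and x: "x \<in> half_space"
  have "(0, 1) \<in> (Basis :: ((real^'n) \<times> real) set)" by (simp add: Basis_prod_def)
  then have "0 < z \<bullet> (0, 1)" using z unfolding pos_ball_def by blast
  with x show "x + z \<in> half_space" by (auto simp: half_space_def inner_prod_def)
qed

definition en :: "(real^'n) \<times> real" where "en = (0, 1)"

lemma en_Basis: "en \<in> Basis"
  by (simp add: en_def Basis_prod_def)

text \<open>Integrating \<open>d/dt (- (1 - t) u(x', t))\<close> over \<open>[0, 1]\<close> recovers \<open>u(x', 0)\<close>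
  from \<open>u\<close> and its normal derivative \<open>v\<close>.\<close>

definition slice :: "(real \<Rightarrow> real) \<Rightarrow> ((real^'n) \<times> real \<Rightarrow> real) \<Rightarrow> real^'n \<Rightarrow> real" where
  "slice a f x = conv (Pair 0) a f (x, 0)"

definition tr :: "((real^'n) \<times> real \<Rightarrow> real) \<Rightarrow> ((real^'n) \<times> real \<Rightarrow> real) \<Rightarrow> real^'n \<Rightarrow> real" where
  "tr u v x = slice (indicat_real {0..1}) u x - slice (\<lambda>t. indicat_real {0..1} t * (1 - t)) v x"

lemma slice_eq: "slice a f x = (LINT t|lborel. a t * f (x, t))"
  by (simp add: slice_def conv_def)

text \<open>A common frame for the two weights in \<open>tr\<close>: bounded by the indicator of the
  unit interval, they have mass at most 1 and ignore points below the boundary.\<close>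

definition slice_weight :: "(real \<Rightarrow> real) \<Rightarrow> bool" where
  "slice_weight a \<longleftrightarrow> a \<in> borel_measurable borel \<and> (\<forall>t. \<bar>a t\<bar> \<le> indicat_real {0..1} t)"

lemma slice_weights: "slice_weight (indicat_real {0..1})" "slice_weight (\<lambda>t. indicat_real {0..1} t * (1 - t))"
  by (auto simp: slice_weight_def indicator_def)

lemma slice_weightD:
  assumes "slice_weight a"
  shows "a \<in> borel_measurable borel" "\<bar>a t\<bar> \<le> indicat_real {0..1} t" "\<bar>a t\<bar> \<le> 1" "bounded {t. a t \<noteq> 0}" "integrable lborel a"
proof -
  show a: "a \<in> borel_measurable borel" and b: "\<bar>a t\<bar> \<le> indicat_real {0..1} t" for t using assms by (auto simp: slice_weight_def)
  show c: "\<bar>a t\<bar> \<le> 1" for t using order_trans[OF b indicator_le_1] .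
  have "a t = 0" if "t \<notin> {0..1}" for t using b[of t] that by simp
  then have "{t. a t \<noteq> 0} \<subseteq> {0..1}" by blast
  then show d: "bounded {t. a t \<noteq> 0}" by (rule bounded_subset[OF bounded_closed_interval])
  show "integrable lborel a" by (rule integrable_kernel[OF a c d])
qed

lemma linear_Pair_0: "linear (Pair 0)" "linear (\<lambda>y. (y, 0))"
  by (auto intro!: linearI simp: scaleR_prod_def)

lemma slice_measurable:
  fixes f :: "(real^'n) \<times> real \<Rightarrow> real"
  assumes "slice_weight a" "f \<in> borel_measurable borel"
  shows "slice a f \<in> borel_measurable borel"
proof -
  have [measurable]: "conv (Pair 0) a f \<in> borel_measurable borel"
    by (rule conv_measurable[OF linear_Pair_0(1) assms(2) slice_weightD(1)[OF assms(1)]])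
  have [measurable]: "(\<lambda>x::real^'n. (x, 0::real)) \<in> borel_measurable borel"
    by (intro borel_measurable_continuous_onI continuous_intros)
  show ?thesis unfolding slice_def[abs_def] by measurable
qed

lemma tr_measurable:
  assumes "u \<in> borel_measurable borel" "v \<in> borel_measurable borel"
  shows "tr u v \<in> borel_measurable borel"
  unfolding tr_def[abs_def] using slice_measurable[OF slice_weights(1) assms(1)] slice_measurable[OF slice_weights(2) assms(2)]
  by measurable

section \<open>Estimates for the trace functional\<close>

lemma product_measurable:
  fixes f :: "('a::euclidean_space) \<times> ('b::euclidean_space) \<Rightarrow> real"
  assumes "f \<in> borel_measurable borel"
  shows "f \<in> borel_measurable (borel \<Otimes>\<^sub>M borel)" "(\<lambda>(t, x). f (x, t)) \<in> borel_measurable (borel \<Otimes>\<^sub>M borel)"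
proof -
  show m[measurable]: "f \<in> borel_measurable (borel \<Otimes>\<^sub>M borel)" using assms by (simp add: borel_prod)
  show "(\<lambda>(t, x). f (x, t)) \<in> borel_measurable (borel \<Otimes>\<^sub>M borel)" by measurable
qed

lemma Npow_Fubini:
  fixes f :: "('a::euclidean_space) \<times> ('b::euclidean_space) \<Rightarrow> real"
  assumes "f \<in> borel_measurable borel"
  shows "(\<integral>\<^sup>+t. Npow p (\<lambda>x. f (x, t)) \<partial>lborel) = Npow p f"
    and "(\<integral>\<^sup>+x. Npow p (\<lambda>t. f (x, t)) \<partial>lborel) = Npow p f"
proof -
  note [measurable] = product_measurable(1)[OF assms]
  have m: "(\<lambda>z. ennreal (\<bar>f z\<bar> powr p)) \<in> borel_measurable (lborel \<Otimes>\<^sub>M lborel)" by measurable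
  show "(\<integral>\<^sup>+t. Npow p (\<lambda>x. f (x, t)) \<partial>lborel) = Npow p f"
    unfolding Npow_def using lborel_pair.nn_integral_snd[OF m] by (simp add: lborel_prod)
  show "(\<integral>\<^sup>+x. Npow p (\<lambda>t. f (x, t)) \<partial>lborel) = Npow p f"
    unfolding Npow_def using lborel.nn_integral_fst[OF m] by (simp add: lborel_prod)
qed

text \<open>Jensen with total mass at most 1, then integration over \<open>t\<close>. The weight
  vanishes for \<open>t < 0\<close> and \<open>t = 0\<close> is a null set, so only values in the
  open half-space enter.\<close>

lemma slice_Npow:
  fixes f :: "(real^'n) \<times> real \<Rightarrow> real"
  assumes a: "slice_weight a" and f: "f \<in> borel_measurable borel" and p: "p \<ge> 1"
  shows "Npow p (slice a f) \<le> Npow p (\<lambda>x. indicat_real half_space x * f x)"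
proof -
  let ?c = "LINT t|lborel. \<bar>a t\<bar>"
  note A = slice_weightD[OF a]
  have "?c \<le> (LINT t|lborel. indicat_real {0..1::real} t)"
    using A(5) by (intro integral_mono A) auto
  then have c: "?c \<le> 1" by simp
  have [measurable]: "half_space \<in> sets borel" using half_space_open by (rule borel_open)
  have "Npow p (slice a f) \<le> ennreal (?c powr (p - 1)) * (\<integral>\<^sup>+t. ennreal \<bar>a t\<bar> * Npow p (\<lambda>x. f (x, t)) \<partial>lborel)"
    unfolding slice_eq[abs_def] by (rule Npow_kernel[OF _ A(5) p refl]) (rule product_measurable(2)[OF f])
  also have "\<dots> \<le> 1 * (\<integral>\<^sup>+t. Npow p (\<lambda>x. indicat_real half_space (x, t) * f (x, t)) \<partial>lborel)"
  proof (rule mult_mono)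
    show "ennreal (?c powr (p - 1)) \<le> 1"
      using powr_mono2[of "p - 1" ?c 1] c p by simp
    show "(\<integral>\<^sup>+t. ennreal \<bar>a t\<bar> * Npow p (\<lambda>x. f (x, t)) \<partial>lborel) \<le> (\<integral>\<^sup>+t. Npow p (\<lambda>x. indicat_real half_space (x, t) * f (x, t)) \<partial>lborel)"
    proof (rule nn_integral_mono_AE)
      show "AE t in lborel. ennreal \<bar>a t\<bar> * Npow p (\<lambda>x. f (x, t)) \<le> Npow p (\<lambda>x. indicat_real half_space (x, t) * f (x, t))"
        using AE_lborel_singleton[of 0]
      proof eventually_elim
        fix t :: real assume "t \<noteq> 0"
        show "ennreal \<bar>a t\<bar> * Npow p (\<lambda>x. f (x, t)) \<le> Npow p (\<lambda>x. indicat_real half_space (x, t) * f (x, t))"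
        proof (cases "t > 0")
          case True
          then have "Npow p (\<lambda>x. indicat_real half_space (x, t) * f (x, t)) = Npow p (\<lambda>x. f (x, t))"
            by (simp add: half_space_def indicator_def)
          moreover have "ennreal \<bar>a t\<bar> * Npow p (\<lambda>x. f (x, t)) \<le> 1 * Npow p (\<lambda>x. f (x, t))"
            using A(3)[of t] by (intro mult_right_mono) auto
          ultimately show ?thesis by simp
        next
          case False
          then have "a t = 0" using A(2)[of t] \<open>t \<noteq> 0\<close> by (auto simp: indicator_def)
          then show ?thesis by simp
        qed
      qed
    qed
  qed auto
  also have "\<dots> = Npow p (\<lambda>x. indicat_real half_space x * f x)"
    using Npow_Fubini(1)[of "\<lambda>x. indicat_real half_space x * f x" p] f by simp
  finally show ?thesis .
qed

lemma AE_slice_integrable: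
  fixes f :: "(real^'n) \<times> real \<Rightarrow> real"
  assumes a: "slice_weight a" and f: "f \<in> borel_measurable borel" and p: "p \<ge> 1" and fin: "Npow p f < \<infinity>"
  shows "AE x in lborel. integrable lborel (\<lambda>t. a t * f (x, t))"
proof -
  note A = slice_weightD[OF a] and [measurable] = product_measurable(1)[OF f]
  have "(\<integral>\<^sup>+x. Npow p (\<lambda>t. f (x, t)) \<partial>lborel) < \<infinity>" using Npow_Fubini(2)[OF f] fin by simp
  then have "AE x in lborel. Npow p (\<lambda>t. f (x, t)) \<noteq> \<infinity>"
    unfolding Npow_def by (intro nn_integral_noteq_infinite) auto
  then show ?thesis
  proof eventually_elim
    case (elim x)
    show ?case
      by (rule integrable_mult_bounded[OF _ A(1) _ p A(3,4)]) (use elim in \<open>auto simp: less_top\<close>)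
  qed
qed

lemma AE_slice_diff:
  fixes f g :: "(real^'n) \<times> real \<Rightarrow> real"
  assumes "slice_weight a" "f \<in> borel_measurable borel" "g \<in> borel_measurable borel" "p \<ge> 1" "Npow p f < \<infinity>" "Npow p g < \<infinity>"
  shows "AE x in lborel. slice a (\<lambda>x. f x - g x) x = slice a f x - slice a g x"
  using AE_slice_integrable[OF assms(1,2,4,5)] AE_slice_integrable[OF assms(1,3,4,6)]
  by eventually_elim (simp add: slice_eq right_diff_distrib)

lemma AE_tr_diff:
  fixes f g :: "(real^'n) \<times> real \<Rightarrow> real"
  assumes "f \<in> borel_measurable borel" "g \<in> borel_measurable borel" "p \<ge> 1" "Npow p f < \<infinity>" "Npow p g < \<infinity>"
    "f' \<in> borel_measurable borel" "g' \<in> borel_measurable borel" "Npow p f' < \<infinity>" "Npow p g' < \<infinity>"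
  shows "AE x in lborel. tr (\<lambda>x. f x - g x) (\<lambda>x. f' x - g' x) x = tr f f' x - tr g g' x"
  using AE_slice_diff[OF slice_weights(1) assms(1-5)] AE_slice_diff[OF slice_weights(2) assms(6,7,3,8,9)]
  by eventually_elim (simp add: tr_def)

text \<open>Each of the two slices obeys \<open>slice_Npow\<close>; with \<open>v\<close> the normal
  derivative of \<open>u\<close> this is the trace inequality.\<close>

lemma tr_Npow:
  assumes "u \<in> borel_measurable borel" "v \<in> borel_measurable borel" "p \<ge> 1"
  shows "Npow p (tr u v) \<le> ennreal (2 powr p) * (Npow p (\<lambda>x. indicat_real half_space x * u x) + Npow p (\<lambda>x. indicat_real half_space x * v x))"
proof -
  have "Npow p (tr u v) \<le> ennreal (2 powr p) * (Npow p (slice (indicat_real {0..1}) u) + Npow p (slice (\<lambda>t. indicat_real {0..1} t * (1 - t)) v))"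
    unfolding tr_def[abs_def] by (intro Npow_diff slice_measurable slice_weights assms)
  also have "\<dots> \<le> ennreal (2 powr p) * (Npow p (\<lambda>x. indicat_real half_space x * u x) + Npow p (\<lambda>x. indicat_real half_space x * v x))"
    by (intro mult_left_mono add_mono slice_Npow slice_weights assms) auto
  finally show ?thesis .
qed

lemma tr_Npow_finite:
  assumes "u \<in> borel_measurable borel" "v \<in> borel_measurable borel" "p \<ge> 1" "Npow p u < \<infinity>" "Npow p v < \<infinity>"
  shows "Npow p (tr u v) < \<infinity>"
proof -
  have "Npow p (tr u v) \<le> ennreal (2 powr p) * (Npow p u + Npow p v)"
    by (rule order_trans[OF tr_Npow[OF assms(1-3)]]) (intro mult_left_mono add_mono Npow_indicator_le assms, simp)
  also have "\<dots> < \<infinity>" using assms by (auto simp: ennreal_mult_less_top)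
  finally show ?thesis .
qed

lemma tr_smooth:
  fixes \<phi> :: "(real^'n) \<times> real \<Rightarrow> real"
  assumes \<phi>: "smooth \<phi>"
  shows "tr \<phi> (pd en \<phi>) x = \<phi> (x, 0)"
proof -
  have D: "((\<lambda>t. \<phi> (x, t)) has_real_derivative pd en \<phi> (x, t)) (at t)" for t
  proof -
    have "((\<lambda>t. \<phi> (x, t)) has_derivative (\<lambda>h. frechet_derivative \<phi> (at (x, t)) (0, h))) (at t)"
      by (rule has_derivative_compose[OF _ smooth_frechet[OF \<phi>], of "Pair x"]) (auto intro!: derivative_eq_intros)
    moreover have "frechet_derivative \<phi> (at (x, t)) (0, h) = h * pd en \<phi> (x, t)" for h
      using linear_scale[OF linear_frechet_derivative[OF smooth_differentiable[OF \<phi>]], of "(x, t)" h en]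
      by (simp add: pd_def en_def)
    ultimately show ?thesis by (simp add: has_field_derivative_def mult_commute_abs mult.commute)
  qed
  have cont: "continuous_on UNIV (\<lambda>t. \<phi> (x, t))" "continuous_on UNIV (\<lambda>t. pd en \<phi> (x, t))"
    by (auto intro!: continuous_on_compose2[OF smooth_continuous[OF \<phi>], of UNIV] continuous_on_compose2[OF smooth_continuous[OF smooth_pd[OF \<phi> en_Basis]], of UNIV] continuous_intros)
  then have ci: "isCont (\<lambda>t. \<phi> (x, t)) t" "isCont (\<lambda>t. pd en \<phi> (x, t)) t" for t
    by (auto simp: continuous_on_eq_continuous_at)
  \<comment> \<open>The primitive \<open>- (1 - t) * \<phi> (x, t)\<close> vanishes at
    \<open>t = 1\<close>, so only the boundary value survives.\<close>
  have "(LINT t|lborel. (\<phi> (x, t) - (1 - t) * pd en \<phi> (x, t)) * indicator {0..1} t) = - (1 - 1) * \<phi> (x, 1) - (- (1 - 0) * \<phi> (x, 0))"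
  proof (rule integral_FTC_Icc_real)
    fix t :: real
    show "((\<lambda>t. - (1 - t) * \<phi> (x, t)) has_real_derivative \<phi> (x, t) - (1 - t) * pd en \<phi> (x, t)) (at t)"
      by (auto intro!: derivative_eq_intros D simp: algebra_simps)
    show "isCont (\<lambda>t. \<phi> (x, t) - (1 - t) * pd en \<phi> (x, t)) t"
      by (intro continuous_intros ci)
  qed simp
  moreover have i1: "integrable lborel (\<lambda>t. indicat_real {0..1} t * \<phi> (x, t))"
    using borel_integrable_compact[OF compact_Icc, of 0 1 "\<lambda>t. \<phi> (x, t)"] continuous_on_subset[OF cont(1)] by auto
  moreover have i2: "integrable lborel (\<lambda>t. indicat_real {0..1} t * (1 - t) * pd en \<phi> (x, t))"
  proof -
    have "continuous_on {0..1} (\<lambda>t. (1 - t) * pd en \<phi> (x, t))"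
      by (intro continuous_intros continuous_on_subset[OF cont(2)]) auto
    from borel_integrable_compact[OF compact_Icc this] show ?thesis by (simp add: mult.assoc)
  qed
  moreover have "(LINT t|lborel. (\<phi> (x, t) - (1 - t) * pd en \<phi> (x, t)) * indicator {0..1} t)
      = (LINT t|lborel. indicat_real {0..1} t * \<phi> (x, t) - indicat_real {0..1} t * (1 - t) * pd en \<phi> (x, t))"
    by (intro Bochner_Integration.integral_cong refl) (simp add: algebra_simps)
  ultimately show ?thesis
    by (simp add: tr_def slice_eq)
qed

section \<open>Existence and uniqueness of the trace\<close>

lemma smooth_Npow_finite:
  assumes "smooth f" "bounded {x. f x \<noteq> 0}" "p \<ge> 1"
  shows "Npow p f < \<infinity>"
  using smooth_bounded[OF assms(1,2)] Npow_bounded_support[OF _ assms(2,3)] by metis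

lemma test_wderivs:
  assumes \<phi>: "\<phi> \<in> test_functions UNIV" and p: "p \<ge> 1"
  obtains F where "wderivs (Suc 0) p \<Omega> \<phi> F" "F {#} = \<phi>" "\<And>b. b \<in> Basis \<Longrightarrow> F {#b#} = pd b \<phi>"
proof -
  define F where "F \<alpha> = (if \<alpha> = {#} then \<phi> else pd (THE b. \<alpha> = {#b#}) \<phi>)" for \<alpha>
  have F: "F {#} = \<phi>" "\<And>b. F {#b#} = pd b \<phi>" by (auto simp: F_def)
  note s = test_functionsD[OF \<phi>]
  have "Npow p \<phi> < \<infinity>" "\<And>b. b \<in> Basis \<Longrightarrow> Npow p (pd b \<phi>) < \<infinity>"
    by (intro smooth_Npow_finite smooth_pd bounded_support_pd s p; assumption)+
  then have "wderivs (Suc 0) p \<Omega> \<phi> F"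
    unfolding wderivs_def multi_indices_1
    by (auto simp: F wd_empty intro!: rep_refl smooth_measurable s smooth_pd wd_smooth)
  with F that show ?thesis by blast
qed

text \<open>On a test function the functional returns the boundary values, so by linearity the
  difference is the functional of \<phi> - u, which the \<open>W^{1,p}\<close> norm
  controls.\<close>

lemma trace_inequality:
  fixes u :: "(real^'n) \<times> real \<Rightarrow> real"
  assumes \<phi>: "\<phi> \<in> test_functions UNIV" and V: "wderivs (Suc 0) p half_space u V" and p: "p \<ge> 1"
    and s: "s = Sobolev_norm 1 p half_space (\<lambda>x. \<phi> x - u x)"
  shows "Npow p (\<lambda>x. \<phi> (x, 0) - tr (V {#}) (V {#en#}) x) \<le> ennreal (2 powr p) * (ennreal (s powr p) + ennreal (s powr p))"
proof -
  obtain F where F: "wderivs (Suc 0) p half_space \<phi> F" "F {#} = \<phi>" "\<And>b. b \<in> Basis \<Longrightarrow> F {#b#} = pd b \<phi>"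
    using test_wderivs[OF \<phi> p] by blast
  have i: "{#} \<in> multi_indices (Suc 0)" "{#en#} \<in> multi_indices (Suc 0)"
    by (auto simp: multi_indices_1 en_Basis)
  note VD = wderivsD[OF V _ p half_space_open] and FD = wderivsD[OF F(1) _ p half_space_open]
  let ?u = "\<lambda>x. F {#} x - V {#} x" and ?v = "\<lambda>x. F {#en#} x - V {#en#} x"
  have "Npow p (\<lambda>x. \<phi> (x, 0) - tr (V {#}) (V {#en#}) x) = Npow p (tr ?u ?v)"
  proof (rule Npow_cong_AE)
    have eq: "\<phi> (x, 0) = tr (F {#}) (F {#en#}) x" for x
      using tr_smooth[OF test_functionsD(1)[OF \<phi>]] F(2) F(3)[OF en_Basis] by simp
    show "AE x in lborel. \<phi> (x, 0) - tr (V {#}) (V {#en#}) x = tr ?u ?v x"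
      unfolding eq
      using AE_tr_diff[OF FD(1)[OF i(1)] VD(1)[OF i(1)] p FD(2)[OF i(1)] VD(2)[OF i(1)] FD(1)[OF i(2)] VD(1)[OF i(2)] FD(2)[OF i(2)] VD(2)[OF i(2)]]
      by eventually_elim simp
  qed
  also have "\<dots> \<le> ennreal (2 powr p) * (Npow p (\<lambda>x. indicat_real half_space x * ?u x) + Npow p (\<lambda>x. indicat_real half_space x * ?v x))"
    using FD(1)[OF i(1)] VD(1)[OF i(1)] FD(1)[OF i(2)] VD(1)[OF i(2)] by (intro tr_Npow p) auto
  also have "\<dots> \<le> ennreal (2 powr p) * (ennreal (s powr p) + ennreal (s powr p))"
    using Npow_le_Sobolev_norm[OF wderivs_diff[OF F(1) V p half_space_open] p half_space_open i(1)]
      Npow_le_Sobolev_norm[OF wderivs_diff[OF F(1) V p half_space_open] p half_space_open i(2)]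
    by (intro mult_left_mono add_mono) (auto simp: s)
  finally show ?thesis .
qed

text \<open>The approximating boundary values converge in \<open>L^p\<close> to \<open>g\<close>, by
  definition, and to the explicit functional, by the trace inequality. Hence all traces of
  \<open>u\<close> agree almost everywhere, whatever sequence produced them.\<close>

lemma has_trace_unique:
  fixes u :: "(real^'n) \<times> real \<Rightarrow> real"
  assumes g: "has_trace p u g" and V: "wderivs (Suc 0) p half_space u V" and p: "p \<ge> 1"
  shows "rep UNIV g (tr (V {#}) (V {#en#}))"
proof -
  have i: "{#} \<in> multi_indices (Suc 0)" "{#en#} \<in> multi_indices (Suc 0)"
    by (auto simp: multi_indices_1 en_Basis)
  note VD = wderivsD[OF V _ p half_space_open]
  let ?T = "tr (V {#}) (V {#en#})"
  have Tm[measurable]: "?T \<in> borel_measurable borel" by (intro tr_measurable VD i)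
  obtain \<phi> where \<phi>: "\<And>n::nat. \<phi> n \<in> test_functions UNIV"
    "(\<lambda>n. Sobolev_norm 1 p half_space (\<lambda>x. \<phi> n x - u x)) \<longlonglongrightarrow> 0"
    "(\<lambda>n. Lp_norm p UNIV (\<lambda>x'. \<phi> n (x', 0) - g x')) \<longlonglongrightarrow> 0" and gL: "g \<in> Lp p UNIV"
    using g unfolding has_trace_def by blast
  have "g \<in> borel_measurable (lebesgue_on UNIV)" using gL by (simp add: Lp_def)
  then obtain g' where g': "g' \<in> borel_measurable borel" "AE x in lborel. x \<in> UNIV \<longrightarrow> g x = g' x"
    using lebesgue_on_borel_rep[of g UNIV] by auto
  then have rg: "rep UNIV g g'" by (simp add: rep_def)
  have g'fin: "Npow p g' < \<infinity>" using Lp_rep(1)[OF rg, of p] gL by simp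
  note [measurable] = g'(1)
  define s where "s n = Sobolev_norm 1 p half_space (\<lambda>x. \<phi> n x - u x)" for n
  define l where "l n = Lp_norm p UNIV (\<lambda>x'. \<phi> n (x', 0) - g x')" for n
  have \<phi>m[measurable]: "(\<lambda>x. \<phi> n (x, 0)) \<in> borel_measurable borel" for n
    by (intro borel_measurable_continuous_onI continuous_on_compose2[OF smooth_continuous[OF test_functionsD(1)[OF \<phi>(1)]], of UNIV] continuous_intros) auto
  have 1: "Npow p (\<lambda>x. \<phi> n (x, 0) - ?T x) \<le> ennreal (2 powr p) * (ennreal (s n powr p) + ennreal (s n powr p))" for n
    by (rule trace_inequality[OF \<phi>(1) V p s_def])
  \<comment> \<open>In \<open>Lp_norm\<close> a divergent integral counts as 0, so finiteness has to
    be known before \<open>Lp_norm\<close> can be converted into \<open>Npow\<close>.\<close>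
  have \<phi>fin: "Npow p (\<lambda>x. \<phi> n (x, 0)) < \<infinity>" for n
  proof -
    have "Npow p (\<lambda>x. \<phi> n (x, 0)) = Npow p (\<lambda>x. (\<phi> n (x, 0) - ?T x) + ?T x)" by simp
    also have "\<dots> \<le> ennreal (2 powr p) * (Npow p (\<lambda>x. \<phi> n (x, 0) - ?T x) + Npow p ?T)"
      by (intro Npow_add p) measurable
    also have "\<dots> < \<infinity>"
      using order.strict_trans1[OF 1[of n]] tr_Npow_finite[OF VD(1)[OF i(1)] VD(1)[OF i(2)] p VD(2)[OF i(1)] VD(2)[OF i(2)]]
      by (auto simp: ennreal_mult_less_top)
    finally show ?thesis .
  qed
  have 2: "Npow p (\<lambda>x. \<phi> n (x, 0) - g' x) = ennreal (l n powr p)" for n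
  proof -
    have r: "rep UNIV (\<lambda>x'. \<phi> n (x', 0) - g x') (\<lambda>x'. \<phi> n (x', 0) - g' x')"
      by (intro rep_diff rep_refl rg) measurable
    have "Npow p (\<lambda>x. \<phi> n (x, 0) - g' x) \<le> ennreal (2 powr p) * (Npow p (\<lambda>x. \<phi> n (x, 0)) + Npow p g')"
      by (intro Npow_diff p) measurable
    also have "\<dots> < \<infinity>" using \<phi>fin g'fin by (auto simp: ennreal_mult_less_top)
    finally show ?thesis using Lp_rep(2)[OF r, of p] p by (simp add: l_def powr_powr less_top)
  qed
  define r where "r n = 2 powr p * (2 powr p * (s n powr p + s n powr p) + l n powr p)" for n
  have 3: "Npow p (\<lambda>x. g' x - ?T x) \<le> ennreal (r n)" for n
  proof -
    have "Npow p (\<lambda>x. g' x - ?T x) = Npow p (\<lambda>x. (\<phi> n (x, 0) - ?T x) - (\<phi> n (x, 0) - g' x))" by (simp add: Npow_def)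
    also have "\<dots> \<le> ennreal (2 powr p) * (Npow p (\<lambda>x. \<phi> n (x, 0) - ?T x) + Npow p (\<lambda>x. \<phi> n (x, 0) - g' x))"
      by (intro Npow_diff p) measurable
    also have "\<dots> \<le> ennreal (2 powr p) * (ennreal (2 powr p) * (ennreal (s n powr p) + ennreal (s n powr p)) + ennreal (l n powr p))"
      using 1 2 by (intro mult_left_mono add_mono) auto
    also have "\<dots> = ennreal (r n)"
      unfolding r_def by (simp only: ennreal_mult ennreal_plus add_nonneg_nonneg mult_nonneg_nonneg powr_ge_zero)
    finally show ?thesis .
  qed
  have "r \<longlonglongrightarrow> 2 powr p * (2 powr p * (0 powr p + 0 powr p) + 0 powr p)"
    unfolding r_def using \<phi>(2,3) p
    by (intro tendsto_intros tendsto_powr') (auto simp: s_def l_def Sobolev_norm_def Lp_norm_def)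
  then have "(\<lambda>n. ennreal (r n)) \<longlonglongrightarrow> 0" using tendsto_ennrealI by fastforce
  then have "Npow p (\<lambda>x. g' x - ?T x) \<le> 0"
    by (rule LIMSEQ_le_const) (use 3 in blast)
  then have "AE x in lborel. g' x - ?T x = 0" by (subst Npow_eq_0_iff[symmetric]) auto
  with g'(2) have "AE x in lborel. g x = ?T x" by eventually_elim auto
  then show ?thesis by (simp add: rep_def)
qed

text \<open>Traces are limits along compactly supported test functions, so their existence rests on
  this density. Cutting off at a large radius gives bounded support; averaging in all variables over
  displacements in the positive orthant then gives smoothness across the boundary.\<close>

lemma Sobolev_1_approx:
  fixes u :: "(real^'n) \<times> real \<Rightarrow> real"
  assumes u: "u \<in> Sobolev (Suc 0) p half_space" and p: "p \<ge> 1" and "e > 0"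
  obtains \<phi> where "\<phi> \<in> test_functions UNIV" "Sobolev_norm 1 p half_space (\<lambda>x. \<phi> x - u x) < e"
proof -
  let ?A = "multi_indices (Suc 0) :: ((real^'n) \<times> real) multiset set"
  obtain V where V: "wderivs (Suc 0) p half_space u V"
    using Sobolev_wderivs[OF u half_space_open p] by metis
  note VD = wderivsD[OF V _ p half_space_open]
  have bi: "{#b#} \<in> ?A" if "b \<in> Basis" for b using that by (simp add: multi_indices_1)
  note ei = empty_in_multi_indices[of "Suc 0"]
  obtain \<delta> where \<delta>: "\<delta> > 0" and small: "\<And>(u :: (real^'n) \<times> real \<Rightarrow> real) V \<Omega>. wderivs (Suc 0) p \<Omega> u V \<Longrightarrow> open \<Omega> \<Longrightarrow>
      (\<And>\<alpha>. \<alpha> \<in> ?A \<Longrightarrow> Npow p (V \<alpha>) \<le> ennreal \<delta>) \<Longrightarrow> Sobolev_norm (Suc 0) p \<Omega> u < e"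
    using Sobolev_norm_small[OF \<open>e > 0\<close> p] by metis
  define D :: real where "D = 2 powr p"
  have D: "D > 0" by (simp add: D_def)
  obtain C where C: "C \<ge> 0 \<and> (\<forall>R. \<exists>\<xi> :: (real^'n) \<times> real \<Rightarrow> real. smooth \<xi> \<and> bounded {x. \<xi> x \<noteq> 0} \<and>
    (\<forall>x. \<bar>\<xi> x\<bar> \<le> 1) \<and> (\<forall>x\<in>cball 0 R. \<xi> x = 1) \<and>
    (\<forall>b\<in>Basis. (\<forall>x. \<bar>pd b \<xi> x\<bar> \<le> C) \<and> (\<forall>x\<in>cball 0 R. pd b \<xi> x = 0)))"
    using cutoff_exists ..
  note C = conjunct1[OF C] conjunct2[OF C, rule_format]
  \<comment> \<open>Chosen so that D (D + C^p) \<tau> = \<delta> / (2 D), the budget of one summand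
    in \<open>Npow_add_half\<close>. The inner \<open>D\<close> comes from |\<xi> - 1| <= 2, and C^p
    from the partials of the cutoff.\<close>
  define \<tau> where "\<tau> = \<delta> / (2 * D * (D * (D + C powr p)))"
  have DC: "D + C powr p > 0" using D by (intro add_pos_nonneg) auto
  have \<tau>: "\<tau> > 0" using \<delta> D DC by (simp add: \<tau>_def)
  have "\<forall>\<alpha>\<in>?A. \<forall>\<^sub>F n in sequentially. Npow p (\<lambda>x. indicat_real (- cball 0 (real n)) x * V \<alpha> x) < ennreal \<tau>"
    using \<tau> by (intro ballI order_tendstoD(2)[OF Npow_tail] VD p) auto
  then have "\<forall>\<^sub>F n in sequentially. \<forall>\<alpha>\<in>?A. Npow p (\<lambda>x. indicat_real (- cball 0 (real n)) x * V \<alpha> x) < ennreal \<tau>"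
    by (rule eventually_ball_finite[OF finite_multi_indices])
  from eventually_happens'[OF sequentially_bot this]
  obtain n where n: "\<And>\<alpha>. \<alpha> \<in> ?A \<Longrightarrow> Npow p (\<lambda>x. indicat_real (- cball 0 (real n)) x * V \<alpha> x) \<le> ennreal \<tau>"
    using less_imp_le by blast
  obtain \<xi> :: "(real^'n) \<times> real \<Rightarrow> real" where \<xi>: "smooth \<xi>" "bounded {x. \<xi> x \<noteq> 0}" "\<And>x. \<bar>\<xi> x\<bar> \<le> 1" "\<And>x. x \<in> cball 0 (real n) \<Longrightarrow> \<xi> x = 1"
    "\<And>b x. b \<in> Basis \<Longrightarrow> \<bar>pd b \<xi> x\<bar> \<le> C" "\<And>b x. b \<in> Basis \<Longrightarrow> x \<in> cball 0 (real n) \<Longrightarrow> pd b \<xi> x = 0"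
    using C(2)[of "real n"] by blast
  \<comment> \<open>The Leibniz rule for the cutoff times \<open>u\<close>; the description operator
    recovers \<open>b\<close> from \<open>{#b#}\<close>.\<close>
  define U where "U \<alpha> x = \<xi> x * V \<alpha> x + (if \<alpha> = {#} then 0 else pd (THE b. \<alpha> = {#b#}) \<xi> x * V {#} x)" for \<alpha> x
  have U0: "U {#} = (\<lambda>x. \<xi> x * V {#} x)" and Ub: "\<And>b. U {#b#} = (\<lambda>x. \<xi> x * V {#b#} x + pd b \<xi> x * V {#} x)"
    by (auto simp: U_def fun_eq_iff)
  have cases: "P \<alpha>" if "\<alpha> \<in> ?A" "P {#}" "\<And>b. b \<in> Basis \<Longrightarrow> P {#b#}" for P \<alpha>
    using that by (auto simp: multi_indices_1)
  have pm: "pd b \<xi> \<in> borel_measurable borel" if "b \<in> Basis" for b by (intro smooth_measurable smooth_pd \<xi> that)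
  have Vm: "V {#} \<in> borel_measurable borel" "\<And>b. b \<in> Basis \<Longrightarrow> V {#b#} \<in> borel_measurable borel"
    using VD(1)[OF ei] VD(1)[OF bi] by auto
  have \<xi>m: "\<xi> \<in> borel_measurable borel" by (rule smooth_measurable[OF \<xi>(1)])
  have Um: "U \<alpha> \<in> borel_measurable borel" if "\<alpha> \<in> ?A" for \<alpha>
    by (rule cases[OF that]) (auto simp: U0 Ub intro!: borel_measurable_add borel_measurable_times pm Vm \<xi>m)
  have UV: "Npow p (\<lambda>x. U \<alpha> x - V \<alpha> x) \<le> ennreal (\<delta> / (2 * D))" if "\<alpha> \<in> ?A" for \<alpha>
  proof -
    have t: "Npow p (\<lambda>x. c * (indicat_real (- cball 0 (real n)) x * V \<alpha> x)) \<le> ennreal (\<bar>c\<bar> powr p * \<tau>)" if "\<alpha> \<in> ?A" for c \<alpha>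
    proof -
      have [measurable]: "- cball (0 :: (real^'n) \<times> real) (real n) \<in> sets borel" "V \<alpha> \<in> borel_measurable borel" using VD(1)[OF that] by auto
      have "Npow p (\<lambda>x. c * (indicat_real (- cball 0 (real n)) x * V \<alpha> x)) = ennreal (\<bar>c\<bar> powr p) * Npow p (\<lambda>x. indicat_real (- cball 0 (real n)) x * V \<alpha> x)"
        by (rule Npow_cmult) measurable
      also have "\<dots> \<le> ennreal (\<bar>c\<bar> powr p) * ennreal \<tau>" by (intro mult_left_mono n that) auto
      finally show ?thesis using \<tau> by (simp add: ennreal_mult)
    qed
    have a: "Npow p (\<lambda>x. (\<xi> x - 1) * V \<alpha> x) \<le> ennreal (D * \<tau>)" if "\<alpha> \<in> ?A" for \<alpha>
    proof -
      have "\<bar>(\<xi> x - 1) * V \<alpha> x\<bar> \<le> \<bar>2 * (indicat_real (- cball 0 (real n)) x * V \<alpha> x)\<bar>" for x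
      proof (cases "x \<in> cball 0 (real n)")
        case True
        then show ?thesis using \<xi>(4) by simp
      next
        case False
        have "\<bar>\<xi> x - 1\<bar> \<le> 2" using \<xi>(3)[of x] by linarith
        with False show ?thesis by (simp add: abs_mult mult_right_mono)
      qed
      then have "Npow p (\<lambda>x. (\<xi> x - 1) * V \<alpha> x) \<le> Npow p (\<lambda>x. 2 * (indicat_real (- cball 0 (real n)) x * V \<alpha> x))"
        using p by (intro Npow_mono) auto
      also have "\<dots> \<le> ennreal (D * \<tau>)" using t[OF that, of 2] by (simp add: D_def)
      finally show ?thesis .
    qed
    have b: "Npow p (\<lambda>x. pd b \<xi> x * V {#} x) \<le> ennreal (C powr p * \<tau>)" if "b \<in> Basis" for b
    proof -
      have "\<bar>pd b \<xi> x * V {#} x\<bar> \<le> \<bar>C * (indicat_real (- cball 0 (real n)) x * V {#} x)\<bar>" for x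
      proof (cases "x \<in> cball 0 (real n)")
        case True
        then show ?thesis using \<xi>(6)[OF that] by simp
      next
        case False
        with \<xi>(5)[OF that, of x] C(1) show ?thesis by (simp add: abs_mult mult_right_mono)
      qed
      then have "Npow p (\<lambda>x. pd b \<xi> x * V {#} x) \<le> Npow p (\<lambda>x. C * (indicat_real (- cball 0 (real n)) x * V {#} x))"
        using p by (intro Npow_mono) auto
      also have "\<dots> \<le> ennreal (C powr p * \<tau>)" using t[OF ei, of C] C(1) by simp
      finally show ?thesis .
    qed
    have bound: "ennreal D * (ennreal (D * \<tau>) + ennreal (C powr p * \<tau>)) = ennreal (\<delta> / (2 * D))"
    proof -
      have "ennreal D * (ennreal (D * \<tau>) + ennreal (C powr p * \<tau>)) = ennreal (D * (D * \<tau> + C powr p * \<tau>))"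
        using D \<tau> by (simp add: ennreal_mult)
      also have "D * (D * \<tau> + C powr p * \<tau>) = \<delta> / (2 * D)"
      proof -
        have "D * (D * \<tau> + C powr p * \<tau>) = (D * (D + C powr p)) * \<tau>" by (simp add: algebra_simps)
        moreover have "D * (D + C powr p) \<noteq> 0" using D DC by simp
        ultimately show ?thesis unfolding \<tau>_def by simp
      qed
      finally show ?thesis .
    qed
    show ?thesis
    proof (rule cases[OF that])
      \<comment> \<open>The artificial summand 0 lets both cases share the estimate
        \<open>bound\<close>.\<close>
      have "Npow p (\<lambda>x. U {#} x - V {#} x) = Npow p (\<lambda>x. (\<xi> x - 1) * V {#} x + 0)"
        by (simp add: U0 left_diff_distrib)
      also have "\<dots> \<le> ennreal D * (Npow p (\<lambda>x. (\<xi> x - 1) * V {#} x) + Npow p (\<lambda>x :: (real^'n) \<times> real. 0))"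
        unfolding D_def using \<xi>m Vm by (intro Npow_add p) auto
      also have "\<dots> \<le> ennreal D * (ennreal (D * \<tau>) + ennreal (C powr p * \<tau>))"
        by (intro mult_left_mono add_mono a ei) (auto simp: Npow_zero)
      finally show "Npow p (\<lambda>x. U {#} x - V {#} x) \<le> ennreal (\<delta> / (2 * D))" unfolding bound .
    next
      fix b :: "(real^'n) \<times> real" assume bB: "b \<in> Basis"
      have "Npow p (\<lambda>x. U {#b#} x - V {#b#} x) = Npow p (\<lambda>x. (\<xi> x - 1) * V {#b#} x + pd b \<xi> x * V {#} x)"
        by (simp add: Ub algebra_simps)
      also have "\<dots> \<le> ennreal D * (Npow p (\<lambda>x. (\<xi> x - 1) * V {#b#} x) + Npow p (\<lambda>x. pd b \<xi> x * V {#} x))"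
        unfolding D_def using \<xi>m Vm(1) Vm(2)[OF bB] pm[OF bB] by (intro Npow_add p) auto
      also have "\<dots> \<le> ennreal D * (ennreal (D * \<tau>) + ennreal (C powr p * \<tau>))"
        by (intro mult_left_mono add_mono a b bi bB) auto
      finally show "Npow p (\<lambda>x. U {#b#} x - V {#b#} x) \<le> ennreal (\<delta> / (2 * D))" unfolding bound .
    qed
  qed
  have Ufin: "Npow p (U \<alpha>) < \<infinity>" if "\<alpha> \<in> ?A" for \<alpha>
  proof -
    have "Npow p (U \<alpha>) = Npow p (\<lambda>x. (U \<alpha> x - V \<alpha> x) + V \<alpha> x)" by simp
    also have "\<dots> \<le> ennreal D * (Npow p (\<lambda>x. U \<alpha> x - V \<alpha> x) + Npow p (V \<alpha>))"
      unfolding D_def using Um[OF that] VD(1)[OF that] by (intro Npow_add p) auto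
    also have "\<dots> < \<infinity>"
      using order.strict_trans1[OF UV[OF that]] VD(2)[OF that] by (auto simp: ennreal_mult_less_top)
    finally show ?thesis .
  qed
  have Uwd: "wd half_space \<alpha> (U {#}) (U \<alpha>)" if "\<alpha> \<in> ?A" for \<alpha>
  proof (rule cases[OF that])
    show "wd half_space {#b#} (U {#}) (U {#b#})" if "b \<in> Basis" for b
      unfolding U0 Ub by (intro wd_mult \<xi> that VD bi ei)
  qed (rule wd_empty)
  have "\<delta> / (2 * D) > 0" using \<delta> D by simp
  then have "\<exists>d>0. \<forall>\<alpha>\<in>?A. \<forall>d' \<kappa>. d' \<le> d \<longrightarrow> mollifier d' \<kappa> \<longrightarrow> Npow p (\<lambda>x. conv (\<lambda>z. z) \<kappa> (U \<alpha>) x - U \<alpha> x) \<le> ennreal (\<delta> / (2 * D))"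
    by (intro mollifier_approx_finite finite_multi_indices linear_ident order_refl Um Ufin p)
  then
  obtain d where d: "d > 0" "\<And>\<alpha> d' \<kappa>. \<alpha> \<in> ?A \<Longrightarrow> d' \<le> d \<Longrightarrow> mollifier d' \<kappa> \<Longrightarrow> Npow p (\<lambda>x. conv (\<lambda>z. z) \<kappa> (U \<alpha>) x - U \<alpha> x) \<le> ennreal (\<delta> / (2 * D))"
    by blast
  obtain \<kappa> :: "(real^'n) \<times> real \<Rightarrow> real" where \<kappa>: "mollifier d \<kappa>" using mollifier_exists[OF d(1)] by auto
  note k = mollifierD[OF \<kappa>]
  define W where "W \<alpha> = conv (\<lambda>z. z) \<kappa> (U \<alpha>)" for \<alpha>
  have Wm: "W \<alpha> \<in> borel_measurable borel" if "\<alpha> \<in> ?A" for \<alpha>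
    unfolding W_def by (intro conv_measurable linear_ident Um that k)
  have U0li: "loc_int (U {#})" by (rule loc_int_Npow[OF Um[OF ei] Ufin[OF ei] p])
  have test: "W {#} \<in> test_functions UNIV"
  proof (rule test_functionsI)
    show "smooth (W {#})" unfolding W_def by (rule smooth_conv[OF k(1,5) U0li])
    obtain B1 where B1: "\<And>x. U {#} x \<noteq> 0 \<Longrightarrow> norm x \<le> B1" using \<xi>(2) unfolding bounded_iff U0 by auto
    have "norm x \<le> B1 + d" if "W {#} x \<noteq> 0" for x
    proof (rule ccontr)
      assume "\<not> norm x \<le> B1 + d"
      then have "\<kappa> z * U {#} (x + z) = 0" for z
        using k(4)[of z] B1[of "x + z"] norm_triangle_ineq2[of x "- z"] by (force simp: pos_ball_def)
      with that show False by (simp add: W_def conv_def)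
    qed
    then show "bounded {x. W {#} x \<noteq> 0}" unfolding bounded_iff by blast
  qed simp
  have WD: "wderivs (Suc 0) p half_space (W {#}) W"
    unfolding wderivs_def
  proof (intro conjI ballI)
    show "rep half_space (W {#}) (W {#})" by (intro rep_refl Wm ei)
    fix \<alpha> assume \<alpha>: "\<alpha> \<in> ?A"
    show "W \<alpha> \<in> borel_measurable borel" by (rule Wm[OF \<alpha>])
    show "Npow p (W \<alpha>) < \<infinity>"
      unfolding W_def by (rule order.strict_trans1[OF mollifier_Npow[OF \<kappa> linear_ident Um[OF \<alpha>] p] Ufin[OF \<alpha>]])
    show "wd half_space \<alpha> (W {#}) (W \<alpha>)"
      unfolding W_def
      by (rule wd_conv[OF linear_ident Um[OF ei] Ufin[OF ei] Um[OF \<alpha>] Ufin[OF \<alpha>] p k(6) half_space_shift(1)[OF k(4)] _ Uwd[OF \<alpha>]])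
         (use \<alpha> in \<open>auto simp: multi_indices_def\<close>)
  qed
  have "Npow p (\<lambda>x. W \<alpha> x - V \<alpha> x) \<le> ennreal \<delta>" if \<alpha>: "\<alpha> \<in> ?A" for \<alpha>
  proof -
    have "Npow p (\<lambda>x. W \<alpha> x - V \<alpha> x) = Npow p (\<lambda>x. (W \<alpha> x - U \<alpha> x) + (U \<alpha> x - V \<alpha> x))" by simp
    also have "\<dots> \<le> ennreal \<delta>"
      using Wm[OF \<alpha>] Um[OF \<alpha>] VD(1)[OF \<alpha>] d(2)[OF \<alpha> order_refl \<kappa>] UV[OF \<alpha>]
      by (intro Npow_add_half p \<delta>) (auto simp: W_def D_def)
    finally show ?thesis .
  qed
  then have "Sobolev_norm (Suc 0) p half_space (\<lambda>x. W {#} x - u x) < e"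
    by (rule small[OF wderivs_diff[OF WD V p half_space_open] half_space_open])
  with that[OF test] show ?thesis by simp
qed

text \<open>The explicit functional is a trace: by the trace inequality, every approximation of
  \<open>u\<close> in \<open>W^{1,p}\<close> by test functions converges on the boundary as
  well.\<close>

lemma has_trace_exists:
  fixes u :: "(real^'n) \<times> real \<Rightarrow> real"
  assumes u: "u \<in> Sobolev (Suc 0) p half_space" and p: "p \<ge> 1"
  shows "\<exists>g. has_trace p u g"
proof -
  obtain V where V: "wderivs (Suc 0) p half_space u V"
    using Sobolev_wderivs[OF u half_space_open p] by metis
  note VD = wderivsD[OF V _ p half_space_open]
  have i: "{#} \<in> multi_indices (Suc 0)" "{#en#} \<in> multi_indices (Suc 0)"
    by (auto simp: multi_indices_1 en_Basis)
  let ?T = "tr (V {#}) (V {#en#})"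
  have Tm[measurable]: "?T \<in> borel_measurable borel" by (intro tr_measurable VD i)
  have Tfin: "Npow p ?T < \<infinity>" by (rule tr_Npow_finite[OF VD(1)[OF i(1)] VD(1)[OF i(2)] p VD(2)[OF i(1)] VD(2)[OF i(2)]])
  have "\<exists>\<phi>. \<phi> \<in> test_functions UNIV \<and> Sobolev_norm 1 p half_space (\<lambda>x. \<phi> x - u x) < inverse (real (Suc n))" for n
    using Sobolev_1_approx[OF u p, of "inverse (real (Suc n))"] by force
  then obtain \<phi> where \<phi>: "\<And>n. \<phi> n \<in> test_functions UNIV" "\<And>n. Sobolev_norm 1 p half_space (\<lambda>x. \<phi> n x - u x) < inverse (real (Suc n))"
    by metis
  define s where "s n = Sobolev_norm 1 p half_space (\<lambda>x. \<phi> n x - u x)" for n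
  have s0: "s n \<ge> 0" for n by (simp add: s_def Sobolev_norm_def)
  have s: "s \<longlonglongrightarrow> 0"
    by (rule tendsto_sandwich[OF _ _ tendsto_const LIMSEQ_inverse_real_of_nat])
       (use s0 \<phi>(2) in \<open>auto simp: s_def less_imp_le\<close>)
  have "has_trace p u ?T"
    unfolding has_trace_def
  proof (intro conjI exI[of _ \<phi>] allI \<phi>)
    show "u \<in> Sobolev 1 p half_space" using u by simp
    show "?T \<in> Lp p UNIV" using Lp_rep(1)[OF rep_refl[OF Tm], of UNIV p] Tfin by simp
    show "(\<lambda>n. Sobolev_norm 1 p half_space (\<lambda>x. \<phi> n x - u x)) \<longlonglongrightarrow> 0" using s unfolding s_def[abs_def] by simp
    have \<phi>m[measurable]: "(\<lambda>x. \<phi> n (x, 0)) \<in> borel_measurable borel" for n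
      by (intro borel_measurable_continuous_onI continuous_on_compose2[OF smooth_continuous[OF test_functionsD(1)[OF \<phi>(1)]], of UNIV] continuous_intros) auto
    define r where "r n = 2 powr p * (s n powr p + s n powr p)" for n
    have r0: "r n \<ge> 0" for n by (simp add: r_def)
    have le: "Lp_norm p UNIV (\<lambda>x'. \<phi> n (x', 0) - ?T x') \<le> r n powr (1 / p)" for n
    proof -
      have rp: "rep UNIV (\<lambda>x'. \<phi> n (x', 0) - ?T x') (\<lambda>x'. \<phi> n (x', 0) - ?T x')" by (intro rep_refl) measurable
      have "Npow p (\<lambda>x. \<phi> n (x, 0) - ?T x) \<le> ennreal (r n)"
        using trace_inequality[OF \<phi>(1) V p s_def]
        unfolding r_def by (simp only: ennreal_mult ennreal_plus add_nonneg_nonneg mult_nonneg_nonneg powr_ge_zero)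
      then have "enn2real (Npow p (\<lambda>x. \<phi> n (x, 0) - ?T x)) \<le> r n" using r0 by (intro enn2real_leI) auto
      then show ?thesis using Lp_rep(2)[OF rp, of p] p by (auto intro!: powr_mono2)
    qed
    have "r \<longlonglongrightarrow> 2 powr p * (0 powr p + 0 powr p)"
      unfolding r_def using s p s0 by (intro tendsto_intros tendsto_powr') auto
    then have "(\<lambda>n. r n powr (1 / p)) \<longlonglongrightarrow> 0 powr (1 / p)"
      using p r0 by (intro tendsto_powr') auto
    then have "(\<lambda>n. r n powr (1 / p)) \<longlonglongrightarrow> 0" by simp
    then show "(\<lambda>n. Lp_norm p UNIV (\<lambda>x'. \<phi> n (x', 0) - ?T x')) \<longlonglongrightarrow> 0"
      by (rule tendsto_sandwich[OF _ _ tendsto_const, rotated 2]) (intro always_eventually allI, simp add: Lp_norm_def, intro always_eventually allI le)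
  qed
  then show ?thesis by blast
qed

text \<open>By existence the choice in \<open>boundary_trace\<close> yields a genuine trace, and by
  uniqueness it agrees with the explicit functional almost everywhere. From here on the trace is
  computed by a formula.\<close>

lemma boundary_trace_rep:
  fixes u :: "(real^'n) \<times> real \<Rightarrow> real"
  assumes V: "wderivs (Suc 0) p half_space u V" and p: "p \<ge> 1"
  shows "rep UNIV (boundary_trace p u) (tr (V {#}) (V {#en#}))"
proof -
  have "\<exists>g. has_trace p u g"
    by (rule has_trace_exists[OF wderivs_Sobolev[OF V p half_space_open] p])
  then have "has_trace p u (boundary_trace p u)" unfolding boundary_trace_def by (rule someI_ex)
  then show ?thesis by (rule has_trace_unique[OF _ V p])
qed

section \<open>Density\<close>

lemma wderivs_mono: "wderivs k p \<Omega> u V \<Longrightarrow> j \<le> k \<Longrightarrow> wderivs j p \<Omega> u V"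
  by (auto simp: wderivs_def multi_indices_def)

lemma wderivs_cong_AE:
  "AE x in lborel. x \<in> \<Omega> \<longrightarrow> u' x = u x \<Longrightarrow> wderivs k p \<Omega> u V \<Longrightarrow> wderivs k p \<Omega> u' V"
  unfolding wderivs_def using rep_AE_trans by blast

text \<open>A slice is itself an average in the normal direction, evaluated at height 0, so the
  commutation of the two partial averages applies.\<close>

lemma slice_conv:
  fixes f :: "(real^'n) \<times> real \<Rightarrow> real"
  assumes a: "slice_weight a" and \<rho>: "mollifier d \<rho>" and f: "loc_int f"
  shows "slice a (conv (\<lambda>y. (y, 0)) \<rho> f) = conv (\<lambda>z. z) \<rho> (slice a f)"
proof
  fix x
  note A = slice_weightD[OF a] and R = mollifierD[OF \<rho>]
  obtain M where M: "\<And>x. \<bar>\<rho> x\<bar> \<le> M" using smooth_bounded[OF R(1,5)] by metis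
  note P = conv_conv_product[OF f R(7) M R(5) A(1) A(3) A(4)]
  have "slice a (conv (\<lambda>y. (y, 0)) \<rho> f) x = conv (\<lambda>y. (y, 0)) \<rho> (conv (Pair 0) a f) (x, 0)"
    unfolding slice_def P ..
  then show "slice a (conv (\<lambda>y. (y, 0)) \<rho> f) x = conv (\<lambda>z. z) \<rho> (slice a f) x"
    by (simp add: conv_def[of "\<lambda>y. (y, 0)"] conv_def[of "\<lambda>z. z"] slice_def)
qed

text \<open>A smooth kernel of bounded support makes the integrand integrable at every point, so
  linearity holds everywhere and not just almost everywhere.\<close>

lemma conv_id_diff:
  assumes "loc_int f" "loc_int g" "smooth K" "bounded {x. K x \<noteq> 0}"
  shows "conv (\<lambda>z. z) K (\<lambda>x. f x - g x) x = conv (\<lambda>z. z) K f x - conv (\<lambda>z. z) K g x"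
  using conv_id_integrable[OF assms(1,3,4)] conv_id_integrable[OF assms(2,3,4)]
  by (simp add: conv_def right_diff_distrib)

text \<open>Both slices commute with the tangential average; linearity of the convolution at every
  point then gives equality everywhere.\<close>

lemma tr_conv:
  fixes u v :: "(real^'n) \<times> real \<Rightarrow> real"
  assumes \<rho>: "mollifier d \<rho>" and u: "u \<in> borel_measurable borel" "Npow p u < \<infinity>"
    and v: "v \<in> borel_measurable borel" "Npow p v < \<infinity>" and p: "p \<ge> 1"
  shows "tr (conv (\<lambda>y. (y, 0)) \<rho> u) (conv (\<lambda>y. (y, 0)) \<rho> v) = conv (\<lambda>z. z) \<rho> (tr u v)"
proof
  fix x
  have "loc_int (slice a f)" if "slice_weight a" "f \<in> borel_measurable borel" "Npow p f < \<infinity>"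
    for a and f :: "(real^'n) \<times> real \<Rightarrow> real"
    using order.strict_trans1[OF order_trans[OF slice_Npow[OF that(1,2) p] Npow_indicator_le[OF p]] that(3)]
    by (rule loc_int_Npow[OF slice_measurable[OF that(1,2)] _ p])
  from conv_id_diff[OF this[OF slice_weights(1) u] this[OF slice_weights(2) v] mollifierD(1,5)[OF \<rho>], of x]
  show "tr (conv (\<lambda>y. (y, 0)) \<rho> u) (conv (\<lambda>y. (y, 0)) \<rho> v) x = conv (\<lambda>z. z) \<rho> (tr u v) x"
    unfolding tr_def[abs_def]
    by (simp add: slice_conv[OF slice_weights(1) \<rho> loc_int_Npow[OF u p]] slice_conv[OF slice_weights(2) \<rho> loc_int_Npow[OF v p]])
qed

text \<open>Derivatives of a mollified function fall on the kernel. Symmetry of the mixed partials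
  of the kernel lets the single enumeration \<open>cs\<close> stand for every enumeration in the
  definition of \<open>wd\<close>.\<close>

lemma wd_mollifier:
  assumes \<rho>: "mollifier d \<rho>" and h: "loc_int h" and cs: "set cs \<subseteq> Basis"
  shows "wd \<Omega> (mset cs) (conv (\<lambda>z. z) \<rho> h) (\<lambda>x. (-1) ^ length cs * conv (\<lambda>z. z) (iter_partial cs \<rho>) h x)"
  unfolding wd_def
proof (intro ballI allI impI)
  fix \<phi> bs assume \<phi>: "\<phi> \<in> test_functions \<Omega>" and bs: "mset bs = mset cs"
  note R = mollifierD[OF \<rho>]
  have bB: "set bs \<subseteq> Basis" using cs mset_eq_setD[OF bs] by simp
  have len: "length bs = length cs" using mset_eq_length[OF bs] .
  have "iter_partial (rev bs) \<rho> = iter_partial cs \<rho>"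
    using bs bB by (intro mollifier_symmetric[OF \<rho>]) auto
  then have "iter_partial (rev bs) (conv (\<lambda>z. z) \<rho> h) = (\<lambda>x. (-1) ^ length cs * conv (\<lambda>z. z) (iter_partial cs \<rho>) h x)"
    using iter_partial_conv[OF R(1,5) h, of "rev bs"] bB len by simp
  then show "(LINT x|lborel. conv (\<lambda>z. z) \<rho> h x * iter_partial bs \<phi> x)
      = (-1) ^ size (mset cs) * (LINT x|lborel. ((-1) ^ length cs * conv (\<lambda>z. z) (iter_partial cs \<rho>) h x) * \<phi> x)"
    using integral_by_parts_iter[OF smooth_conv[OF R(1,5) h] test_functionsD(1,2)[OF \<phi>] bB] len by simp
qed

text \<open>The approximant is \<open>W {#}\<close>. The derivatives of its trace are written as
  \<rho> * (D^\<beta> g) - (D^\<beta> \<rho>) * h, up to the sign from the reflected kernel: they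
  stay on \<open>g\<close>, which has them, and go to the kernel in the part where only an
  \<open>L^p\<close> bound is known.\<close>

lemma smooth_trace_approximation:
  fixes u :: "(real^'n) \<times> real \<Rightarrow> real"
  assumes k: "k \<ge> 1" and p: "p \<ge> 1" and u: "u \<in> Sobolev_trace k l p" and "e > 0"
  shows "\<exists>w. smooth w \<and> w \<in> Sobolev_trace k l p \<and> Sobolev_trace_norm k l p (\<lambda>x. u x - w x) < e"
proof -
  let ?A = "multi_indices k :: ((real^'n) \<times> real) multiset set" and ?B = "multi_indices l :: (real^'n) multiset set"
  let ?t = "boundary_trace p u"
  let ?X = "\<lambda>y::real^'n. (y, 0::real)" and ?Y = "Pair (0::real^'n) :: real \<Rightarrow> _" and ?I = "\<lambda>z::real^'n. z"
  have nX: "norm (?X y) \<le> norm y" and nY: "norm (?Y t) \<le> norm t" for y t by (simp_all add: norm_Pair)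
  obtain V where V: "wderivs k p half_space u V"
    using Sobolev_wderivs[OF _ half_space_open p] u unfolding Sobolev_trace_def by blast
  obtain G where G: "wderivs l p UNIV ?t G"
    using Sobolev_wderivs[OF _ open_UNIV p] u unfolding Sobolev_trace_def by blast
  note VD = wderivsD[OF V _ p half_space_open] and GD = wderivsD[OF G _ p open_UNIV]
  have iA: "{#} \<in> ?A" "{#en#} \<in> ?A" using k by (auto simp: multi_indices_def en_Basis)
  have iB: "{#} \<in> ?B" by (rule empty_in_multi_indices)
  have V1: "wderivs (Suc 0) p half_space u V" using wderivs_mono[OF V] k by simp
  have tV: "rep UNIV ?t (tr (V {#}) (V {#en#}))" by (rule boundary_trace_rep[OF V1 p])
  \<comment> \<open>The two norms that make up \<open>Sobolev_trace_norm\<close> receive e / 2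
    each.\<close>
  obtain \<delta>1 where \<delta>1: "\<delta>1 > 0" and small1: "\<And>(u :: (real^'n) \<times> real \<Rightarrow> real) V \<Omega>. wderivs k p \<Omega> u V \<Longrightarrow> open \<Omega> \<Longrightarrow>
      (\<And>\<alpha>. \<alpha> \<in> ?A \<Longrightarrow> Npow p (V \<alpha>) \<le> ennreal \<delta>1) \<Longrightarrow> Sobolev_norm k p \<Omega> u < e / 2"
    using Sobolev_norm_small[of "e / 2" p] \<open>e > 0\<close> p by (metis half_gt_zero)
  obtain \<delta>2 where \<delta>2: "\<delta>2 > 0" and small2: "\<And>(u :: real^'n \<Rightarrow> real) V \<Omega>. wderivs l p \<Omega> u V \<Longrightarrow> open \<Omega> \<Longrightarrow>
      (\<And>\<alpha>. \<alpha> \<in> ?B \<Longrightarrow> Npow p (V \<alpha>) \<le> ennreal \<delta>2) \<Longrightarrow> Sobolev_norm l p \<Omega> u < e / 2"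
    using Sobolev_norm_small[of "e / 2" p] \<open>e > 0\<close> p by (metis half_gt_zero)
  define D :: real where "D = 2 powr p"
  have D: "D > 0" by (simp add: D_def)
  have q1: "\<delta>1 / (2 * D) > 0" and q2: "\<delta>2 / (2 * D) > 0" using \<delta>1 \<delta>2 D by auto

  \<comment> \<open>The tangential kernel is chosen first: the loss in its derivatives is then absorbed by the normal kernel.\<close>
  have "\<exists>d>0. \<forall>\<alpha>\<in>?A. \<forall>d' \<kappa>. d' \<le> d \<longrightarrow> mollifier d' \<kappa> \<longrightarrow> Npow p (\<lambda>x. conv ?X \<kappa> (V \<alpha>) x - V \<alpha> x) \<le> ennreal (\<delta>1 / (2 * D))"
    by (intro mollifier_approx_finite finite_multi_indices linear_Pair_0 nX VD p q1)
  then obtain d1 where d1: "d1 > 0" "\<And>\<alpha> d' \<kappa>. \<alpha> \<in> ?A \<Longrightarrow> d' \<le> d1 \<Longrightarrow> mollifier d' \<kappa> \<Longrightarrow> Npow p (\<lambda>x. conv ?X \<kappa> (V \<alpha>) x - V \<alpha> x) \<le> ennreal (\<delta>1 / (2 * D))"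
    by blast
  have "\<exists>d>0. \<forall>\<beta>\<in>?B. \<forall>d' \<kappa>. d' \<le> d \<longrightarrow> mollifier d' \<kappa> \<longrightarrow> Npow p (\<lambda>x. conv ?I \<kappa> (G \<beta>) x - G \<beta> x) \<le> ennreal (\<delta>2 / (2 * D))"
    by (intro mollifier_approx_finite finite_multi_indices linear_ident order_refl GD p q2)
  then obtain d2 where d2: "d2 > 0" "\<And>\<beta> d' \<kappa>. \<beta> \<in> ?B \<Longrightarrow> d' \<le> d2 \<Longrightarrow> mollifier d' \<kappa> \<Longrightarrow> Npow p (\<lambda>x. conv ?I \<kappa> (G \<beta>) x - G \<beta> x) \<le> ennreal (\<delta>2 / (2 * D))"
    by blast
  \<comment> \<open>One tangential kernel has to be fine enough for the derivatives of
    \<open>u\<close> up to order \<open>k\<close> and for those of its trace up to order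
    \<open>l\<close>.\<close>
  obtain \<rho> :: "real^'n \<Rightarrow> real" where \<rho>: "mollifier (min d1 d2) \<rho>" using mollifier_exists[of "min d1 d2"] d1(1) d2(1) by auto
  note R = mollifierD[OF \<rho>]
  \<comment> \<open>One enumeration per multi-index is fixed; by \<open>mollifier_symmetric\<close>
    the resulting kernel derivative does not depend on it.\<close>
  define bs where "bs \<beta> = (SOME xs. mset xs = \<beta>)" for \<beta> :: "(real^'n) multiset"
  have bs: "mset (bs \<beta>) = \<beta>" for \<beta> unfolding bs_def by (rule someI_ex[OF ex_mset])
  have bsB: "set (bs \<beta>) \<subseteq> Basis" if "\<beta> \<in> ?B" for \<beta>
    using that bs[of \<beta>] unfolding multi_indices_def by (metis (mono_tags, lifting) mem_Collect_eq set_mset_mset)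
  define d\<rho> where "d\<rho> \<beta> = iter_partial (bs \<beta>) \<rho>" for \<beta>
  have d\<rho>: "smooth (d\<rho> \<beta>)" "bounded {x. d\<rho> \<beta> x \<noteq> 0}" "integrable lborel (d\<rho> \<beta>)" "d\<rho> \<beta> \<in> borel_measurable borel" if "\<beta> \<in> ?B" for \<beta>
  proof -
    show s: "smooth (d\<rho> \<beta>)" "bounded {x. d\<rho> \<beta> x \<noteq> 0}"
      unfolding d\<rho>_def by (intro smooth_iter_partial R bsB that) (intro bounded_support_iter_partial R)
    show "integrable lborel (d\<rho> \<beta>)" by (rule smooth_integrable[OF s])
    show "d\<rho> \<beta> \<in> borel_measurable borel" by (rule smooth_measurable[OF s(1)])
  qed
  \<comment> \<open>A common bound for the factors that \<open>Npow_conv\<close> produces for the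
    kernel derivatives; adding 1 makes it positive.\<close>
  define M where "M = (\<Sum>\<beta>\<in>?B. (LINT z|lborel. \<bar>d\<rho> \<beta> z\<bar>) powr p) + 1"
  have M: "M > 0" unfolding M_def by (intro add_nonneg_pos sum_nonneg) auto
  have M\<beta>: "(LINT z|lborel. \<bar>d\<rho> \<beta> z\<bar>) powr p \<le> M" if "\<beta> \<in> ?B" for \<beta>
  proof -
    have "(LINT z|lborel. \<bar>d\<rho> \<beta> z\<bar>) powr p \<le> (\<Sum>\<beta>\<in>?B. (LINT z|lborel. \<bar>d\<rho> \<beta> z\<bar>) powr p)"
      by (rule member_le_sum[OF that]) (auto intro: finite_multi_indices)
    then show ?thesis by (simp add: M_def)
  qed
  \<comment> \<open>The first entry serves the interior error. The second gives M D (\<tau> +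
    \<tau>) <= \<delta>2 / (2 D), where D (\<tau> + \<tau>) bounds \<open>h\<close> and
    \<open>M\<close> is the loss from differentiating the kernel.\<close>
  define \<tau> where "\<tau> = min (\<delta>1 / (2 * D)) (\<delta>2 / (2 * D) / (M * D * 2))"
  have \<tau>: "\<tau> > 0" using q1 \<delta>2 M D by (simp add: \<tau>_def)
  have "\<exists>d>0. \<forall>\<alpha>\<in>?A. \<forall>d' \<kappa>. d' \<le> d \<longrightarrow> mollifier d' \<kappa> \<longrightarrow> Npow p (\<lambda>x. conv ?Y \<kappa> (V \<alpha>) x - V \<alpha> x) \<le> ennreal \<tau>"
    by (intro mollifier_approx_finite finite_multi_indices linear_Pair_0 nY VD p \<tau>)
  then obtain d3 where d3: "d3 > 0" "\<And>\<alpha> d' \<kappa>. \<alpha> \<in> ?A \<Longrightarrow> d' \<le> d3 \<Longrightarrow> mollifier d' \<kappa> \<Longrightarrow> Npow p (\<lambda>x. conv ?Y \<kappa> (V \<alpha>) x - V \<alpha> x) \<le> ennreal \<tau>"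
    by blast
  obtain \<eta> :: "real \<Rightarrow> real" where \<eta>: "mollifier d3 \<eta>" using mollifier_exists[OF d3(1)] .
  note E = mollifierD[OF \<eta>]

  define U where "U \<alpha> = conv ?Y \<eta> (V \<alpha>)" for \<alpha>
  define W where "W \<alpha> = conv ?X \<rho> (U \<alpha>)" for \<alpha>
  have U: "U \<alpha> \<in> borel_measurable borel" "Npow p (U \<alpha>) < \<infinity>" "Npow p (\<lambda>x. U \<alpha> x - V \<alpha> x) \<le> ennreal \<tau>" if "\<alpha> \<in> ?A" for \<alpha>
  proof -
    show "U \<alpha> \<in> borel_measurable borel" unfolding U_def by (intro conv_measurable linear_Pair_0 VD that E)
    show "Npow p (U \<alpha>) < \<infinity>"
      unfolding U_def by (rule order.strict_trans1[OF mollifier_Npow[OF \<eta> linear_Pair_0(1) VD(1)[OF that] p] VD(2)[OF that]])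
    show "Npow p (\<lambda>x. U \<alpha> x - V \<alpha> x) \<le> ennreal \<tau>" unfolding U_def by (rule d3(2)[OF that order_refl \<eta>])
  qed
  have W: "W \<alpha> \<in> borel_measurable borel" "Npow p (W \<alpha>) < \<infinity>" if "\<alpha> \<in> ?A" for \<alpha>
  proof -
    show "W \<alpha> \<in> borel_measurable borel" unfolding W_def by (intro conv_measurable linear_Pair_0 U that R)
    show "Npow p (W \<alpha>) < \<infinity>"
      unfolding W_def by (rule order.strict_trans1[OF mollifier_Npow[OF \<rho> linear_Pair_0(2) U(1)[OF that] p] U(2)[OF that]])
  qed
  have WD: "wderivs k p half_space (W {#}) W"
    unfolding wderivs_def
  proof (intro conjI ballI)
    show "rep half_space (W {#}) (W {#})" by (intro rep_refl W iA)
    fix \<alpha> assume \<alpha>: "\<alpha> \<in> ?A"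
    then have \<alpha>B: "set_mset \<alpha> \<subseteq> Basis" by (simp add: multi_indices_def)
    show "W \<alpha> \<in> borel_measurable borel" "Npow p (W \<alpha>) < \<infinity>" by (intro W \<alpha>)+
    have "wd half_space \<alpha> (U {#}) (U \<alpha>)"
      unfolding U_def
      by (rule wd_conv[OF linear_Pair_0(1) VD(1,2)[OF iA(1)] VD(1,2)[OF \<alpha>] p E(6) half_space_shift(3)[OF E(4)] \<alpha>B VD(3)[OF \<alpha>]])
    then show "wd half_space \<alpha> (W {#}) (W \<alpha>)"
      unfolding W_def
      by (intro wd_conv[OF linear_Pair_0(2) U(1,2)[OF iA(1)] U(1,2)[OF \<alpha>] p R(6) _ \<alpha>B] half_space_shift(2))
  qed
  \<comment> \<open>The error splits into the tangential average of U - V, which is no larger than U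
    - V itself, and the tangential mollification error of V.\<close>
  have WV: "Npow p (\<lambda>x. V \<alpha> x - W \<alpha> x) \<le> ennreal \<delta>1" if \<alpha>: "\<alpha> \<in> ?A" for \<alpha>
  proof -
    let ?R = "conv ?X \<rho> (V \<alpha>)"
    have Rm: "?R \<in> borel_measurable borel" by (intro conv_measurable linear_Pair_0 VD \<alpha> R)
    have "Npow p (\<lambda>x. W \<alpha> x - ?R x) = Npow p (conv ?X \<rho> (\<lambda>x. U \<alpha> x - V \<alpha> x))"
      unfolding W_def
      using AE_conv_diff[OF linear_Pair_0(2) U(1)[OF \<alpha>] VD(1)[OF \<alpha>] R(6) p U(2)[OF \<alpha>] VD(2)[OF \<alpha>]]
      by (intro Npow_cong_AE) (auto elim: eventually_mono)
    also have "\<dots> \<le> Npow p (\<lambda>x. U \<alpha> x - V \<alpha> x)"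
      using U(1)[OF \<alpha>] VD(1)[OF \<alpha>] by (intro mollifier_Npow[OF \<rho> linear_Pair_0(2) _ p]) auto
    also have "\<dots> \<le> ennreal \<tau>" by (rule U(3)[OF \<alpha>])
    also have "\<dots> \<le> ennreal (\<delta>1 / (2 * D))" by (rule ennreal_leI) (simp add: \<tau>_def)
    finally have 1: "Npow p (\<lambda>x. W \<alpha> x - ?R x) \<le> ennreal (\<delta>1 / (2 * D))" .
    have "Npow p (\<lambda>x. V \<alpha> x - W \<alpha> x) = Npow p (\<lambda>x. (W \<alpha> x - ?R x) + (?R x - V \<alpha> x))"
      by (simp add: Npow_diff_commute[of p "V \<alpha>"])
    also have "\<dots> \<le> ennreal \<delta>1"
      using W(1)[OF \<alpha>] Rm VD(1)[OF \<alpha>] 1 d1(2)[OF \<alpha> _ \<rho>] by (intro Npow_add_half p \<delta>1) (auto simp: D_def)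
    finally show ?thesis .
  qed
  have smooth: "smooth (W {#})"
  proof -
    obtain B where B: "\<And>x. \<bar>\<rho> x\<bar> \<le> B" using smooth_bounded[OF R(1,5)] by metis
    obtain C where C: "\<And>x. \<bar>\<eta> x\<bar> \<le> C" using smooth_bounded[OF E(1,5)] by metis
    have "W {#} = conv (\<lambda>z. z) (\<lambda>z. \<rho> (fst z) * \<eta> (snd z)) (V {#})"
      unfolding W_def U_def by (rule conv_conv_product(1)[OF VD(4)[OF iA(1)] R(7) B R(5) E(7) C E(5)])
    then show ?thesis using smooth_conv[OF mollifier_product_smooth[OF \<rho> \<eta>] VD(4)[OF iA(1)]] by simp
  qed

  \<comment> \<open>\<open>q\<close> is the trace of the normal average of \<open>u\<close>, and
    \<open>h\<close> its defect against the trace of \<open>u\<close>.\<close>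
  define q where "q = tr (U {#}) (U {#en#})"
  define h where "h x = G {#} x - q x" for x
  \<comment> \<open>Differentiating \<open>conv\<close> costs a minus sign for each partial moved to
    the kernel; the power of -1 restores the derivative of the average of \<open>h\<close>.\<close>
  define H where "H \<beta> x = conv ?I \<rho> (G \<beta>) x - (-1) ^ length (bs \<beta>) * conv ?I (d\<rho> \<beta>) h x" for \<beta> x
  have q: "q \<in> borel_measurable borel" "Npow p q < \<infinity>"
    unfolding q_def by (intro tr_measurable U iA) (rule tr_Npow_finite[OF U(1)[OF iA(1)] U(1)[OF iA(2)] p U(2)[OF iA(1)] U(2)[OF iA(2)]])
  have hm: "h \<in> borel_measurable borel" unfolding h_def[abs_def] using q(1) GD(1)[OF iB] by measurable
  \<comment> \<open>Up to sign, \<open>h\<close> is the functional applied to U - V, so it is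
    bounded by the errors of the normal average on \<open>u\<close> and on its normal derivative,
    both at most \<open>\<tau>\<close>.\<close>
  have hN: "Npow p h \<le> ennreal (D * (\<tau> + \<tau>))"
  proof -
    let ?u = "\<lambda>x. U {#} x - V {#} x" and ?v = "\<lambda>x. U {#en#} x - V {#en#} x"
    have "AE x in lborel. ?t x = tr (V {#}) (V {#en#}) x" "AE x in lborel. ?t x = G {#} x"
      using repD(2)[OF tV] repD(2)[OF GD(7)[OF iB]] by auto
    moreover have "AE x in lborel. tr ?u ?v x = tr (U {#}) (U {#en#}) x - tr (V {#}) (V {#en#}) x"
      by (rule AE_tr_diff[OF U(1)[OF iA(1)] VD(1)[OF iA(1)] p U(2)[OF iA(1)] VD(2)[OF iA(1)] U(1)[OF iA(2)] VD(1)[OF iA(2)] U(2)[OF iA(2)] VD(2)[OF iA(2)]])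
    ultimately have "AE x in lborel. h x = - tr ?u ?v x"
      by eventually_elim (simp add: h_def q_def)
    then have "Npow p h = Npow p (tr ?u ?v)"
      using Npow_cong_AE[of h "\<lambda>x. - tr ?u ?v x" p] by (simp add: Npow_minus)
    also have "\<dots> \<le> ennreal (2 powr p) * (Npow p (\<lambda>x. indicat_real half_space x * ?u x) + Npow p (\<lambda>x. indicat_real half_space x * ?v x))"
      using U(1)[OF iA(1)] VD(1)[OF iA(1)] U(1)[OF iA(2)] VD(1)[OF iA(2)] by (intro tr_Npow p) auto
    also have "\<dots> \<le> ennreal D * (ennreal \<tau> + ennreal \<tau>)"
      unfolding D_def by (intro mult_left_mono add_mono order_trans[OF Npow_indicator_le[OF p]] U(3) iA) auto
    also have "\<dots> = ennreal (D * (\<tau> + \<tau>))" using D \<tau> by (simp only: ennreal_mult ennreal_plus add_nonneg_nonneg less_imp_le)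
    finally show ?thesis .
  qed
  have hfin: "Npow p h < \<infinity>" by (rule order.strict_trans1[OF hN]) simp
  have hl: "loc_int h" by (rule loc_int_Npow[OF hm hfin p])
  have ql: "loc_int q" by (rule loc_int_Npow[OF q p])
  have bs0: "bs {#} = []" using bs[of "{#}"] by simp
  \<comment> \<open>With no derivative taken, \<rho> * G - \<rho> * h = \<rho> * q, and tangential
    averaging commutes with the functional.\<close>
  have H0: "H {#} = tr (W {#}) (W {#en#})"
  proof
    fix x
    have "H {#} x = conv ?I \<rho> (G {#}) x - conv ?I \<rho> h x" by (simp add: H_def bs0 d\<rho>_def)
    also have "\<dots> = conv ?I \<rho> (\<lambda>x. G {#} x - h x) x"
      by (rule conv_id_diff[OF GD(4)[OF iB] hl R(1,5), symmetric])
    also have "\<dots> = conv ?I \<rho> q x" by (simp add: h_def)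
    also have "\<dots> = tr (W {#}) (W {#en#}) x"
      unfolding W_def q_def using tr_conv[OF \<rho> U(1,2)[OF iA(1)] U(1,2)[OF iA(2)] p] by simp
    finally show "H {#} x = tr (W {#}) (W {#en#}) x" .
  qed
  have cm: "conv ?I \<rho> (G \<beta>) \<in> borel_measurable borel" "Npow p (conv ?I \<rho> (G \<beta>)) < \<infinity>" if "\<beta> \<in> ?B" for \<beta>
    by (intro conv_measurable linear_ident GD that R)
       (rule order.strict_trans1[OF mollifier_Npow[OF \<rho> linear_ident GD(1)[OF that] p] GD(2)[OF that]])
  define S where "S \<beta> x = (-1) ^ length (bs \<beta>) * conv ?I (d\<rho> \<beta>) h x" for \<beta> x
  have S: "S \<beta> \<in> borel_measurable borel" "Npow p (S \<beta>) \<le> ennreal (\<delta>2 / (2 * D))" if \<beta>: "\<beta> \<in> ?B" for \<beta>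
  proof -
    have m: "conv ?I (d\<rho> \<beta>) h \<in> borel_measurable borel" by (intro conv_measurable linear_ident hm d\<rho> \<beta>)
    then show "S \<beta> \<in> borel_measurable borel" unfolding S_def[abs_def] by measurable
    have "Npow p (S \<beta>) = Npow p (conv ?I (d\<rho> \<beta>) h)"
      unfolding S_def[abs_def] using m by (subst Npow_cmult) (auto simp: power_abs)
    also have "\<dots> \<le> ennreal ((LINT z|lborel. \<bar>d\<rho> \<beta> z\<bar>) powr p) * Npow p h"
      by (rule Npow_conv[OF linear_ident hm d\<rho>(3)[OF \<beta>] p])
    also have "\<dots> \<le> ennreal M * ennreal (D * (\<tau> + \<tau>))"
      by (intro mult_mono hN ennreal_leI M\<beta> \<beta>) auto
    also have "\<dots> = ennreal (M * (D * (\<tau> + \<tau>)))" using M D \<tau> by (simp add: ennreal_mult)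
    also have "\<dots> \<le> ennreal (\<delta>2 / (2 * D))"
    proof (rule ennreal_leI)
      have "\<tau> \<le> \<delta>2 / (2 * D) / (M * D * 2)" by (simp add: \<tau>_def)
      moreover have "0 < M * D * 2" using M D by simp
      ultimately have "\<tau> * (M * D * 2) \<le> \<delta>2 / (2 * D)" using pos_le_divide_eq by blast
      then show "M * (D * (\<tau> + \<tau>)) \<le> \<delta>2 / (2 * D)" by (simp add: algebra_simps)
    qed
    finally show "Npow p (S \<beta>) \<le> ennreal (\<delta>2 / (2 * D))" .
  qed
  have HS: "H \<beta> = (\<lambda>x. conv ?I \<rho> (G \<beta>) x - S \<beta> x)" for \<beta> by (simp add: H_def S_def fun_eq_iff)
  have Sfin: "Npow p (S \<beta>) < \<infinity>" if "\<beta> \<in> ?B" for \<beta> by (rule order.strict_trans1[OF S(2)[OF that]]) simp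
  have Hm: "H \<beta> \<in> borel_measurable borel" if "\<beta> \<in> ?B" for \<beta>
    unfolding HS using cm(1)[OF that] S(1)[OF that] by measurable
  have tW: "rep UNIV (boundary_trace p (W {#})) (H {#})"
    unfolding H0 using boundary_trace_rep[OF wderivs_mono[OF WD] p] k by simp
  have HD: "wderivs l p UNIV (boundary_trace p (W {#})) H"
    unfolding wderivs_def
  proof (intro conjI ballI tW)
    fix \<beta> assume \<beta>: "\<beta> \<in> ?B"
    then have \<beta>B: "set_mset \<beta> \<subseteq> Basis" by (simp add: multi_indices_def)
    show "H \<beta> \<in> borel_measurable borel" by (rule Hm[OF \<beta>])
    have "Npow p (H \<beta>) \<le> ennreal (2 powr p) * (Npow p (conv ?I \<rho> (G \<beta>)) + Npow p (S \<beta>))"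
      unfolding HS by (intro Npow_diff cm S \<beta> p)
    also have "\<dots> < \<infinity>" using cm(2)[OF \<beta>] Sfin[OF \<beta>] by (auto simp: ennreal_mult_less_top)
    finally show "Npow p (H \<beta>) < \<infinity>" .
    \<comment> \<open>In this part the weak derivatives of the trace are mollified; in
      \<open>b\<close> the kernel is differentiated instead.\<close>
    have a: "wd UNIV \<beta> (conv ?I \<rho> (G {#})) (conv ?I \<rho> (G \<beta>))"
      by (rule wd_conv[OF linear_ident GD(1,2)[OF iB] GD(1,2)[OF \<beta>] p R(6) _ \<beta>B GD(3)[OF \<beta>]]) simp
    have "wd UNIV (mset (bs \<beta>)) (conv ?I \<rho> h) (S \<beta>)"
      unfolding S_def[abs_def] d\<rho>_def by (rule wd_mollifier[OF \<rho> hl bsB[OF \<beta>]])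
    moreover have "S {#} = conv ?I \<rho> h" by (simp add: S_def bs0 d\<rho>_def fun_eq_iff)
    ultimately have b: "wd UNIV \<beta> (S {#}) (S \<beta>)" by (simp add: bs)
    show "wd UNIV \<beta> (H {#}) (H \<beta>)"
      unfolding HS
      by (rule wd_diff[OF a b loc_int_Npow[OF cm[OF iB] p] loc_int_Npow[OF S(1)[OF iB] Sfin[OF iB] p]
            loc_int_Npow[OF cm[OF \<beta>] p] loc_int_Npow[OF S(1)[OF \<beta>] Sfin[OF \<beta>] p] \<beta>B])
  qed
  have HG: "Npow p (\<lambda>x. G \<beta> x - H \<beta> x) \<le> ennreal \<delta>2" if \<beta>: "\<beta> \<in> ?B" for \<beta>
  proof -
    \<comment> \<open>The trace error is the mollification error of \<open>G \<beta>\<close> plus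
      the term with the differentiated kernel, each within the budget \<delta>2 / (2 D).\<close>
    have "Npow p (\<lambda>x. G \<beta> x - H \<beta> x) = Npow p (\<lambda>x. (conv ?I \<rho> (G \<beta>) x - G \<beta> x) + - S \<beta> x)"
      by (subst Npow_diff_commute) (simp add: HS Npow_def algebra_simps)
    also have "\<dots> \<le> ennreal \<delta>2"
      using cm(1)[OF \<beta>] GD(1)[OF \<beta>] S[OF \<beta>] d2(2)[OF \<beta> _ \<rho>]
      by (intro Npow_add_half p \<delta>2) (auto simp: D_def Npow_minus)
    finally show ?thesis .
  qed

  have dVW: "wderivs k p half_space (\<lambda>x. u x - W {#} x) (\<lambda>\<alpha> x. V \<alpha> x - W \<alpha> x)"
    by (rule wderivs_diff[OF V WD p half_space_open])
  have n1: "Sobolev_norm k p half_space (\<lambda>x. u x - W {#} x) < e / 2"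
    by (rule small1[OF dVW half_space_open WV])
  \<comment> \<open>The chosen trace of a difference is not by definition the difference of the
    chosen traces; they are compared through the explicit functional, which is linear almost
    everywhere.\<close>
  have "rep UNIV (boundary_trace p (\<lambda>x. u x - W {#} x)) (tr (\<lambda>x. V {#} x - W {#} x) (\<lambda>x. V {#en#} x - W {#en#} x))"
    using boundary_trace_rep[OF wderivs_mono[OF dVW] p] k by simp
  then have "AE x in lborel. boundary_trace p (\<lambda>x. u x - W {#} x) x = tr (\<lambda>x. V {#} x - W {#} x) (\<lambda>x. V {#en#} x - W {#en#} x) x"
    by (auto simp: rep_def)
  moreover have "AE x in lborel. tr (\<lambda>x. V {#} x - W {#} x) (\<lambda>x. V {#en#} x - W {#en#} x) x = tr (V {#}) (V {#en#}) x - tr (W {#}) (W {#en#}) x"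
    by (rule AE_tr_diff[OF VD(1)[OF iA(1)] W(1)[OF iA(1)] p VD(2)[OF iA(1)] W(2)[OF iA(1)] VD(1)[OF iA(2)] W(1)[OF iA(2)] VD(2)[OF iA(2)] W(2)[OF iA(2)]])
  moreover have "AE x in lborel. ?t x = tr (V {#}) (V {#en#}) x" "AE x in lborel. boundary_trace p (W {#}) x = tr (W {#}) (W {#en#}) x"
    using repD(2)[OF tV] repD(2)[OF tW] H0 by auto
  ultimately have "AE x in lborel. x \<in> UNIV \<longrightarrow> boundary_trace p (\<lambda>x. u x - W {#} x) x = ?t x - boundary_trace p (W {#}) x"
    by eventually_elim simp
  then have "wderivs l p UNIV (boundary_trace p (\<lambda>x. u x - W {#} x)) (\<lambda>\<beta> x. G \<beta> x - H \<beta> x)"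
    by (rule wderivs_cong_AE[OF _ wderivs_diff[OF G HD p open_UNIV]])
  then have n2: "Sobolev_norm l p UNIV (boundary_trace p (\<lambda>x. u x - W {#} x)) < e / 2"
    by (rule small2[OF _ open_UNIV HG])
  have "W {#} \<in> Sobolev_trace k l p"
    unfolding Sobolev_trace_def
    using wderivs_Sobolev[OF WD p half_space_open] wderivs_Sobolev[OF HD p open_UNIV] by simp
  moreover have "Sobolev_trace_norm k l p (\<lambda>x. u x - W {#} x) < e"
    using n1 n2 by (simp add: Sobolev_trace_norm_def)
  ultimately show ?thesis using smooth by blast
qed

theorem corollary1:
  fixes k l :: nat and p :: real
  assumes "k \<ge> 1" and "l \<ge> 1" and "p \<ge> 1"
  shows "dense_wrt (Sobolev_trace_norm k l p)
           (smooth_restrictions \<inter> Sobolev_trace k l p)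
           (Sobolev_trace k l p :: ((real^'n) \<times> real \<Rightarrow> real) set)"
  unfolding dense_wrt_def
proof (intro conjI ballI allI impI)
  fix u :: "(real^'n) \<times> real \<Rightarrow> real" and e :: real
  assume "u \<in> Sobolev_trace k l p" and "e > 0"
  from smooth_trace_approximation[OF assms(1,3) this]
  show "\<exists>w\<in>smooth_restrictions \<inter> Sobolev_trace k l p. Sobolev_trace_norm k l p (\<lambda>x. u x - w x) < e"
    by (auto simp: smooth_restrictions_def)
qed simp

end
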